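(* There exists an absolute constant $C>0$ with the following property. Let $A\subset\mathbb{R}^2$ be a finite set with $|A|=N$, and suppose that at most $M$ elements of $A$ lie on any single line and at most $M$ elements of $A$ lie on any single circle. Let $$\mathcal Q=|\{(a,b,c,d)\in A^4 : a\neq b,\ c\neq d,\ \mathcal B(a,b)=\mathcal B(c,d)\}|.$$ Then $$\mathcal Q\le C\left(MN^2+\log^{1/2}(N)\,N^{5/2}\right).$$
   Context: For distinct $a,b\in\mathbb{R}^2$, $\mathcal B(a,b)=\{x\in\mathbb{R}^2:\ |a-x|=|b-x|\}$ denotes the perpendicular bisector of $a$ and $b$ (a line). The quantity $\mathcal Q$ is called the bisector energy of $A$. *)

theory Defs
  imports "HOL-Analysis.Analysis"
begin

definition is_line :: "(real ^ 2) set \<Rightarrow> bool" where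
  "is_line L \<longleftrightarrow> affine L \<and> aff_dim L = 1"

definition is_circle :: "(real ^ 2) set \<Rightarrow> bool" where
  "is_circle S \<longleftrightarrow> (\<exists>c r. 0 < r \<and> S = sphere c r)"

definition perp_bisector :: "real ^ 2 \<Rightarrow> real ^ 2 \<Rightarrow> (real ^ 2) set" where
  "perp_bisector a b = {x. norm (a - x) = norm (b - x)}"

definition bisector_energy :: "(real ^ 2) set \<Rightarrow> nat" where
  "bisector_energy A =
     card {(a, b, c, d). a \<in> A \<and> b \<in> A \<and> c \<in> A \<and> d \<in> A \<and>
       a \<noteq> b \<and> c \<noteq> d \<and> perp_bisector a b = perp_bisector c d}"

end

theory Submission
  imports Defs "HOL-Homology.Invariance_of_Domain"
begin

text \<open>
  Let \<open>L a\<close> be the set of bisectors of \<open>a\<close> and the other points of \<open>A\<close>, and let \<open>n (a, c)\<close> be the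
  number of common lines of \<open>L a\<close> and \<open>L c\<close>. Then \<open>Q\<close> is the sum of the \<open>n (a, c)\<close>, so by
  Cauchy-Schwarz \<open>Q\<^sup>2 \<le> N\<^sup>2 S\<close> with \<open>S\<close> the sum of the \<open>n (a, c)\<^sup>2\<close>, which counts pairs of
  common lines \<open>l, l'\<close>.
  Pairs of parallel lines, or of lines through a common point, send \<open>a\<close> to points of one line or
  of one circle; hence at most \<open>M\<close> of the lines counted by \<open>n (a, c)\<close> are parallel or concurrent.
  With this, the Szemeredi-Trotter theorem shows that, up to \<open>O(M Q)\<close>, most pairs cross at a point
  lying on boundedly many of the common lines. For such a pair the composition of the two reflections
  is a rotation \<open>g\<close> that maps two points of \<open>A\<close>, the images of \<open>a\<close> and \<open>c\<close> under \<open>l\<close>, into \<open>A\<close>,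
  and \<open>g\<close> together with these two points determines the pair up to a bounded factor.
  So \<open>S\<close> is bounded by the sum of the squares of the numbers \<open>r g\<close> of points of \<open>A\<close> that \<open>g\<close> maps
  into \<open>A\<close>, and this sum is \<open>O(N\<^sup>3 log N)\<close> because, for every sufficiently large \<open>s\<close>, at most
  \<open>O(N\<^sup>3 / s\<^sup>2)\<close> rotations have \<open>r g \<ge> s\<close>.

  The last bound is the Guth-Katz bound on the points incident to \<open>s\<close> of the \<open>N\<^sup>2\<close> lines that
  represent the rotations mapping a given point of \<open>A\<close> to another one. As \<open>s\<close> may be assumed large,
  ruled surfaces do not enter: polynomial partitioning puts most incidences on lines inside a
  surface of low degree, and for a polynomial of minimal degree vanishing on these lines either the
  gradient vanishes on all of them, contradicting minimality, or the tangent plane is constant along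
  one of them and contains too many of the lines.
\<close>

text \<open>The delicate point is to recover lines from a rotation: \<open>rotation l l'\<close> and
  the images \<open>u\<close> of \<open>a\<close> and \<open>c\<close> under \<open>l\<close> do not
  give back \<open>l\<close>. They do give the center, so \<open>l\<close> is one of the common
  bisectors of \<open>u\<close> through it. It is thus the pencil of \<open>u\<close>, not that of
  \<open>(a, c)\<close>, that must be small. Pairs with a heavy pencil at \<open>(a, c)\<close> are
  split off too, because this is what allows those heavy only at \<open>u\<close> to be counted. For
  \<open>K\<close> a suitable multiple of the Szemeredi-Trotter constant, each heavy class has at
  most \<open>S / 4\<close> members up to \<open>O(M Q)\<close>, and half of \<open>S\<close>
  remains. The logarithm is a harmonic sum, from layers of size
  \<open>s * N ^ 3 / s\<^sup>2\<close>. It enters \<open>Q\<close> under a square root, while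
  \<open>M Q\<close>, being linear in \<open>Q\<close>, turns into \<open>M N\<^sup>2\<close>.
  "Sufficiently large" means \<open>s \<ge> 12\<close>: pruning keeps \<open>s / 4\<close> lines per
  point, and three lines through a regular point make the surface flat there. Partitioning bisects
  unboundedly many sets at once, hence Borsuk-Ulam in every dimension. For homogeneous Lipschitz
  maps a count of grid cells supplies the missed direction that approximation by smooth maps would
  otherwise provide.\<close>

section \<open>The Borsuk-Ulam theorem for homogeneous Lipschitz maps\<close>

text \<open>Functions supported below \<open>n\<close> model \<open>n\<close>-space, since the dimension must be a variable.\<close>

definition coord_space :: "nat \<Rightarrow> (nat \<Rightarrow> real) set" where
  "coord_space n = {x. \<forall>i\<ge>n. x i = 0}"

text \<open>Homogeneity is demanded for all real \<open>t\<close>, so it includes oddness. The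
  Lipschitz bound serves to count grid cells.\<close>

definition hom_lipschitz :: "nat \<Rightarrow> ((nat \<Rightarrow> real) \<Rightarrow> nat \<Rightarrow> real) \<Rightarrow> bool" where
  "hom_lipschitz n F \<longleftrightarrow>
     (\<exists>K. \<forall>x\<in>coord_space n. \<forall>y\<in>coord_space n. \<forall>i. \<bar>F x i - F y i\<bar> \<le> K * (\<Sum>j<n. \<bar>x j - y j\<bar>)) \<and>
     (\<forall>x\<in>coord_space n. \<forall>t i. F (\<lambda>j. t * x j) i = t * F x i)"

definition unit_sphere :: "nat \<Rightarrow> (nat \<Rightarrow> real) set" where
  "unit_sphere n = {x. (\<Sum>i\<le>n. (x i)\<^sup>2) = 1 \<and> (\<forall>i>n. x i = 0)}"

definition normalized :: "nat \<Rightarrow> (nat \<Rightarrow> real) \<Rightarrow> nat \<Rightarrow> real" where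
  "normalized n y = (\<lambda>i. y i / sqrt (\<Sum>j\<le>n. (y j)\<^sup>2))"

lemma nsphere_eq_unit_sphere: "nsphere n = top_of_set (unit_sphere n)"
  unfolding nsphere unit_sphere_def euclidean_product_topology
  by (rule arg_cong[where f="subtopology euclidean"]) (auto simp: Suc_le_eq)

lemma unit_sphere_subset_coord_space: "unit_sphere n \<subseteq> coord_space (Suc n)"
  by (auto simp: unit_sphere_def coord_space_def)

lemma abs_unit_sphere_le_1: "x \<in> unit_sphere n \<Longrightarrow> \<bar>x i\<bar> \<le> 1"
  using topspace_nsphere_1[of x n i] by (simp add: nsphere_eq_unit_sphere abs_square_le_1)

lemma unit_sphere_nonzero:
  assumes "x \<in> unit_sphere n" shows "x \<noteq> (\<lambda>_. 0)"
  using assms by (auto simp: unit_sphere_def)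

lemma continuous_on_coord [continuous_intros]:
  "continuous_on S (\<lambda>x::nat \<Rightarrow> real. x i)"
  by (rule continuous_on_subset[OF continuous_on_product_coordinates]) simp

lemma compact_unit_sphere: "compact (unit_sphere n)"
proof -
  define C where "C = (PiE UNIV (\<lambda>i::nat. if i \<le> n then {-1..1::real} else {0}))"
  have "compactin (powertop_real UNIV) C"
    unfolding C_def compactin_PiE by auto
  then have cC: "compact C"
    by (simp add: euclidean_product_topology)
  have "closed {x::nat\<Rightarrow>real. (\<Sum>i\<le>n. (x i)\<^sup>2) = 1}"
    by (intro closed_Collect_eq continuous_intros)
  moreover have "unit_sphere n = C \<inter> {x. (\<Sum>i\<le>n. (x i)\<^sup>2) = 1}"
  proof (intro equalityI subsetI)
    fix x assume x: "x \<in> unit_sphere n"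
    have "- 1 \<le> x i \<and> x i \<le> 1" for i using abs_unit_sphere_le_1[OF x, of i] by linarith
    then show "x \<in> C \<inter> {x. (\<Sum>i\<le>n. (x i)\<^sup>2) = 1}"
      using x by (auto simp: C_def unit_sphere_def)
  next
    fix x assume x: "x \<in> C \<inter> {x. (\<Sum>i\<le>n. (x i)\<^sup>2) = 1}"
    have "x i = 0" if "i > n" for i
      using x that by (auto simp: C_def PiE_def Pi_def dest!: spec[of _ i])
    then show "x \<in> unit_sphere n" using x by (auto simp: unit_sphere_def)
  qed
  ultimately show ?thesis
    using cC by (simp add: compact_Int_closed)
qed

lemma hom_lipschitz_continuous_on:
  assumes "hom_lipschitz n F" "S \<subseteq> coord_space n"
  shows "continuous_on S (\<lambda>x. F x i)"
proof -
  obtain K where K: "\<And>x y i. x \<in> coord_space n \<Longrightarrow> y \<in> coord_space n \<Longrightarrow> \<bar>F x i - F y i\<bar> \<le> K * (\<Sum>j<n. \<bar>x j - y j\<bar>)"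
    using assms(1) unfolding hom_lipschitz_def by blast
  show ?thesis
    unfolding continuous_on_def
  proof
    fix a assume a: "a \<in> S"
    have *: "continuous_on S (\<lambda>x. K * (\<Sum>j<n. \<bar>x j - a j\<bar>))"
      by (intro continuous_intros)
    have "tendsto (\<lambda>x. K * (\<Sum>j<n. \<bar>x j - a j\<bar>)) (K * (\<Sum>j<n. \<bar>a j - a j\<bar>)) (at a within S)"
      using * a unfolding continuous_on_def by blast
    then have lim: "tendsto (\<lambda>x. K * (\<Sum>j<n. \<bar>x j - a j\<bar>)) 0 (at a within S)" by simp
    have ev: "\<forall>\<^sub>F x in at a within S. norm (F x i - F a i) \<le> K * (\<Sum>j<n. \<bar>x j - a j\<bar>)"
      unfolding eventually_at_filter
      by (rule always_eventually) (use K a assms(2) in auto)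
    show "tendsto (\<lambda>x. F x i) (F a i) (at a within S)"
      by (rule LIM_zero_cancel[OF Lim_null_comparison[OF ev lim]])
  qed
qed

lemma scale_to_unit_sphere:
  assumes "x \<in> coord_space (Suc n)" "x \<noteq> (\<lambda>_. 0)"
  obtains s u where "s > 0" "u \<in> unit_sphere n" "x = (\<lambda>j. s * u j)"
proof -
  define s where "s = sqrt (\<Sum>i\<le>n. (x i)\<^sup>2)"
  obtain i where i: "x i \<noteq> 0" using assms(2) by fastforce
  then have "i \<le> n" using assms(1) by (auto simp: coord_space_def not_less_eq_eq)
  then have "(\<Sum>i\<le>n. (x i)\<^sup>2) > 0"
    using i by (intro sum_pos2[of _ i]) auto
  then have s: "s > 0" "s\<^sup>2 = (\<Sum>i\<le>n. (x i)\<^sup>2)" by (auto simp: s_def)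
  show ?thesis
  proof (rule that[of s "\<lambda>j. x j / s"])
    have "(\<Sum>i\<le>n. (x i / s)\<^sup>2) = (\<Sum>i\<le>n. (x i)\<^sup>2) / s\<^sup>2"
      by (simp add: power_divide sum_divide_distrib)
    also have "\<dots> = 1" using s by auto
    finally show "(\<lambda>j. x j / s) \<in> unit_sphere n"
      using assms(1) by (auto simp: unit_sphere_def coord_space_def)
  qed (use s in auto)
qed

text \<open>The sum of absolute values has a positive minimum on the compact sphere, and homogeneity
  carries the bound to all of space. It confines preimages of a box to a box.\<close>

lemma hom_lipschitz_lower_bound:
  assumes F: "hom_lipschitz (Suc n) F"
    and nz: "\<And>x. x \<in> coord_space (Suc n) \<Longrightarrow> x \<noteq> (\<lambda>_. 0) \<Longrightarrow> \<exists>i\<le>m. F x i \<noteq> 0"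
  obtains c where "c > 0" "\<And>x j. x \<in> coord_space (Suc n) \<Longrightarrow> c * \<bar>x j\<bar> \<le> (\<Sum>i\<le>m. \<bar>F x i\<bar>)"
proof -
  have cont: "continuous_on (unit_sphere n) (\<lambda>x. \<Sum>i\<le>m. \<bar>F x i\<bar>)"
    by (intro continuous_intros hom_lipschitz_continuous_on[OF F unit_sphere_subset_coord_space])
  have ne: "unit_sphere n \<noteq> {}"
    using in_topspace_nsphere[of n] unfolding nsphere_eq_unit_sphere by auto
  obtain u where u: "u \<in> unit_sphere n" and umin: "\<And>x. x \<in> unit_sphere n \<Longrightarrow> (\<Sum>i\<le>m. \<bar>F u i\<bar>) \<le> (\<Sum>i\<le>m. \<bar>F x i\<bar>)"
    using continuous_attains_inf[OF compact_unit_sphere ne cont] by blast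
  define c where "c = (\<Sum>i\<le>m. \<bar>F u i\<bar>)"
  obtain i where "i \<le> m" "F u i \<noteq> 0"
    using nz[of u] u unit_sphere_nonzero unit_sphere_subset_coord_space by blast
  then have c: "c > 0" unfolding c_def by (intro sum_pos2[of _ i]) auto
  have "c * \<bar>x j\<bar> \<le> (\<Sum>i\<le>m. \<bar>F x i\<bar>)" if x: "x \<in> coord_space (Suc n)" for x j
  proof (cases "x = (\<lambda>_. 0)")
    case True
    then show ?thesis by (simp add: sum_nonneg)
  next
    case False
    obtain s w where sw: "s > 0" "w \<in> unit_sphere n" "x = (\<lambda>j. s * w j)"
      by (rule scale_to_unit_sphere[OF x False])
    have hom: "F x i = s * F w i" for i
      using F sw unit_sphere_subset_coord_space unfolding hom_lipschitz_def by blast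
    have "c * \<bar>x j\<bar> = s * (c * \<bar>w j\<bar>)" using sw by (simp add: abs_mult)
    also have "\<dots> \<le> s * (c * 1)"
      using sw c abs_unit_sphere_le_1[OF sw(2), of j] by (intro mult_left_mono) auto
    also have "\<dots> \<le> s * (\<Sum>i\<le>m. \<bar>F w i\<bar>)"
      using sw umin c_def by auto
    also have "\<dots> = (\<Sum>i\<le>m. \<bar>F x i\<bar>)"
      using sw(1) by (simp add: hom abs_mult sum_distrib_left)
    finally show ?thesis .
  qed
  then show ?thesis using c that by blast
qed

text \<open>If every direction with nonzero last coordinate were attained, then by homogeneity a box in dimension
  \<open>n + 1\<close> would be the Lipschitz image of a box in dimension \<open>n\<close>; counting grid cells excludes this.\<close>

lemma hom_lipschitz_misses_direction:
  assumes F: "hom_lipschitz n F"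
    and nz: "\<And>x. x \<in> coord_space n \<Longrightarrow> x \<noteq> (\<lambda>_. 0) \<Longrightarrow> \<exists>i\<le>n. F x i \<noteq> 0"
  shows "\<exists>v. \<forall>x\<in>coord_space n. (\<forall>i<n. F x i = v i * F x n) \<longrightarrow> x = (\<lambda>_. 0)"
proof (cases n)
  case 0
  then show ?thesis by (auto simp: coord_space_def)
next
  case (Suc n')
  show ?thesis
  proof (rule ccontr)
    assume contra: "\<not> ?thesis"
    have hom: "F (\<lambda>j. t * x j) i = t * F x i" if "x \<in> coord_space n" for x t i
      using F that unfolding hom_lipschitz_def by blast
    obtain K0 where K0: "\<And>x y i. x \<in> coord_space n \<Longrightarrow> y \<in> coord_space n \<Longrightarrow> \<bar>F x i - F y i\<bar> \<le> K0 * (\<Sum>j<n. \<bar>x j - y j\<bar>)"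
      using F unfolding hom_lipschitz_def by blast
    define K where "K = max K0 1"
    have K: "\<bar>F x i - F y i\<bar> \<le> K * (\<Sum>j<n. \<bar>x j - y j\<bar>)" if "x \<in> coord_space n" "y \<in> coord_space n" for x y i
    proof -
      have "K0 * (\<Sum>j<n. \<bar>x j - y j\<bar>) \<le> K * (\<Sum>j<n. \<bar>x j - y j\<bar>)"
        by (intro mult_right_mono) (auto simp: K_def sum_nonneg)
      with K0[OF that, of i] show ?thesis by linarith
    qed
    \<comment> \<open>A nonzero \<open>x\<close> whose image has the direction of \<open>y\<close>
      is rescaled to hit \<open>y\<close>. Its last image coordinate is nonzero, as otherwise the
      whole image would vanish.\<close>
    have surj: "\<exists>x\<in>coord_space n. \<forall>i\<le>n. F x i = y i" if "y n \<noteq> 0" for y :: "nat \<Rightarrow> real"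
    proof -
      obtain x where x: "x \<in> coord_space n" "\<And>i. i < n \<Longrightarrow> F x i = (y i / y n) * F x n" "x \<noteq> (\<lambda>_. 0)"
        using contra by (auto dest!: spec[of _ "\<lambda>i. y i / y n"])
      have Fn: "F x n \<noteq> 0"
      proof
        assume "F x n = 0"
        then have "F x i = 0" if "i \<le> n" for i
          using x(2)[of i] that by (cases "i = n") auto
        then show False using nz[OF x(1,3)] by blast
      qed
      have "F (\<lambda>j. (y n / F x n) * x j) i = y i" if "i \<le> n" for i
        using x that Fn \<open>y n \<noteq> 0\<close> unfolding hom[OF x(1)] by (cases "i = n") auto
      moreover have "(\<lambda>j. (y n / F x n) * x j) \<in> coord_space n"
        using x(1) by (auto simp: coord_space_def)
      ultimately show ?thesis by blast
    qed
    obtain c where c: "c > 0" "\<And>x j. x \<in> coord_space n \<Longrightarrow> c * \<bar>x j\<bar> \<le> (\<Sum>i\<le>n. \<bar>F x i\<bar>)"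
      using hom_lipschitz_lower_bound[of n' F n] F nz Suc by metis
    define C where "C = 2 * real (Suc n) / c"
    define K2 where "K2 = 2 * K * real n"
    have Kpos: "K > 0" and npos: "real n > 0" using Suc by (simp_all add: K_def)
    then have K2: "K2 > 0" by (simp add: K2_def)
    have C0: "C > 0" using c by (simp add: C_def)
    obtain B :: nat where B: "real B > 2 * C * K2" using reals_Archimedean2 by blast
    \<comment> \<open>The \<open>m ^ (n + 1)\<close> grid points have spacing \<open>1 / m\<close>.
      Their preimages lie in \<open>(B * m) ^ n\<close> cells of side \<open>1 / (m * K2)\<close>,
      and the image of a cell varies by at most \<open>1 / (2 * m)\<close> in each coordinate. So no
      two share a cell, which forces \<open>m \<le> B ^ n\<close>.\<close>
    define m where "m = Suc (B ^ n)"
    define T where "T = (PiE {..n} (\<lambda>_. {..<m}))"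
    \<comment> \<open>The last coordinate is shifted by 1 because only targets with nonzero last
      coordinate are known to be attained.\<close>
    define y where "y = (\<lambda>(t::nat\<Rightarrow>nat) i. if i = n then 1 + real (t i) / real m else real (t i) / real m)"
    have yn: "y t n \<noteq> 0" for t
    proof -
      have "y t n \<ge> 1" by (simp add: y_def)
      then show ?thesis by linarith
    qed
    define X where "X = (\<lambda>t. SOME x. x \<in> coord_space n \<and> (\<forall>i\<le>n. F x i = y t i))"
    have X: "X t \<in> coord_space n" "\<And>i. i \<le> n \<Longrightarrow> F (X t) i = y t i" for t
      using someI_ex[of "\<lambda>x. x \<in> coord_space n \<and> (\<forall>i\<le>n. F x i = y t i)"] surj[of "y t", OF yn]
      unfolding X_def by blast+
    have m0: "m > 0" by (simp add: m_def)
    have Xb: "\<bar>X t j\<bar> \<le> C" if t: "t \<in> T" for t j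
    proof -
      have "\<bar>F (X t) i\<bar> \<le> 2" if "i \<le> n" for i
      proof -
        have "t i < m" using t that by (auto simp: T_def)
        then have "real (t i) / real m \<le> 1" by simp
        moreover have "real (t i) / real m \<ge> 0" by simp
        ultimately show ?thesis unfolding X(2)[OF that] y_def by (cases "i = n") simp_all
      qed
      then have "(\<Sum>i\<le>n. \<bar>F (X t) i\<bar>) \<le> (\<Sum>i\<le>n. 2)" by (intro sum_mono) auto
      also have "\<dots> = 2 * real (Suc n)" by simp
      finally have "c * \<bar>X t j\<bar> \<le> 2 * real (Suc n)"
        using c(2)[OF X(1), of t j] by linarith
      then show ?thesis using c(1) by (simp add: C_def field_simps)
    qed
    define \<kappa> where "\<kappa> = (\<lambda>t. restrict (\<lambda>j. nat \<lfloor>(X t j + C) * (real m * K2)\<rfloor>) {..<n})"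
    have mem: "\<kappa> ` T \<subseteq> (PiE {..<n} (\<lambda>_. {..<B * m}))"
    proof (clarsimp simp: \<kappa>_def)
      fix t j assume t: "t \<in> T" and j: "j < n"
      have nn: "0 \<le> (X t j + C) * (real m * K2)"
        using Xb[OF t, of j] K2 by (intro mult_nonneg_nonneg) auto
      have "(X t j + C) * (real m * K2) \<le> (2 * C) * (real m * K2)"
        using Xb[OF t, of j] K2 by (intro mult_right_mono) auto
      also have "\<dots> = (2 * C * K2) * real m" by simp
      also have "\<dots> < real B * real m" using B m0 by (intro mult_strict_right_mono) auto
      finally have "(X t j + C) * (real m * K2) < real (B * m)" by simp
      then show "nat \<lfloor>(X t j + C) * (real m * K2)\<rfloor> < B * m"
        using nn m0 B by (metis floor_less_iff nat_less_iff of_int_of_nat_eq zero_le_floor)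
    qed
    have inj: "inj_on \<kappa> T"
    proof (rule inj_onI)
      fix t t' assume t: "t \<in> T" and t': "t' \<in> T" and eq: "\<kappa> t = \<kappa> t'"
      have close: "\<bar>X t j - X t' j\<bar> \<le> 1 / (real m * K2)" if j: "j < n" for j
      proof -
        have mK: "real m * K2 > 0" using m0 K2 by simp
        have "nat \<lfloor>(X t j + C) * (real m * K2)\<rfloor> = nat \<lfloor>(X t' j + C) * (real m * K2)\<rfloor>"
          using fun_cong[OF eq, of j] j by (simp add: \<kappa>_def)
        moreover have "0 \<le> (X t j + C) * (real m * K2)" "0 \<le> (X t' j + C) * (real m * K2)"
          using Xb[OF t, of j] Xb[OF t', of j] mK by (auto intro!: mult_nonneg_nonneg)
        ultimately have "\<lfloor>(X t j + C) * (real m * K2)\<rfloor> = \<lfloor>(X t' j + C) * (real m * K2)\<rfloor>"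
          by (simp add: eq_nat_nat_iff)
        then have "\<bar>(X t j + C) * (real m * K2) - (X t' j + C) * (real m * K2)\<bar> \<le> 1"
          by linarith
        then have "\<bar>X t j - X t' j\<bar> * (real m * K2) \<le> 1"
          using mK K2 by (simp add: abs_mult flip: left_diff_distrib)
        then show ?thesis using mK by (simp add: field_simps)
      qed
      have "t i = t' i" if i: "i \<le> n" for i
      proof -
        have "\<bar>y t i - y t' i\<bar> \<le> K * (\<Sum>j<n. \<bar>X t j - X t' j\<bar>)"
          using K[OF X(1)[of t] X(1)[of t'], of i] i by (simp add: X(2))
        also have "\<dots> \<le> K * (\<Sum>j<n. 1 / (real m * K2))"
          using close by (intro mult_left_mono sum_mono) (auto simp: K_def)
        also have "\<dots> = (1/2) / real m"
          using Kpos npos m0 by (simp add: K2_def)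
        finally have "\<bar>y t i - y t' i\<bar> \<le> (1/2) / real m" .
        moreover have "y t i - y t' i = (real (t i) - real (t' i)) / real m"
          by (simp add: y_def diff_divide_distrib)
        ultimately have "\<bar>real (t i) - real (t' i)\<bar> / real m \<le> (1/2) / real m"
          by (simp add: abs_divide)
        then have "\<bar>real (t i) - real (t' i)\<bar> \<le> 1/2"
          using m0 by (subst (asm) divide_le_cancel) simp
        then show ?thesis by linarith
      qed
      then show "t = t'"
        using t t' unfolding T_def by (intro PiE_ext) auto
    qed
    have "card T \<le> card (PiE {..<n} (\<lambda>_. {..<B * m}))"
      by (rule card_inj_on_le[OF inj mem]) (auto intro: finite_PiE)
    then have "m ^ Suc n \<le> (B * m) ^ n"
      by (simp add: T_def card_PiE)
    then have "m * m ^ n \<le> B ^ n * m ^ n" by (simp add: power_mult_distrib)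
    then have "m \<le> B ^ n" using m0 by simp
    then show False by (simp add: m_def)
  qed
qed

lemma normalized_in_unit_sphere:
  assumes "y \<in> coord_space (Suc n)" "i \<le> n" "y i \<noteq> 0"
  shows "normalized n y \<in> unit_sphere n"
proof -
  have "(\<Sum>j\<le>n. (y j)\<^sup>2) > 0" using assms by (intro sum_pos2[of _ i]) auto
  then have "(\<Sum>j\<le>n. (normalized n y j)\<^sup>2) = 1"
    by (simp add: normalized_def power_divide flip: sum_divide_distrib)
  then show ?thesis using assms by (auto simp: unit_sphere_def normalized_def coord_space_def)
qed

lemma continuous_on_normalized:
  fixes f :: "'a::topological_space \<Rightarrow> nat \<Rightarrow> real"
  assumes c: "\<And>i. continuous_on S (\<lambda>x. f x i)"
    and nz: "\<And>x. x \<in> S \<Longrightarrow> \<exists>i\<le>n. f x i \<noteq> 0"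
  shows "continuous_on S (\<lambda>x. normalized n (f x))"
proof (rule continuous_on_coordinatewise_then_product)
  fix i
  have "sqrt (\<Sum>j\<le>n. (f x j)\<^sup>2) \<noteq> 0" if x: "x \<in> S" for x
  proof -
    obtain k where "k \<le> n" "f x k \<noteq> 0" using nz x by blast
    then have "(\<Sum>j\<le>n. (f x j)\<^sup>2) > 0" by (intro sum_pos2[of _ k]) auto
    then show ?thesis by simp
  qed
  then show "continuous_on S (\<lambda>x. normalized n (f x) i)"
    unfolding normalized_def by (intro continuous_intros c) auto
qed

lemma normalized_minus: "normalized n (\<lambda>i. - y i) = (\<lambda>i. - normalized n y i)"
  by (simp add: normalized_def)

lemma hom_lipschitz_minus:
  assumes "hom_lipschitz n F" "x \<in> coord_space n"
  shows "F (\<lambda>i. - x i) = (\<lambda>i. - F x i)"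
proof -
  have "F (\<lambda>j. (-1) * x j) i = (-1) * F x i" for i
    using assms unfolding hom_lipschitz_def by blast
  then show ?thesis by auto
qed

text \<open>The direction missed by the equator allows an odd homotopy to a map that preserves the equator,
  to which the degree step of Borsuk applies.\<close>

lemma hom_lipschitz_degree_odd:
  assumes "hom_lipschitz (Suc n) F" "\<And>x. x \<in> coord_space (Suc n) \<Longrightarrow> F x \<in> coord_space (Suc n)"
    and "\<And>x. x \<in> coord_space (Suc n) \<Longrightarrow> x \<noteq> (\<lambda>_. 0) \<Longrightarrow> \<exists>i\<le>n. F x i \<noteq> 0"
  shows "odd (Brouwer_degree2 n (\<lambda>x. normalized n (F x)))"
  using assms
proof (induction n arbitrary: F)
  case 0
  define e where "e = (\<lambda>i::nat. if i = 0 then 1 else 0::real)"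
  have e: "e \<in> coord_space (Suc 0)" "e \<noteq> (\<lambda>_. 0)" by (auto simp: e_def coord_space_def fun_eq_iff)
  have hom: "F (\<lambda>j. t * e j) i = t * F e i" for t i
    using 0(1) e unfolding hom_lipschitz_def by blast
  have us: "x = (\<lambda>j. x 0 * e j)" "(x 0)\<^sup>2 = 1" if "x \<in> unit_sphere 0" for x
    using that by (auto simp: unit_sphere_def e_def fun_eq_iff)
  define b where "b = F e 0"
  have b: "b \<noteq> 0" using 0(3)[OF e] by (auto simp: b_def)
  have Fx: "F x 0 = x 0 * b" "F x i = 0" if "x \<in> unit_sphere 0" "i > 0" for x i
  proof -
    show "F x 0 = x 0 * b" using hom[of "x 0" 0] us(1)[OF that(1)] unfolding b_def by metis
    show "F x i = 0" using 0(2)[of x] that unit_sphere_subset_coord_space by (auto simp: coord_space_def Suc_le_eq)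
  qed
  have nf: "normalized 0 (F x) = (\<lambda>i. if i = 0 then sgn b * x i else x i)" if x: "x \<in> unit_sphere 0" for x
  proof
    fix i
    have "\<bar>x 0\<bar> = 1" using us(2)[OF x] by (auto simp: power2_eq_1_iff)
    then show "normalized 0 (F x) i = (if i = 0 then sgn b * x i else x i)"
      using Fx(1)[OF x zero_less_one] Fx(2)[OF x, of i] x b
      by (cases "i = 0") (auto simp: normalized_def abs_mult sgn_if unit_sphere_def)
  qed
  show ?case
  proof (cases "b > 0")
    case True
    have "Brouwer_degree2 0 (\<lambda>x. normalized 0 (F x)) = Brouwer_degree2 0 id"
      by (rule Brouwer_degree2_eq) (use True nf in \<open>auto simp: nsphere_eq_unit_sphere fun_eq_iff\<close>)
    then show ?thesis by simp
  next
    case False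
    have "Brouwer_degree2 0 (\<lambda>x. normalized 0 (F x)) = Brouwer_degree2 0 (\<lambda>x i. if i = 0 then -x i else x i)"
      by (rule Brouwer_degree2_eq) (use False b nf in \<open>auto simp: nsphere_eq_unit_sphere fun_eq_iff sgn_if\<close>)
    then show ?thesis by (simp add: Brouwer_degree2_reflection)
  qed
next
  case (Suc m)
  note F = Suc.prems(1)
  have sub: "coord_space (Suc m) \<subseteq> coord_space (Suc (Suc m))" by (auto simp: coord_space_def)
  obtain K where K: "\<And>x y i. x \<in> coord_space (Suc (Suc m)) \<Longrightarrow> y \<in> coord_space (Suc (Suc m)) \<Longrightarrow>
      \<bar>F x i - F y i\<bar> \<le> K * (\<Sum>j<Suc (Suc m). \<bar>x j - y j\<bar>)"
    using F unfolding hom_lipschitz_def by blast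
  have hom: "F (\<lambda>j. t * x j) i = t * F x i" if "x \<in> coord_space (Suc (Suc m))" for x t i
    using F that unfolding hom_lipschitz_def by blast
  have K': "\<bar>F x i - F y i\<bar> \<le> K * (\<Sum>j<Suc m. \<bar>x j - y j\<bar>)" if "x \<in> coord_space (Suc m)" "y \<in> coord_space (Suc m)" for x y i
  proof -
    have "x (Suc m) = 0" "y (Suc m) = 0" using that by (auto simp: coord_space_def)
    then show ?thesis using K[of x y i] that sub by auto
  qed
  have F1: "hom_lipschitz (Suc m) F"
    unfolding hom_lipschitz_def using K' hom sub by blast
  obtain v where v: "\<And>x. x \<in> coord_space (Suc m) \<Longrightarrow> (\<And>i. i < Suc m \<Longrightarrow> F x i = v i * F x (Suc m)) \<Longrightarrow> x = (\<lambda>_. 0)"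
    using hom_lipschitz_misses_direction[OF F1] Suc.prems(3) sub by blast
  \<comment> \<open>Projection of the image along the missed direction \<open>(v, 1)\<close> onto
    the first \<open>m + 1\<close> coordinates. On the equatorial space it vanishes only at the
    origin, because that direction is missed.\<close>
  define F' where "F' = (\<lambda>x i. if i \<le> m then F x i - v i * F x (Suc m) else 0)"
  have F': "hom_lipschitz (Suc m) F'"
    unfolding hom_lipschitz_def
  proof
    define V where "V = (\<Sum>i\<le>m. \<bar>v i\<bar>)"
    have "\<bar>F' x i - F' y i\<bar> \<le> ((1 + V) * \<bar>K\<bar>) * (\<Sum>j<Suc m. \<bar>x j - y j\<bar>)"
      if xy: "x \<in> coord_space (Suc m)" "y \<in> coord_space (Suc m)" for x y i
    proof (cases "i \<le> m")
      case True
      let ?s = "\<Sum>j<Suc m. \<bar>x j - y j\<bar>"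
      have s: "?s \<ge> 0" by (simp add: sum_nonneg)
      have b: "\<bar>F x j - F y j\<bar> \<le> \<bar>K\<bar> * ?s" for j
        using K'[OF xy, of j] mult_right_mono[OF abs_ge_self[of K] s] by linarith
      have vV: "\<bar>v i\<bar> \<le> V" unfolding V_def using True by (intro member_le_sum) auto
      have "F' x i - F' y i = (F x i - F y i) - v i * (F x (Suc m) - F y (Suc m))"
        using True by (simp add: F'_def algebra_simps)
      then have "\<bar>F' x i - F' y i\<bar> \<le> \<bar>F x i - F y i\<bar> + \<bar>v i\<bar> * \<bar>F x (Suc m) - F y (Suc m)\<bar>"
        by (metis abs_mult abs_triangle_ineq4)
      also have "\<dots> \<le> \<bar>K\<bar> * ?s + V * (\<bar>K\<bar> * ?s)"
        by (intro add_mono mult_mono b vV) (auto simp: V_def sum_nonneg)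
      finally show ?thesis by (simp add: algebra_simps)
    next
      case False
      have "V \<ge> 0" by (simp add: V_def sum_nonneg)
      then show ?thesis using False by (auto simp: F'_def sum_nonneg intro!: mult_nonneg_nonneg)
    qed
    then show "\<exists>K. \<forall>x\<in>coord_space (Suc m). \<forall>y\<in>coord_space (Suc m). \<forall>i. \<bar>F' x i - F' y i\<bar> \<le> K * (\<Sum>j<Suc m. \<bar>x j - y j\<bar>)"
      by blast
    show "\<forall>x\<in>coord_space (Suc m). \<forall>t i. F' (\<lambda>j. t * x j) i = t * F' x i"
      using hom sub by (auto simp: F'_def algebra_simps)
  qed
  have F'nz: "\<exists>i\<le>m. F' x i \<noteq> 0" if "x \<in> coord_space (Suc m)" "x \<noteq> (\<lambda>_. 0)" for x
    using v[OF that(1)] that(2) by (auto simp: F'_def less_Suc_eq_le)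
  have IH: "odd (Brouwer_degree2 m (\<lambda>x. normalized m (F' x)))"
    by (rule Suc.IH[OF F' _ F'nz]) (auto simp: F'_def coord_space_def)
  \<comment> \<open>At \<open>t = 0\<close> this is \<open>F\<close>. At \<open>t = 1\<close> the
    last coordinate carries the absolute value of \<open>x (Suc m)\<close> as a factor, so the
    equator stays in the equator and is mapped by \<open>F'\<close>. The factor is even in
    \<open>x\<close>, so each stage is odd. It vanishes only for \<open>t = 1\<close> on the
    equator, where the choice of \<open>v\<close> excludes a zero.\<close>
  define h where "h = (\<lambda>(t, x) i. if i \<le> m then F x i - t * v i * F x (Suc m)
      else F x i * (1 - t * (1 - \<bar>x (Suc m)\<bar>)))"
  have hE: "h (t, x) \<in> coord_space (Suc (Suc m))" if "x \<in> coord_space (Suc (Suc m))" for t x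
    using Suc.prems(2)[OF that] by (auto simp: h_def coord_space_def)
  have hnz: "\<exists>i\<le>Suc m. h (t, x) i \<noteq> 0" if t: "t \<in> {0..1}" and x: "x \<in> unit_sphere (Suc m)" for t x
  proof (rule ccontr)
    assume "\<not> ?thesis"
    then have z: "h (t, x) i = 0" if "i \<le> Suc m" for i using that by blast
    have xE: "x \<in> coord_space (Suc (Suc m))" using x unit_sphere_subset_coord_space by blast
    have "F x (Suc m) * (1 - t * (1 - \<bar>x (Suc m)\<bar>)) = 0"
      using z[of "Suc m"] by (simp add: h_def)
    then consider "F x (Suc m) = 0" | "t * (1 - \<bar>x (Suc m)\<bar>) = 1" by auto
    then show False
    proof cases
      case 1
      then have "F x i = 0" if "i \<le> Suc m" for i
        using z[OF that] that by (cases "i = Suc m") (auto simp: h_def)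
      then show False using Suc.prems(3)[OF xE unit_sphere_nonzero[OF x]] by blast
    next
      case 2
      have le: "0 \<le> 1 - \<bar>x (Suc m)\<bar>" "1 - \<bar>x (Suc m)\<bar> \<le> 1" using abs_unit_sphere_le_1[OF x, of "Suc m"] by auto
      have "t * (1 - \<bar>x (Suc m)\<bar>) \<le> 1 * (1 - \<bar>x (Suc m)\<bar>)" "t * (1 - \<bar>x (Suc m)\<bar>) \<le> t * 1"
        using t le by (intro mult_right_mono mult_left_mono; simp)+
      then have "t = 1" "x (Suc m) = 0" using 2 t le by auto
      then have "x \<in> coord_space (Suc m)" "F x i = v i * F x (Suc m)" if "i < Suc m" for i
        using xE z[of i] that by (auto simp: coord_space_def h_def le_Suc_eq Suc_le_eq) (metis Suc_leI le_neq_implies_less)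
      then have "x = (\<lambda>_. 0)" using v[of x] by blast
      then show False using unit_sphere_nonzero[OF x] by blast
    qed
  qed
  let ?S = "unit_sphere (Suc m)"
  have hcont: "continuous_on ({0..1} \<times> ?S) (\<lambda>p. normalized (Suc m) (h p))"
  proof (rule continuous_on_normalized)
    fix i
    have cF: "continuous_on ({0..1::real} \<times> ?S) (\<lambda>p. F (snd p) j)" for j
      by (rule continuous_on_compose2[OF hom_lipschitz_continuous_on[OF F unit_sphere_subset_coord_space] continuous_on_snd[OF continuous_on_id]]) auto
    have cx: "continuous_on ({0..1::real} \<times> ?S) (\<lambda>p. snd p j)" for j
      by (rule continuous_on_compose2[OF continuous_on_product_coordinates continuous_on_snd[OF continuous_on_id]]) auto
    show "continuous_on ({0..1} \<times> ?S) (\<lambda>p. h p i)"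
      unfolding h_def case_prod_unfold
      by (cases "i \<le> m") (auto intro!: continuous_intros cF cx)
  qed (use hnz in auto)
  have him: "normalized (Suc m) (h (t, x)) \<in> ?S" if "t \<in> {0..1}" "x \<in> ?S" for t x
    using hnz[OF that] normalized_in_unit_sphere hE that(2) unit_sphere_subset_coord_space by blast
  define g where "g = (\<lambda>x. normalized (Suc m) (h (1, x)))"
  have hom1: "homotopic_with (\<lambda>x. True) (nsphere (Suc m)) (nsphere (Suc m)) (\<lambda>x. normalized (Suc m) (F x)) g"
    unfolding homotopic_with_def
  proof (intro exI conjI allI)
    show "continuous_map (prod_topology (top_of_set {0..1}) (nsphere (Suc m))) (nsphere (Suc m)) (\<lambda>p. normalized (Suc m) (h p))"
      unfolding nsphere_eq_unit_sphere prod_topology_subtopology_eu continuous_map_subtopology_eu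
      using hcont him by auto
    show "normalized (Suc m) (h (0, x)) = normalized (Suc m) (F x)" for x
      by (rule arg_cong[where f="normalized (Suc m)"]) (auto simp: h_def fun_eq_iff)
  qed (auto simp: g_def)
  then have deg: "Brouwer_degree2 (Suc m) (\<lambda>x. normalized (Suc m) (F x)) = Brouwer_degree2 (Suc m) g"
    by (rule Brouwer_degree2_homotopic)
  have gm: "g x = normalized m (F' x)" if x: "x \<in> unit_sphere m" for x
  proof -
    have "x (Suc m) = 0" using x by (auto simp: unit_sphere_def)
    then have "h (1, x) = F' x"
      using Suc.prems(2)[of x] x unit_sphere_subset_coord_space sub
      by (auto simp: h_def F'_def fun_eq_iff)
    moreover have "F' x (Suc m) = 0" by (simp add: F'_def)
    ultimately show ?thesis by (simp add: g_def normalized_def)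
  qed
  have "even (Brouwer_degree2 (Suc m) g - Brouwer_degree2 (Suc m - Suc 0) g)"
  proof (rule Borsuk_odd_mapping_degree_step)
    show "continuous_map (nsphere (Suc m)) (nsphere (Suc m)) g"
      using hom1 homotopic_with_imp_continuous_maps by blast
    show "(g \<circ> (\<lambda>x i. - x i)) u = ((\<lambda>x i. - x i) \<circ> g) u" if "u \<in> topspace (nsphere (Suc m))" for u
    proof -
      have "u \<in> coord_space (Suc (Suc m))" using that unit_sphere_subset_coord_space by (auto simp: nsphere_eq_unit_sphere)
      then have "h (1, \<lambda>i. - u i) = (\<lambda>i. - h (1, u) i)"
        by (auto simp: h_def hom_lipschitz_minus[OF F] fun_eq_iff)
      then show ?thesis by (simp add: g_def normalized_minus)
    qed
    show "g \<in> topspace (nsphere (Suc m - Suc 0)) \<rightarrow> topspace (nsphere (Suc m - Suc 0))"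
    proof
      fix x assume "x \<in> topspace (nsphere (Suc m - Suc 0))"
      then have x: "x \<in> unit_sphere m" by (simp add: nsphere_eq_unit_sphere)
      obtain i where "i \<le> m" "F' x i \<noteq> 0" using F'nz[of x] x unit_sphere_subset_coord_space unit_sphere_nonzero by blast
      then have "normalized m (F' x) \<in> unit_sphere m" by (intro normalized_in_unit_sphere) (auto simp: F'_def coord_space_def)
      then show "g x \<in> topspace (nsphere (Suc m - Suc 0))" using gm[OF x] by (simp add: nsphere_eq_unit_sphere)
    qed
  qed
  moreover have "Brouwer_degree2 m g = Brouwer_degree2 m (\<lambda>x. normalized m (F' x))"
    by (rule Brouwer_degree2_eq) (use gm in \<open>auto simp: nsphere_eq_unit_sphere\<close>)
  ultimately show ?case using IH deg by auto
qed

text \<open>Without such an \<open>x\<close>, the first \<open>n\<close> coordinates padded by a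
  zero would give, after normalization, a self-map of the \<open>n\<close>-sphere. Its degree is
  odd, but it misses a pole and hence has degree 0.\<close>

theorem Borsuk_Ulam_hom_lipschitz:
  assumes F: "hom_lipschitz (Suc n) F"
  shows "\<exists>x\<in>coord_space (Suc n). x \<noteq> (\<lambda>_. 0) \<and> (\<forall>i<n. F x i = 0)"
proof (rule ccontr)
  assume contra: "\<not> ?thesis"
  define G where "G = (\<lambda>x i. if i < n then F x i else 0)"
  have G: "hom_lipschitz (Suc n) G"
    unfolding hom_lipschitz_def
  proof
    obtain K where K: "\<And>x y i. x \<in> coord_space (Suc n) \<Longrightarrow> y \<in> coord_space (Suc n) \<Longrightarrow>
        \<bar>F x i - F y i\<bar> \<le> K * (\<Sum>j<Suc n. \<bar>x j - y j\<bar>)"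
      using F unfolding hom_lipschitz_def by blast
    have "\<bar>G x i - G y i\<bar> \<le> K * (\<Sum>j<Suc n. \<bar>x j - y j\<bar>)" if "x \<in> coord_space (Suc n)" "y \<in> coord_space (Suc n)" for x y i
    proof (cases "i < n")
      case True
      then show ?thesis using K[OF that, of i] by (simp add: G_def)
    next
      case False
      have "0 \<le> \<bar>F x i - F y i\<bar>" by simp
      then show ?thesis using K[OF that, of i] False by (simp add: G_def)
    qed
    then show "\<exists>K. \<forall>x\<in>coord_space (Suc n). \<forall>y\<in>coord_space (Suc n). \<forall>i. \<bar>G x i - G y i\<bar> \<le> K * (\<Sum>j<Suc n. \<bar>x j - y j\<bar>)"
      by blast
    show "\<forall>x\<in>coord_space (Suc n). \<forall>t i. G (\<lambda>j. t * x j) i = t * G x i"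
      using F unfolding hom_lipschitz_def G_def by auto
  qed
  have Gnz: "\<exists>i\<le>n. G x i \<noteq> 0" if "x \<in> coord_space (Suc n)" "x \<noteq> (\<lambda>_. 0)" for x
    using contra that by (fastforce simp: G_def)
  have "odd (Brouwer_degree2 n (\<lambda>x. normalized n (G x)))"
    by (rule hom_lipschitz_degree_odd[OF G _ Gnz]) (auto simp: G_def coord_space_def)
  moreover have "Brouwer_degree2 n (\<lambda>x. normalized n (G x)) = 0"
  proof (rule Brouwer_degree2_nonsurjective)
    have im: "normalized n (G x) \<in> unit_sphere n" if "x \<in> unit_sphere n" for x
    proof -
      have "x \<in> coord_space (Suc n)" "x \<noteq> (\<lambda>_. 0)" using that unit_sphere_subset_coord_space unit_sphere_nonzero by blast+
      then obtain i where "i \<le> n" "G x i \<noteq> 0" using Gnz by blast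
      then show ?thesis by (intro normalized_in_unit_sphere) (auto simp: G_def coord_space_def)
    qed
    have "continuous_on (unit_sphere n) (\<lambda>x. normalized n (G x))"
      by (rule continuous_on_normalized[OF hom_lipschitz_continuous_on[OF G unit_sphere_subset_coord_space]])
        (use Gnz unit_sphere_subset_coord_space unit_sphere_nonzero in blast)
    then show "continuous_map (nsphere n) (nsphere n) (\<lambda>x. normalized n (G x))"
      using im by (auto simp: nsphere_eq_unit_sphere)
    define e where "e = (\<lambda>i. if i = n then 1 else 0::real)"
    have "(\<Sum>i\<le>n. (e i)\<^sup>2) = (\<Sum>i\<le>n. if i = n then 1 else 0)"
      by (intro sum.cong) (auto simp: e_def)
    then have "e \<in> unit_sphere n" by (auto simp: unit_sphere_def e_def)
    moreover have "e \<notin> (\<lambda>x. normalized n (G x)) ` unit_sphere n"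
    proof
      assume "e \<in> (\<lambda>x. normalized n (G x)) ` unit_sphere n"
      then obtain x where "e n = normalized n (G x) n" by auto
      then show False by (simp add: e_def normalized_def G_def)
    qed
    ultimately show "(\<lambda>x. normalized n (G x)) ` topspace (nsphere n) \<noteq> topspace (nsphere n)"
      by (auto simp: nsphere_eq_unit_sphere)
  qed
  ultimately show False by simp
qed

section \<open>Polynomial partitioning\<close>

text \<open>Here \<open>d\<close> is only an upper bound for the degree. Multiplication by arbitrary
  functionals \<open>x \<bullet> b\<close> keeps the notion free of coordinates, and restriction to
  lines and differentiation follow by induction on the rules.\<close>

inductive poly_fun :: "nat \<Rightarrow> ('a::euclidean_space \<Rightarrow> real) \<Rightarrow> bool" where
  const: "poly_fun d (\<lambda>_. c)"
| inner: "poly_fun d f \<Longrightarrow> poly_fun (Suc d) (\<lambda>x. (x \<bullet> b) * f x)"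
| add: "poly_fun d f \<Longrightarrow> poly_fun d g \<Longrightarrow> poly_fun d (\<lambda>x. f x + g x)"
| Suc: "poly_fun d f \<Longrightarrow> poly_fun (Suc d) f"

lemma poly_fun_mono: "poly_fun d f \<Longrightarrow> d \<le> e \<Longrightarrow> poly_fun e f"
  by (induction e rule: nat_induct) (auto simp: le_Suc_eq intro: poly_fun.Suc)

lemma poly_fun_scale: "poly_fun d f \<Longrightarrow> poly_fun d (\<lambda>x. c * f x)"
proof (induction rule: poly_fun.induct)
  case (inner d f b)
  have "(\<lambda>x. c * ((x \<bullet> b) * f x)) = (\<lambda>x. (x \<bullet> b) * (c * f x))" by (simp add: algebra_simps)
  then show ?case using poly_fun.inner[OF inner.IH, of b] by simp
next
  case (add d f g)
  then show ?case using poly_fun.add by (fastforce simp: distrib_left)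
qed (auto intro: poly_fun.intros)

lemma poly_fun_mult: "poly_fun d f \<Longrightarrow> poly_fun e g \<Longrightarrow> poly_fun (d + e) (\<lambda>x. f x * g x)"
proof (induction arbitrary: e rule: poly_fun.induct)
  case (const d c)
  then show ?case using poly_fun_scale poly_fun_mono le_add2 by blast
next
  case (inner d f b)
  then show ?case using poly_fun.inner[of "d + e" "\<lambda>x. f x * g x" b] by (simp add: mult.assoc)
next
  case (add d f f')
  then show ?case using poly_fun.add[of "d + e" "\<lambda>x. f x * g x" "\<lambda>x. f' x * g x"] by (simp add: distrib_right)
qed (auto intro: poly_fun.intros)

lemma poly_fun_sum:
  "finite I \<Longrightarrow> (\<And>i. i \<in> I \<Longrightarrow> poly_fun d (f i)) \<Longrightarrow> poly_fun d (\<lambda>x. \<Sum>i\<in>I. f i x)"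
  by (induction I rule: finite_induct) (auto intro: poly_fun.intros)

lemma poly_fun_prod:
  "finite I \<Longrightarrow> (\<And>i. i \<in> I \<Longrightarrow> poly_fun (d i) (f i)) \<Longrightarrow> poly_fun (sum d I) (\<lambda>x. \<Prod>i\<in>I. f i x)"
proof (induction I rule: finite_induct)
  case empty
  then show ?case using poly_fun.const[of 0 1] by simp
next
  case (insert i I)
  then show ?case using poly_fun_mult[of "d i" "f i" "sum d I" "\<lambda>x. \<Prod>i\<in>I. f i x"] by simp
qed

lemma poly_fun_inner_power: "poly_fun e (\<lambda>x. (x \<bullet> b) ^ e)"
proof (induction e)
  case 0
  then show ?case using poly_fun.const[of 0 1] by simp
next
  case (Suc e)
  then show ?case using poly_fun.inner[of e _ b] by simp
qed

lemma poly_fun_line: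
  "poly_fun d f \<Longrightarrow> \<exists>q. degree q \<le> d \<and> (\<forall>t. f (x + t *\<^sub>R u) = poly q t)"
proof (induction rule: poly_fun.induct)
  case (const d c)
  show ?case by (intro exI[of _ "[:c:]"]) auto
next
  case (inner d f b)
  then obtain q where q: "degree q \<le> d" "\<And>t. f (x + t *\<^sub>R u) = poly q t" by blast
  have "degree ([:x \<bullet> b, u \<bullet> b:] * q) \<le> degree [:x \<bullet> b, u \<bullet> b:] + degree q" by (rule degree_mult_le)
  also have "\<dots> \<le> Suc d" using q(1) by (simp add: degree_pCons_eq_if)
  finally show ?case
    using q by (intro exI[of _ "[:x \<bullet> b, u \<bullet> b:] * q"]) (auto simp: inner_add_left algebra_simps)
next
  case (add d f g)
  then obtain q r where "degree q \<le> d" "\<And>t. f (x + t *\<^sub>R u) = poly q t"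
     "degree r \<le> d" "\<And>t. g (x + t *\<^sub>R u) = poly r t" by blast
  then show ?case by (intro exI[of _ "q + r"]) (auto intro: degree_add_le)
next
  case (Suc d f)
  then show ?case by (meson le_SucI)
qed

lemma poly_fun_continuous: "poly_fun d f \<Longrightarrow> continuous_on S f"
  by (induction rule: poly_fun.induct) (auto intro!: continuous_intros)

text \<open>\<open>g w\<close> is the derivative in direction \<open>w\<close>, and
  \<open>h u w\<close> is the derivative of \<open>g w\<close> in direction \<open>u\<close>. The
  clause on \<open>d = 0\<close> repairs the truncated \<open>d - 1\<close>: the product rule in the
  case \<open>inner\<close> relies on it to stay within degree \<open>d\<close>.\<close>

lemma poly_fun_derivatives:
  "poly_fun d f \<Longrightarrow> \<exists>g h. (\<forall>x. (f has_derivative (\<lambda>w. g w x)) (at x)) \<and>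
     (\<forall>w x. (g w has_derivative (\<lambda>u. h u w x)) (at x)) \<and> (\<forall>u w x. h u w x = h w u x) \<and>
     (\<forall>w. poly_fun (d - 1) (g w)) \<and> (d = 0 \<longrightarrow> (\<forall>w x. g w x = 0))"
proof (induction rule: poly_fun.induct)
  case (const d c)
  show ?case by (intro exI[of _ "\<lambda>_ _. 0"] exI[of _ "\<lambda>_ _ _. 0"]) (auto intro: poly_fun.const)
next
  case (inner d f b)
  then obtain g h where gh: "\<And>x. (f has_derivative (\<lambda>w. g w x)) (at x)"
     "\<And>w x. (g w has_derivative (\<lambda>u. h u w x)) (at x)" "\<And>u w x. h u w x = h w u x"
     "\<And>w. poly_fun (d - 1) (g w)" "d = 0 \<Longrightarrow> (\<forall>w x. g w x = 0)" by blast
  show ?case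
  proof (intro exI conjI allI impI)
    show "((\<lambda>x. x \<bullet> b * f x) has_derivative (\<lambda>w. (w \<bullet> b) * f x + (x \<bullet> b) * g w x)) (at x)" for x
      by (rule derivative_eq_intros gh(1) | simp add: algebra_simps)+
    show "((\<lambda>x. (w \<bullet> b) * f x + (x \<bullet> b) * g w x) has_derivative
        (\<lambda>u. (w \<bullet> b) * g u x + (u \<bullet> b) * g w x + (x \<bullet> b) * h u w x)) (at x)" for w x
      by (rule derivative_eq_intros gh(1) gh(2) | simp add: algebra_simps)+
    show "(w \<bullet> b) * g u x + (u \<bullet> b) * g w x + (x \<bullet> b) * h u w x
        = (u \<bullet> b) * g w x + (w \<bullet> b) * g u x + (x \<bullet> b) * h w u x" for u w x
      using gh(3)[of u w x] by simp
    have "poly_fun d (\<lambda>x. (x \<bullet> b) * g w x)" for w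
    proof (cases d)
      case 0
      then show ?thesis using gh(5) poly_fun.const[of d 0] by simp
    next
      case (Suc d')
      then show ?thesis using poly_fun.inner[OF gh(4)[of w], of b] by simp
    qed
    then show "poly_fun (Suc d - 1) (\<lambda>x. (w \<bullet> b) * f x + (x \<bullet> b) * g w x)" for w
      using poly_fun.add[OF poly_fun_scale[OF inner.hyps]] by simp
  qed auto
next
  case (add d f f')
  then obtain g h where gh: "\<And>x. (f has_derivative (\<lambda>w. g w x)) (at x)"
     "\<And>w x. (g w has_derivative (\<lambda>u. h u w x)) (at x)" "\<And>u w x. h u w x = h w u x"
     "\<And>w. poly_fun (d - 1) (g w)" "d = 0 \<Longrightarrow> (\<forall>w x. g w x = 0)" by blast
  obtain g' h' where gh': "\<And>x. (f' has_derivative (\<lambda>w. g' w x)) (at x)"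
     "\<And>w x. (g' w has_derivative (\<lambda>u. h' u w x)) (at x)" "\<And>u w x. h' u w x = h' w u x"
     "\<And>w. poly_fun (d - 1) (g' w)" "d = 0 \<Longrightarrow> (\<forall>w x. g' w x = 0)" using add by blast
  show ?case
  proof (intro exI conjI allI impI)
    show "((\<lambda>x. f x + f' x) has_derivative (\<lambda>w. g w x + g' w x)) (at x)" for x
      by (intro has_derivative_add gh gh')
    show "((\<lambda>x. g w x + g' w x) has_derivative (\<lambda>u. h u w x + h' u w x)) (at x)" for w x
      by (intro has_derivative_add gh gh')
    show "h u w x + h' u w x = h w u x + h' w u x" for u w x
      using gh(3)[of u w x] gh'(3)[of u w x] by simp
    show "poly_fun (d - 1) (\<lambda>x. g w x + g' w x)" for w
      by (intro poly_fun.add gh gh')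
  qed (use gh gh' in auto)
next
  case (Suc d f)
  then obtain g h where gh: "\<And>x. (f has_derivative (\<lambda>w. g w x)) (at x)"
     "\<And>w x. (g w has_derivative (\<lambda>u. h u w x)) (at x)" "\<And>u w x. h u w x = h w u x"
     "\<And>w. poly_fun (d - 1) (g w)" by blast
  have "poly_fun (Suc d - 1) (g w)" for w using poly_fun_mono[OF gh(4)[of w], of d] by simp
  then show ?case using gh by blast
qed

text \<open>On the line through \<open>x\<close> and \<open>y\<close> both functions restrict to
  nonzero univariate polynomials, whose product is nonzero.\<close>

lemma poly_fun_mult_nonzero:
  assumes f: "poly_fun d f" "f x \<noteq> 0" and g: "poly_fun e g" "g y \<noteq> 0"
  shows "\<exists>z. f z * g z \<noteq> 0"
proof -
  obtain q where q: "\<And>t. f (x + t *\<^sub>R (y - x)) = poly q t" using poly_fun_line[OF f(1)] by blast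
  obtain r where r: "\<And>t. g (x + t *\<^sub>R (y - x)) = poly r t" using poly_fun_line[OF g(1)] by blast
  have "poly q 0 \<noteq> 0" using q[of 0] f(2) by simp
  moreover have "poly r 1 \<noteq> 0" using r[of 1] g(2) by simp
  ultimately have "q * r \<noteq> 0" by auto
  then obtain t where "poly (q * r) t \<noteq> 0" using poly_all_0_iff_0 by blast
  then show ?thesis using q[of t] r[of t] by (intro exI[of _ "x + t *\<^sub>R (y - x)"]) auto
qed

lemma poly_fun_prod_nonzero:
  "finite I \<Longrightarrow> (\<And>i. i \<in> I \<Longrightarrow> poly_fun (d i) (f i) \<and> (\<exists>x. f i x \<noteq> 0)) \<Longrightarrow> \<exists>x. (\<Prod>i\<in>I. f i x) \<noteq> 0"
proof (induction I rule: finite_induct)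
  case (insert i I)
  obtain x where "(\<Prod>i\<in>I. f i x) \<noteq> 0" using insert by blast
  moreover have "poly_fun (sum d I) (\<lambda>x. \<Prod>i\<in>I. f i x)" using insert by (intro poly_fun_prod) auto
  moreover obtain y where "poly_fun (d i) (f i)" "f i y \<noteq> 0" using insert.prems by blast
  ultimately show ?case using poly_fun_mult_nonzero insert.hyps by (metis (no_types, lifting) prod.insert)
qed auto

section \<open>The ham sandwich theorem for finite sets\<close>

definition clamp_abs :: "real \<Rightarrow> real \<Rightarrow> real" where
  "clamp_abs h t = max (- h) (min h t)"

lemma clamp_abs_lipschitz: "\<bar>clamp_abs h t - clamp_abs h' t'\<bar> \<le> \<bar>h - h'\<bar> + \<bar>t - t'\<bar>"
  unfolding clamp_abs_def by (auto simp: max_def min_def abs_if)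

text \<open>Truncation at level \<open>h\<close> is a Lipschitz substitute for the sign. It is
  homogeneous, also for negative \<open>s\<close>, once the level is scaled along with the value;
  hence the level will be proportional to the size of the coefficient vector.\<close>

lemma clamp_abs_scale:
  assumes "h \<ge> 0"
  shows "clamp_abs (\<bar>s\<bar> * h) (s * t) = s * clamp_abs h t"
proof (cases "s \<ge> 0")
  case True
  then show ?thesis unfolding clamp_abs_def by (simp add: max_mult_distrib_left min_mult_distrib_left)
next
  case False
  have "s * h \<le> 0" using False assms by (simp add: mult_nonpos_nonneg)
  moreover have "s * clamp_abs h t = min (- (s * h)) (max (s * h) (s * t))"
    using False unfolding clamp_abs_def by (simp add: max_mult_distrib_left min_mult_distrib_left)
  moreover have "clamp_abs (\<bar>s\<bar> * h) (s * t) = max (s * h) (min (- (s * h)) (s * t))"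
    using False by (simp add: clamp_abs_def)
  moreover have "max a (min (- a) b) = min (- a) (max a b)" if "a \<le> 0" for a b :: real
    using that by (auto simp: min_def max_def)
  ultimately show ?thesis by simp
qed

text \<open>The truncated values, summed over each \<open>S i\<close>, form a homogeneous Lipschitz
  map of the coefficients. At a common zero, points with value above \<open>\<epsilon>\<close>
  contribute the full level and every other point at least its negative, so the former are at most
  half.\<close>

lemma ham_sandwich_approx:
  fixes f :: "nat \<Rightarrow> 'a \<Rightarrow> real" and S :: "nat \<Rightarrow> 'a set"
  assumes fin: "\<And>i. i < n \<Longrightarrow> finite (S i)" and e: "\<epsilon> > 0"
  shows "\<exists>c\<in>unit_sphere n. \<forall>i<n. 2 * card {x \<in> S i. (\<Sum>k\<le>n. c k * f k x) > \<epsilon>} \<le> card (S i) \<and>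
     2 * card {x \<in> S i. (\<Sum>k\<le>n. c k * f k x) < - \<epsilon>} \<le> card (S i)"
proof -
  \<comment> \<open>On the unit sphere the sum \<open>nn c\<close> of \<open>n + 1\<close> absolute
    values is at most \<open>n + 1\<close>, so the truncation level \<open>\<delta> * nn c\<close>
    does not exceed \<open>\<epsilon>\<close>.\<close>
  define \<delta> where "\<delta> = \<epsilon> / real (Suc n)"
  have \<delta>: "\<delta> > 0" using e by (simp add: \<delta>_def)
  define P where "P = (\<lambda>c x. \<Sum>k\<le>n. c k * f k x)"
  define nn where "nn = (\<lambda>c::nat\<Rightarrow>real. \<Sum>k\<le>n. \<bar>c k\<bar>)"
  define F where "F = (\<lambda>c i. if i < n then \<Sum>x\<in>S i. clamp_abs (\<delta> * nn c) (P c x) else 0)"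
  have "hom_lipschitz (Suc n) F"
    unfolding hom_lipschitz_def
  proof
    define B where "B = (\<Sum>i<n. \<Sum>x\<in>S i. (\<delta> + (\<Sum>k\<le>n. \<bar>f k x\<bar>)))"
    have "\<bar>F c i - F c' i\<bar> \<le> B * (\<Sum>j<Suc n. \<bar>c j - c' j\<bar>)" for c c' i
    proof (cases "i < n")
      case True
      let ?s = "\<Sum>j<Suc n. \<bar>c j - c' j\<bar>"
      have s0: "?s \<ge> 0" by (simp add: sum_nonneg)
      have one: "\<bar>clamp_abs (\<delta> * nn c) (P c x) - clamp_abs (\<delta> * nn c') (P c' x)\<bar> \<le> (\<delta> + (\<Sum>k\<le>n. \<bar>f k x\<bar>)) * ?s" for x
      proof -
        have "\<bar>nn c - nn c'\<bar> = \<bar>\<Sum>k\<le>n. \<bar>c k\<bar> - \<bar>c' k\<bar>\<bar>" by (simp add: nn_def sum_subtractf)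
        also have "\<dots> \<le> (\<Sum>k\<le>n. \<bar>c k - c' k\<bar>)"
          by (rule order_trans[OF sum_abs]) (intro sum_mono, auto)
        finally have a: "\<bar>nn c - nn c'\<bar> \<le> ?s" by (simp add: lessThan_Suc_atMost)
        have "\<bar>P c x - P c' x\<bar> = \<bar>\<Sum>k\<le>n. (c k - c' k) * f k x\<bar>"
          by (simp add: P_def sum_subtractf left_diff_distrib)
        also have "\<dots> \<le> (\<Sum>k\<le>n. \<bar>c k - c' k\<bar> * \<bar>f k x\<bar>)"
          by (rule order_trans[OF sum_abs]) (simp add: abs_mult)
        also have "\<dots> \<le> (\<Sum>k\<le>n. ?s * \<bar>f k x\<bar>)"
          by (intro sum_mono mult_right_mono member_le_sum) (auto simp: less_Suc_eq_le)
        also have "\<dots> = ?s * (\<Sum>k\<le>n. \<bar>f k x\<bar>)" by (simp add: sum_distrib_left)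
        finally have b: "\<bar>P c x - P c' x\<bar> \<le> ?s * (\<Sum>k\<le>n. \<bar>f k x\<bar>)" .
        have "\<bar>\<delta> * nn c - \<delta> * nn c'\<bar> = \<delta> * \<bar>nn c - nn c'\<bar>"
          using \<delta> by (simp add: abs_mult flip: right_diff_distrib)
        also have "\<dots> \<le> \<delta> * ?s" using a \<delta> by (intro mult_left_mono) auto
        finally have "\<bar>\<delta> * nn c - \<delta> * nn c'\<bar> \<le> \<delta> * ?s" .
        then show ?thesis
          using clamp_abs_lipschitz[of "\<delta> * nn c" "P c x" "\<delta> * nn c'" "P c' x"] b
          unfolding distrib_right by (simp add: mult.commute)
      qed
      have "\<bar>F c i - F c' i\<bar> = \<bar>\<Sum>x\<in>S i. clamp_abs (\<delta> * nn c) (P c x) - clamp_abs (\<delta> * nn c') (P c' x)\<bar>"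
        using True by (simp add: F_def sum_subtractf)
      also have "\<dots> \<le> (\<Sum>x\<in>S i. (\<delta> + (\<Sum>k\<le>n. \<bar>f k x\<bar>)) * ?s)"
        by (rule order_trans[OF sum_abs]) (intro sum_mono one)
      also have "\<dots> = (\<Sum>x\<in>S i. (\<delta> + (\<Sum>k\<le>n. \<bar>f k x\<bar>))) * ?s" by (simp add: sum_distrib_right)
      also have "\<dots> \<le> B * ?s"
        unfolding B_def using True \<delta> s0
        by (intro mult_right_mono member_le_sum[where f="\<lambda>i. \<Sum>x\<in>S i. (\<delta> + (\<Sum>k\<le>n. \<bar>f k x\<bar>))"])
          (auto intro!: sum_nonneg add_nonneg_nonneg)
      finally show ?thesis .
    next
      case False
      have "B \<ge> 0" using \<delta> unfolding B_def by (intro sum_nonneg add_nonneg_nonneg) auto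
      then show ?thesis using False by (auto simp: F_def intro!: mult_nonneg_nonneg sum_nonneg)
    qed
    then show "\<exists>K. \<forall>x\<in>coord_space (Suc n). \<forall>y\<in>coord_space (Suc n). \<forall>i. \<bar>F x i - F y i\<bar> \<le> K * (\<Sum>j<Suc n. \<bar>x j - y j\<bar>)"
      by blast
    have "F (\<lambda>j. t * c j) i = t * F c i" for c t i
    proof -
      have "nn (\<lambda>j. t * c j) = \<bar>t\<bar> * nn c" "P (\<lambda>j. t * c j) x = t * P c x" for x
        by (auto simp: nn_def P_def abs_mult sum_distrib_left mult.assoc)
      moreover have "\<delta> * nn c \<ge> 0" using \<delta> by (simp add: nn_def sum_nonneg)
      ultimately show ?thesis
        using clamp_abs_scale[of "\<delta> * nn c" t] by (simp add: F_def sum_distrib_left mult.left_commute)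
    qed
    then show "\<forall>x\<in>coord_space (Suc n). \<forall>t i. F (\<lambda>j. t * x j) i = t * F x i" by blast
  qed
  note hl = this
  obtain c0 where c0: "c0 \<in> coord_space (Suc n)" "c0 \<noteq> (\<lambda>_. 0)" "\<And>i. i < n \<Longrightarrow> F c0 i = 0"
    using Borsuk_Ulam_hom_lipschitz[OF hl] by blast
  obtain s c where sc: "s > 0" "c \<in> unit_sphere n" "c0 = (\<lambda>j. s * c j)"
    by (rule scale_to_unit_sphere[OF c0(1,2)])
  have hom: "F (\<lambda>j. s * c j) i = s * F c i" for i
    using hl sc(2) unit_sphere_subset_coord_space unfolding hom_lipschitz_def by blast
  have Fc: "F c i = 0" if "i < n" for i
    using c0(3)[OF that] hom[of i] sc by simp
  define h where "h = \<delta> * nn c"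
  obtain k where "k \<le> n" "c k \<noteq> 0"
    using unit_sphere_nonzero[OF sc(2)] sc(2) by (force simp: unit_sphere_def not_le)
  then have "nn c > 0" unfolding nn_def by (intro sum_pos2[of _ k]) auto
  then have h0: "h > 0" using \<delta> by (simp add: h_def)
  have "nn c \<le> (\<Sum>k\<le>n. 1)" unfolding nn_def using abs_unit_sphere_le_1[OF sc(2)] by (intro sum_mono) auto
  then have "h \<le> \<delta> * real (Suc n)" unfolding h_def using \<delta> by (intro mult_left_mono) auto
  then have he: "h \<le> \<epsilon>" by (simp add: \<delta>_def)
  have "2 * card {x \<in> S i. P c x > \<epsilon>} \<le> card (S i) \<and> 2 * card {x \<in> S i. P c x < - \<epsilon>} \<le> card (S i)"
    if i: "i < n" for i
  proof -
    have fS: "finite (S i)" using fin i by blast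
    have half: "2 * card X \<le> card (S i)"
      if X: "X \<subseteq> S i" and sg: "\<sigma> = 1 \<or> \<sigma> = -1" and Xh: "\<And>x. x \<in> X \<Longrightarrow> \<sigma> * clamp_abs h (P c x) = h" for X and \<sigma> :: real
    proof -
      have fX: "finite X" using X fS finite_subset by blast
      have "0 = \<sigma> * F c i" using Fc[OF i] by simp
      also have "\<dots> = (\<Sum>x\<in>S i. \<sigma> * clamp_abs h (P c x))" using i by (simp add: F_def h_def sum_distrib_left)
      also have "\<dots> = (\<Sum>x\<in>X. \<sigma> * clamp_abs h (P c x)) + (\<Sum>x\<in>S i - X. \<sigma> * clamp_abs h (P c x))"
        using sum.subset_diff[OF X fS] by (simp add: add.commute)
      finally have "0 = (\<Sum>x\<in>X. \<sigma> * clamp_abs h (P c x)) + (\<Sum>x\<in>S i - X. \<sigma> * clamp_abs h (P c x))" .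
      moreover have "(\<Sum>x\<in>X. \<sigma> * clamp_abs h (P c x)) = real (card X) * h" using Xh by simp
      moreover have "(\<Sum>x\<in>S i - X. - h) \<le> (\<Sum>x\<in>S i - X. \<sigma> * clamp_abs h (P c x))"
        using sg h0 by (intro sum_mono) (auto simp: clamp_abs_def)
      ultimately have "real (card X) * h - real (card (S i - X)) * h \<le> 0" by simp
      then have "(real (card X) - real (card (S i - X))) * h \<le> 0" by (simp add: left_diff_distrib)
      then have "card X \<le> card (S i - X)" using h0 by (simp add: mult_le_0_iff)
      moreover have "card (S i - X) = card (S i) - card X" using card_Diff_subset[OF fX X] .
      moreover have "card X \<le> card (S i)" using card_mono[OF fS X] .
      ultimately show ?thesis by linarith
    qed
    have "2 * card {x \<in> S i. P c x > \<epsilon>} \<le> card (S i)"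
      by (rule half[of _ 1]) (use he h0 in \<open>auto simp: clamp_abs_def\<close>)
    moreover have "2 * card {x \<in> S i. P c x < - \<epsilon>} \<le> card (S i)"
      by (rule half[of _ "-1"]) (use he h0 in \<open>auto simp: clamp_abs_def\<close>)
    ultimately show ?thesis by blast
  qed
  then show ?thesis using sc(2) unfolding P_def by blast
qed

text \<open>Equivalently, every subset of more than half the points contains one with value at most
  \<open>\<epsilon>\<close>. This is a finite intersection of finite unions of closed sets.\<close>

lemma closed_card_Collect_le:
  fixes P :: "'b::topological_space \<Rightarrow> 'a \<Rightarrow> real"
  assumes "finite S" "\<And>x. continuous_on UNIV (\<lambda>c. P c x)"
  shows "closed {c. 2 * card {x \<in> S. P c x > \<epsilon>} \<le> card S}"
proof -
  have "{c. 2 * card {x \<in> S. P c x > \<epsilon>} \<le> card S} =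
     (\<Inter>X\<in>{X. X \<subseteq> S \<and> 2 * card X > card S}. \<Union>x\<in>X. {c. P c x \<le> \<epsilon>})" (is "?L = ?R")
  proof (intro equalityI subsetI)
    fix c assume c: "c \<in> ?L"
    show "c \<in> ?R"
    proof
      fix X assume X: "X \<in> {X. X \<subseteq> S \<and> 2 * card X > card S}"
      show "c \<in> (\<Union>x\<in>X. {c. P c x \<le> \<epsilon>})"
      proof (rule ccontr)
        assume "\<not> ?thesis"
        then have "X \<subseteq> {x \<in> S. P c x > \<epsilon>}" using X by (auto simp: not_le)
        then have "card X \<le> card {x \<in> S. P c x > \<epsilon>}" using assms(1) by (intro card_mono) auto
        then show False using c X by auto
      qed
    qed
  next
    fix c assume c: "c \<in> ?R"
    show "c \<in> ?L"
    proof (rule ccontr)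
      assume "\<not> ?thesis"
      then have "{x \<in> S. P c x > \<epsilon>} \<in> {X. X \<subseteq> S \<and> 2 * card X > card S}" by auto
      then have "c \<in> (\<Union>x\<in>{x \<in> S. P c x > \<epsilon>}. {c. P c x \<le> \<epsilon>})" using c by (rule INT_D[rotated])
      then show False by auto
    qed
  qed
  moreover have "closed ?R"
    using assms by (intro closed_INT ballI closed_UN closed_Collect_le) (auto intro: finite_subset)
  ultimately show ?thesis by simp
qed

text \<open>The solutions for the tolerances \<open>1 / (m + 1)\<close> are nested, closed and
  nonempty, so by compactness they share a point \<open>c\<close>. The sets are finite, so for large
  \<open>m\<close> exceeding the tolerance is the same as being positive.\<close>

theorem ham_sandwich:
  fixes f :: "nat \<Rightarrow> 'a \<Rightarrow> real" and S :: "nat \<Rightarrow> 'a set"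
  assumes fin: "\<And>i. i < n \<Longrightarrow> finite (S i)"
  shows "\<exists>c\<in>unit_sphere n. \<forall>i<n. 2 * card {x \<in> S i. (\<Sum>k\<le>n. c k * f k x) > 0} \<le> card (S i) \<and>
     2 * card {x \<in> S i. (\<Sum>k\<le>n. c k * f k x) < 0} \<le> card (S i)"
proof -
  define P where "P = (\<lambda>c x. \<Sum>k\<le>n. c k * f k x)"
  define K where "K = (\<lambda>m::nat. {c. \<forall>i<n. 2 * card {x \<in> S i. P c x > 1 / real (Suc m)} \<le> card (S i) \<and>
     2 * card {x \<in> S i. - P c x > 1 / real (Suc m)} \<le> card (S i)})"
  have cP: "continuous_on UNIV (\<lambda>c. P c x)" for x
    unfolding P_def by (intro continuous_intros)
  have Keq: "K m = (\<Inter>i\<in>{..<n}. {c. 2 * card {x \<in> S i. P c x > 1 / real (Suc m)} \<le> card (S i)} \<inter>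
     {c. 2 * card {x \<in> S i. - P c x > 1 / real (Suc m)} \<le> card (S i)})" for m
    unfolding K_def by blast
  have clK: "closed (K m)" for m
    unfolding Keq
    by (intro closed_INT ballI closed_Int closed_card_Collect_le continuous_intros cP) (use fin in auto)
  have antimono: "K m' \<subseteq> K m" if "m \<le> m'" for m m'
  proof
    fix c assume c: "c \<in> K m'"
    have le: "1 / real (Suc m') \<le> 1 / real (Suc m)" using that by (simp add: field_simps)
    have "card {x \<in> S i. P c x > 1 / real (Suc m)} \<le> card {x \<in> S i. P c x > 1 / real (Suc m')}"
         "card {x \<in> S i. - P c x > 1 / real (Suc m)} \<le> card {x \<in> S i. - P c x > 1 / real (Suc m')}" if "i < n" for i
      using fin[OF that] le by (auto intro!: card_mono)
    then show "c \<in> K m" using c unfolding K_def by fastforce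
  qed
  have ne: "unit_sphere n \<inter> K m \<noteq> {}" for m
  proof -
    obtain c where "c \<in> unit_sphere n" "\<And>i. i < n \<Longrightarrow> 2 * card {x \<in> S i. P c x > 1 / real (Suc m)} \<le> card (S i) \<and>
      2 * card {x \<in> S i. P c x < - (1 / real (Suc m))} \<le> card (S i)"
      using ham_sandwich_approx[of n S "1 / real (Suc m)" f, OF fin] unfolding P_def by auto
    moreover have "{x \<in> S i. P c x < - (1 / real (Suc m))} = {x \<in> S i. - P c x > 1 / real (Suc m)}" for i by auto
    ultimately show ?thesis unfolding K_def by auto
  qed
  have "unit_sphere n \<inter> \<Inter>(range K) \<noteq> {}"
  proof (rule compact_imp_fip[OF compact_unit_sphere])
    fix F' assume F': "finite F'" "F' \<subseteq> range K"
    obtain I where I: "finite I" "F' = K ` I" using finite_subset_image[OF F'] by blast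
    obtain m where "\<forall>i\<in>I. i \<le> m" using I(1) finite_nat_set_iff_bounded_le by blast
    then have "K m \<subseteq> \<Inter>F'" using antimono I by blast
    then show "unit_sphere n \<inter> \<Inter>F' \<noteq> {}" using ne[of m] by blast
  qed (use clK in auto)
  then obtain c where c: "c \<in> unit_sphere n" "\<And>m. c \<in> K m" by blast
  have "2 * card {x \<in> S i. P c x > 0} \<le> card (S i) \<and> 2 * card {x \<in> S i. P c x < 0} \<le> card (S i)"
    if i: "i < n" for i
  proof -
    have key: "\<exists>m. \<forall>x\<in>X. 0 < \<sigma> x \<longrightarrow> \<sigma> x > 1 / real (Suc m)" if "finite X" for X and \<sigma> :: "'a \<Rightarrow> real"
      using that
    proof (induction X rule: finite_induct)
      case (insert y X)
      then obtain m where m: "\<And>x. x\<in>X \<Longrightarrow> 0 < \<sigma> x \<Longrightarrow> \<sigma> x > 1 / real (Suc m)" by blast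
      obtain m1 where m1: "0 < \<sigma> y \<Longrightarrow> \<sigma> y > 1 / real (Suc m1)"
      proof (cases "0 < \<sigma> y")
        case True
        then obtain m1 where "inverse (real (Suc m1)) < \<sigma> y" using reals_Archimedean by blast
        then show ?thesis using that by (auto simp: inverse_eq_divide)
      qed (use that in blast)
      have "1 / real (Suc (max m m1)) \<le> 1 / real (Suc m)" "1 / real (Suc (max m m1)) \<le> 1 / real (Suc m1)"
        by (auto intro!: divide_left_mono)
      then show ?case using m m1 by (intro exI[of _ "max m m1"]) fastforce
    qed simp
    obtain m where m: "\<And>x. x \<in> S i \<Longrightarrow> 0 < P c x \<Longrightarrow> P c x > 1 / real (Suc m)"
      using key[OF fin[OF i], of "P c"] by blast
    obtain m' where m': "\<And>x. x \<in> S i \<Longrightarrow> 0 < - P c x \<Longrightarrow> - P c x > 1 / real (Suc m')"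
      using key[OF fin[OF i], of "\<lambda>x. - P c x"] by blast
    have "{x \<in> S i. P c x > 0} \<subseteq> {x \<in> S i. P c x > 1 / real (Suc m)}"
      using m by auto
    then have "card {x \<in> S i. P c x > 0} \<le> card {x \<in> S i. P c x > 1 / real (Suc m)}"
      using fin[OF i] by (intro card_mono) auto
    moreover have "{x \<in> S i. P c x < 0} \<subseteq> {x \<in> S i. - P c x > 1 / real (Suc m')}"
      using m' by auto
    then have "card {x \<in> S i. P c x < 0} \<le> card {x \<in> S i. - P c x > 1 / real (Suc m')}"
      using fin[OF i] by (intro card_mono) auto
    ultimately show ?thesis using c(2)[of m] c(2)[of m'] i unfolding K_def by fastforce
  qed
  then show ?thesis using c(1) unfolding P_def by blast
qed


text \<open>On the curve with coordinates \<open>t, t ^ m, t ^ m\<^sup>2, \<dots>\<close> the \<open>k\<close>-th monomial restricts to \<open>t ^ k\<close>.\<close>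

definition kronecker_monomial :: "(nat \<Rightarrow> 'a::euclidean_space) \<Rightarrow> nat \<Rightarrow> nat \<Rightarrow> nat \<Rightarrow> 'a \<Rightarrow> real" where
  "kronecker_monomial b r m k x = (\<Prod>i<r. (x \<bullet> b i) ^ (k div m ^ i mod m))"

lemma poly_fun_kronecker_monomial:
  assumes "m > 0" shows "poly_fun (r * m) (kronecker_monomial b r m k)"
proof -
  have "poly_fun (\<Sum>i<r. m) (\<lambda>x. \<Prod>i<r. (x \<bullet> b i) ^ (k div m ^ i mod m))"
    using assms by (intro poly_fun_prod poly_fun_mono[OF poly_fun_inner_power]) (auto intro: less_imp_le)
  then show ?thesis by (simp add: kronecker_monomial_def[abs_def])
qed

lemma sum_digits: "(\<Sum>i<r. k div m ^ i mod m * m ^ i) = k mod m ^ r" for k m :: nat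
proof (induction r)
  case (Suc r)
  have "k mod (m ^ r * m) = m ^ r * (k div m ^ r mod m) + k mod m ^ r" by (rule mod_mult2_eq)
  then show ?case using Suc by (simp add: mult.commute)
qed simp

text \<open>For \<open>k < m ^ r\<close> the base-\<open>m\<close> digits of \<open>k\<close>,
  weighted by the powers of \<open>m\<close>, add up to \<open>k\<close>. Along
  \<open>\<gamma>\<close> the combination is therefore an ordinary polynomial in \<open>t\<close>
  with coefficients \<open>c k\<close>, and it vanishes for all \<open>t\<close>.\<close>

lemma kronecker_monomial_independent:
  fixes b :: "nat \<Rightarrow> 'a::euclidean_space"
  assumes orth: "\<And>i j. i < r \<Longrightarrow> j < r \<Longrightarrow> b i \<bullet> b j = (if i = j then 1 else 0)"
    and n: "n < m ^ r" and z: "\<And>x. (\<Sum>k\<le>n. c k * kronecker_monomial b r m k x) = 0" and k: "k \<le> n"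
  shows "c k = 0"
proof -
  define \<gamma> where "\<gamma> = (\<lambda>t::real. \<Sum>i<r. t ^ (m ^ i) *\<^sub>R b i)"
  have g: "\<gamma> t \<bullet> b i = t ^ (m ^ i)" if "i < r" for t i
  proof -
    have "\<gamma> t \<bullet> b i = (\<Sum>j<r. t ^ (m ^ j) * (if j = i then 1 else 0))"
      unfolding \<gamma>_def inner_sum_left using that by (intro sum.cong) (auto simp: orth)
    also have "\<dots> = t ^ (m ^ i)" using that by (simp add: if_distrib[of "\<lambda>x. _ * x"] sum.delta cong: if_cong)
    finally show ?thesis .
  qed
  have "kronecker_monomial b r m k (\<gamma> t) = t ^ k" if "k \<le> n" for k t
  proof -
    have "kronecker_monomial b r m k (\<gamma> t) = (\<Prod>i<r. t ^ (k div m ^ i mod m * m ^ i))"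
      unfolding kronecker_monomial_def by (intro prod.cong) (auto simp: g mult.commute simp flip: power_mult)
    also have "\<dots> = t ^ (\<Sum>i<r. k div m ^ i mod m * m ^ i)" by (simp add: power_sum)
    also have "\<dots> = t ^ k" using that n by (simp add: sum_digits)
    finally show ?thesis .
  qed
  then have "(\<Sum>k\<le>n. c k * t ^ k) = 0" for t
    using z[of "\<gamma> t"] by simp
  then show ?thesis using polyfun_eq_0[of c n] k by blast
qed

text \<open>The ham sandwich theorem is applied to the first \<open>n + 1\<close> Kronecker
  monomials; their independence makes the result a nonzero polynomial. The degree can be kept of
  order \<open>n\<close> to the power \<open>1 / r\<close>.\<close>

lemma polynomial_bisection:
  fixes b :: "nat \<Rightarrow> 'a::euclidean_space" and S :: "nat \<Rightarrow> 'a set"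
  assumes orth: "\<And>i j. i < r \<Longrightarrow> j < r \<Longrightarrow> b i \<bullet> b j = (if i = j then 1 else 0)"
    and n: "n < m ^ r" "m > 0" and fin: "\<And>i. i < n \<Longrightarrow> finite (S i)"
  shows "\<exists>p. poly_fun (r * m) p \<and> (\<exists>x. p x \<noteq> 0) \<and> (\<forall>i<n. 2 * card {x \<in> S i. p x > 0} \<le> card (S i) \<and>
     2 * card {x \<in> S i. p x < 0} \<le> card (S i))"
proof -
  obtain c where c: "c \<in> unit_sphere n" "\<forall>i<n. 2 * card {x \<in> S i. (\<Sum>k\<le>n. c k * kronecker_monomial b r m k x) > 0} \<le> card (S i) \<and>
     2 * card {x \<in> S i. (\<Sum>k\<le>n. c k * kronecker_monomial b r m k x) < 0} \<le> card (S i)"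
    using ham_sandwich[of n S "kronecker_monomial b r m", OF fin] by blast
  have "poly_fun (r * m) (\<lambda>x. \<Sum>k\<le>n. c k * kronecker_monomial b r m k x)"
    by (intro poly_fun_sum poly_fun_scale poly_fun_kronecker_monomial n) auto
  moreover have "\<exists>x. (\<Sum>k\<le>n. c k * kronecker_monomial b r m k x) \<noteq> 0"
  proof (rule ccontr)
    assume "\<not> ?thesis"
    then have "(\<Sum>k\<le>n. c k * kronecker_monomial b r m k x) = 0" for x by blast
    then have "c k = 0" if "k \<le> n" for k using kronecker_monomial_independent[OF orth n(1)] that by blast
    then show False using c(1) by (simp add: unit_sphere_def)
  qed
  ultimately show ?thesis using c(2) by (intro exI[of _ "\<lambda>x. \<Sum>k\<le>n. c k * kronecker_monomial b r m k x"]) auto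
qed

text \<open>One polynomial per stage bisects all \<open>2 ^ j\<close> sign classes of the earlier
  stages simultaneously. Points on its zero set leave the count, so the bound on each class
  halves.\<close>

lemma partition_stages:
  fixes b :: "nat \<Rightarrow> 'a::euclidean_space" and S :: "'a set"
  assumes orth: "\<And>i j. i < r \<Longrightarrow> j < r \<Longrightarrow> b i \<bullet> b j = (if i = j then 1 else 0)"
    and r: "r > 0" and S: "finite S"
  shows "\<exists>p. (\<forall>i<j. poly_fun (r * 2 ^ Suc (i div r)) (p i) \<and> (\<exists>x. p i x \<noteq> 0)) \<and>
    (\<forall>\<sigma>::nat \<Rightarrow> bool. 2 ^ j * card {x \<in> S. \<forall>i<j. p i x \<noteq> 0 \<and> (p i x > 0 \<longleftrightarrow> \<sigma> i)} \<le> card S)"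
proof (induction j)
  case 0
  then show ?case by auto
next
  case (Suc j)
  then obtain p where p: "\<And>i. i < j \<Longrightarrow> poly_fun (r * 2 ^ Suc (i div r)) (p i) \<and> (\<exists>x. p i x \<noteq> 0)"
    "\<And>\<sigma>::nat \<Rightarrow> bool. 2 ^ j * card {x \<in> S. \<forall>i<j. p i x \<noteq> 0 \<and> (p i x > 0 \<longleftrightarrow> \<sigma> i)} \<le> card S"
    by auto
  define T where "T = (PiE {..<j} (\<lambda>_. UNIV :: bool set))"
  have T: "finite T" "card T = 2 ^ j" by (auto simp: T_def card_PiE intro!: finite_PiE)
  obtain e where e: "bij_betw e {0..<2 ^ j :: nat} T" using ex_bij_betw_nat_finite[OF T(1)] T(2) by auto
  define R where "R = (\<lambda>\<sigma>. {x \<in> S. \<forall>i<j. p i x \<noteq> 0 \<and> (p i x > 0 \<longleftrightarrow> \<sigma> i)})"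
  \<comment> \<open>Chosen with \<open>m ^ r > 2 ^ j\<close>, so that the monomials outnumber the
    classes. Being a power of two, it makes the degrees of all stages easy to add.\<close>
  define m where "m = (2::nat) ^ Suc (j div r)"
  have "j < r * Suc (j div r)"
    using r by (metis div_less_iff_less_mult lessI mult.commute)
  then have "(2::nat) ^ j < 2 ^ (r * Suc (j div r))" by simp
  also have "\<dots> = m ^ r" unfolding m_def by (metis mult.commute power_mult)
  finally have mr: "2 ^ j < m ^ r" .
  obtain q where q: "poly_fun (r * m) q" "\<exists>x. q x \<noteq> 0"
    "\<And>i. i < 2 ^ j \<Longrightarrow> 2 * card {x \<in> R (e i). q x > 0} \<le> card (R (e i)) \<and> 2 * card {x \<in> R (e i). q x < 0} \<le> card (R (e i))"
    using polynomial_bisection[OF orth mr, of "\<lambda>i. R (e i)"] S by (auto simp: m_def R_def)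
  define p' where "p' = p(j := q)"
  have "2 ^ Suc j * card {x \<in> S. \<forall>i<Suc j. p' i x \<noteq> 0 \<and> (p' i x > 0 \<longleftrightarrow> \<sigma> i)} \<le> card S" for \<sigma> :: "nat \<Rightarrow> bool"
  proof -
    define \<tau> where "\<tau> = restrict \<sigma> {..<j}"
    have "\<tau> \<in> T" by (auto simp: \<tau>_def T_def)
    then obtain i where i: "i < 2 ^ j" "e i = \<tau>"
      using e unfolding bij_betw_def by (metis atLeastLessThan_iff imageE)
    let ?X = "{x \<in> S. \<forall>i<Suc j. p' i x \<noteq> 0 \<and> (p' i x > 0 \<longleftrightarrow> \<sigma> i)}"
    have "?X \<subseteq> (if \<sigma> j then {x \<in> R \<tau>. q x > 0} else {x \<in> R \<tau>. q x < 0})"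
    proof
      fix x assume x: "x \<in> ?X"
      then have "q x \<noteq> 0 \<and> (q x > 0 \<longleftrightarrow> \<sigma> j)" by (auto simp: p'_def)
      moreover have "p i x \<noteq> 0 \<and> (p i x > 0 \<longleftrightarrow> \<tau> i)" if "i < j" for i
      proof -
        have "p' i x \<noteq> 0 \<and> (p' i x > 0 \<longleftrightarrow> \<sigma> i)" using x that by simp
        then show ?thesis using that by (simp add: p'_def \<tau>_def)
      qed
      then have "x \<in> R \<tau>" using x by (simp add: R_def)
      ultimately show "x \<in> (if \<sigma> j then {x \<in> R \<tau>. q x > 0} else {x \<in> R \<tau>. q x < 0})" by auto
    qed
    then have "card ?X \<le> card (if \<sigma> j then {x \<in> R \<tau>. q x > 0} else {x \<in> R \<tau>. q x < 0})"
      using S by (intro card_mono) (auto simp: R_def)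
    then have "2 * card ?X \<le> card (R \<tau>)" using q(3)[OF i(1)] i(2) by (auto split: if_splits)
    then have "2 ^ j * (2 * card ?X) \<le> 2 ^ j * card (R \<tau>)" by (intro mult_left_mono) auto
    also have "\<dots> \<le> card S" using p(2)[of \<tau>] by (simp add: R_def)
    finally show ?thesis by simp
  qed
  moreover have "poly_fun (r * 2 ^ Suc (i div r)) (p' i) \<and> (\<exists>x. p' i x \<noteq> 0)" if "i < Suc j" for i
    using p(1)[of i] q(1,2) that by (cases "i = j") (auto simp: p'_def m_def)
  ultimately show ?case by (intro exI[of _ p']) blast
qed

text \<open>Each block of \<open>r\<close> stages has constant degree, and the degree doubles from
  block to block. Adding \<open>2 * r\<^sup>2\<close> turns the geometric sum into an identity
  provable by induction.\<close>

lemma partition_degree_sum: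
  assumes "r > 0"
  shows "(\<Sum>i<r * q. r * 2 ^ Suc (i div r)) \<le> 2 * r\<^sup>2 * (2::nat) ^ q"
proof -
  have "(\<Sum>i<r * q. r * 2 ^ Suc (i div r)) + 2 * r\<^sup>2 = 2 * r\<^sup>2 * (2::nat) ^ q"
  proof (induction q)
    case (Suc q)
    have "(\<Sum>i<r * Suc q. r * (2::nat) ^ Suc (i div r)) =
        (\<Sum>i<r * q. r * 2 ^ Suc (i div r)) + (\<Sum>i=r * q..<r * q + r. r * 2 ^ Suc (i div r))"
      by (simp add: sum.atLeastLessThan_concat lessThan_atLeast0 add.commute)
    also have "(\<Sum>i=r * q..<r * q + r. r * (2::nat) ^ Suc (i div r)) = (\<Sum>i=r * q..<r * q + r. r * 2 ^ Suc q)"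
    proof (intro sum.cong refl)
      fix i assume "i \<in> {r * q..<r * q + r}"
      then have "i div r = q" using assms by (intro div_nat_eqI) (auto simp: mult.commute)
      then show "r * (2::nat) ^ Suc (i div r) = r * 2 ^ Suc q" by simp
    qed
    finally show ?case using Suc by (simp add: power2_eq_square algebra_simps)
  qed simp
  then show ?thesis by linarith
qed

text \<open>\<open>\<kappa>\<close> labels cells. These will be sign patterns, possibly
  disconnected, rather than components: what matters is only how many labels a line outside the zero
  set meets, and \<open>D\<close> zeros cut a line into at most \<open>D + 1\<close> pieces.\<close>

definition few_cells :: "nat \<Rightarrow> ('a::euclidean_space \<Rightarrow> real) \<Rightarrow> ('a \<Rightarrow> 'b) \<Rightarrow> bool" where
  "few_cells D f \<kappa> \<longleftrightarrow> (\<forall>x u t. f (x + t *\<^sub>R u) \<noteq> 0 \<longrightarrow>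
     finite (\<kappa> ` {y. y \<in> range (\<lambda>t. x + t *\<^sub>R u) \<and> f y \<noteq> 0}) \<and>
     card (\<kappa> ` {y. y \<in> range (\<lambda>t. x + t *\<^sub>R u) \<and> f y \<noteq> 0}) \<le> Suc D)"

text \<open>\<open>f\<close> is the product of the \<open>r * q\<close> bisecting polynomials, and a
  cell is a pattern of their signs. The number \<open>2 ^ (r * q)\<close> of patterns is of order
  \<open>D ^ r\<close>, while a line meets only \<open>D + 1\<close> of them.\<close>

theorem polynomial_partitioning:
  fixes b :: "nat \<Rightarrow> 'a::euclidean_space" and S :: "'a set"
  assumes orth: "\<And>i j. i < r \<Longrightarrow> j < r \<Longrightarrow> b i \<bullet> b j = (if i = j then 1 else 0)"
    and r: "r > 0" and S: "finite S" and D: "D = 2 * r\<^sup>2 * 2 ^ q"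
  obtains f and \<kappa> :: "'a \<Rightarrow> nat \<Rightarrow> bool" where "poly_fun D f" "\<exists>x. f x \<noteq> 0"
    "\<And>\<sigma>. 2 ^ (r * q) * card {x \<in> S. f x \<noteq> 0 \<and> \<kappa> x = \<sigma>} \<le> card S"
    "few_cells D f \<kappa>"
proof -
  define j where "j = r * q"
  obtain p where p: "\<And>i. i < j \<Longrightarrow> poly_fun (r * 2 ^ Suc (i div r)) (p i) \<and> (\<exists>x. p i x \<noteq> 0)"
    "\<And>\<sigma>::nat \<Rightarrow> bool. 2 ^ j * card {x \<in> S. \<forall>i<j. p i x \<noteq> 0 \<and> (p i x > 0 \<longleftrightarrow> \<sigma> i)} \<le> card S"
    using partition_stages[of r b S j, OF orth r S] by blast
  define f where "f = (\<lambda>x. \<Prod>i<j. p i x)"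
  define \<kappa> where "\<kappa> = (\<lambda>x i. i < j \<and> p i x > 0)"
  have "poly_fun (\<Sum>i<j. r * 2 ^ Suc (i div r)) f"
    unfolding f_def using p(1) by (intro poly_fun_prod) auto
  then have 1: "poly_fun D f"
    by (rule poly_fun_mono) (use partition_degree_sum[OF r, of q] in \<open>simp add: j_def D\<close>)
  have 2: "\<exists>x. f x \<noteq> 0"
    unfolding f_def using p(1) by (intro poly_fun_prod_nonzero[where d="\<lambda>i. r * 2 ^ Suc (i div r)"]) auto
  have 3: "2 ^ (r * q) * card {x \<in> S. f x \<noteq> 0 \<and> \<kappa> x = \<sigma>} \<le> card S" for \<sigma>
  proof -
    have "{x \<in> S. f x \<noteq> 0 \<and> \<kappa> x = \<sigma>} \<subseteq> {x \<in> S. \<forall>i<j. p i x \<noteq> 0 \<and> (p i x > 0 \<longleftrightarrow> \<sigma> i)}"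
      by (auto simp: f_def \<kappa>_def)
    then have "card {x \<in> S. f x \<noteq> 0 \<and> \<kappa> x = \<sigma>} \<le> card {x \<in> S. \<forall>i<j. p i x \<noteq> 0 \<and> (p i x > 0 \<longleftrightarrow> \<sigma> i)}"
      using S by (intro card_mono) auto
    then have "2 ^ j * card {x \<in> S. f x \<noteq> 0 \<and> \<kappa> x = \<sigma>} \<le> 2 ^ j * card {x \<in> S. \<forall>i<j. p i x \<noteq> 0 \<and> (p i x > 0 \<longleftrightarrow> \<sigma> i)}"
      by (intro mult_left_mono) auto
    also have "\<dots> \<le> card S" by (rule p(2))
    finally show ?thesis by (simp only: j_def)
  qed
  have "finite (\<kappa> ` {y. y \<in> range (\<lambda>t. x + t *\<^sub>R u) \<and> f y \<noteq> 0}) \<and>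
       card (\<kappa> ` {y. y \<in> range (\<lambda>t. x + t *\<^sub>R u) \<and> f y \<noteq> 0}) \<le> Suc D"
    if nz: "f (x + t0 *\<^sub>R u) \<noteq> 0" for x u t0
  proof -
    obtain g where g: "degree g \<le> D" "\<And>t. f (x + t *\<^sub>R u) = poly g t" using poly_fun_line[OF 1] by blast
    have g0: "g \<noteq> 0" using nz g(2)[of t0] by auto
    define Z where "Z = {t. poly g t = 0}"
    have Z: "finite Z" "card Z \<le> D"
      using poly_roots_finite[OF g0] card_poly_roots_bound[OF g0] g(1) by (auto simp: Z_def)
    \<comment> \<open>The number of roots to the left names the gap between roots that contains
      \<open>t\<close>. Within a gap no factor of \<open>f\<close> vanishes, so by the intermediate
      value theorem none changes sign.\<close>
    define \<rho> where "\<rho> = (\<lambda>t. card {s \<in> Z. s < t})"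
    have rho: "\<rho> ` (- Z) \<subseteq> {..D}"
    proof clarsimp
      fix t show "\<rho> t \<le> D" unfolding \<rho>_def using card_mono[OF Z(1), of "{s \<in> Z. s < t}"] Z(2) by auto
    qed
    have same: "\<kappa> (x + t *\<^sub>R u) = \<kappa> (x + s *\<^sub>R u)" if st: "t \<notin> Z" "s \<notin> Z" "t < s" "\<rho> t = \<rho> s" for t s
    proof -
      have "{a \<in> Z. a < t} = {a \<in> Z. a < s}"
        using st Z(1) by (intro card_subset_eq) (auto simp: \<rho>_def)
      note eqZ = this
      have noZ: "a \<notin> Z" if "t \<le> a" "a \<le> s" for a
      proof
        assume a: "a \<in> Z"
        then have "a < s" using that st(2) by (cases "a = s") auto
        then have "a \<in> {a \<in> Z. a < t}" using a eqZ by blast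
        then show False using that by simp
      qed
      have pnz: "p i (x + a *\<^sub>R u) \<noteq> 0" if "t \<le> a" "a \<le> s" "i < j" for a i
      proof -
        have "f (x + a *\<^sub>R u) \<noteq> 0" using noZ[OF that(1,2)] g(2)[of a] by (simp add: Z_def)
        then show ?thesis using that(3) by (auto simp: f_def)
      qed
      have "p i (x + t *\<^sub>R u) > 0 \<longleftrightarrow> p i (x + s *\<^sub>R u) > 0" if i: "i < j" for i
      proof -
        have cont: "continuous_on {t..s} (\<lambda>a. p i (x + a *\<^sub>R u))"
          by (rule continuous_on_compose2[of UNIV "p i"])
             (use p(1)[OF i] poly_fun_continuous in \<open>auto intro!: continuous_intros\<close>)
        show ?thesis
        proof (rule ccontr)
          assume "\<not> ?thesis"
          then consider "p i (x + t *\<^sub>R u) \<le> 0" "0 \<le> p i (x + s *\<^sub>R u)" | "p i (x + s *\<^sub>R u) \<le> 0" "0 \<le> p i (x + t *\<^sub>R u)"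
            by linarith
          then show False
          proof cases
            case 1
            then obtain a where "t \<le> a" "a \<le> s" "p i (x + a *\<^sub>R u) = 0"
              using IVT'[of "\<lambda>a. p i (x + a *\<^sub>R u)" t 0 s] cont st(3) by auto
            then show False using pnz i by blast
          next
            case 2
            then obtain a where "t \<le> a" "a \<le> s" "p i (x + a *\<^sub>R u) = 0"
              using IVT2'[of "\<lambda>a. p i (x + a *\<^sub>R u)" s 0 t] cont st(3) by auto
            then show False using pnz i by blast
          qed
        qed
      qed
      then show ?thesis by (auto simp: \<kappa>_def fun_eq_iff)
    qed
    define \<phi> where "\<phi> = (\<lambda>k. \<kappa> (x + (SOME t. t \<notin> Z \<and> \<rho> t = k) *\<^sub>R u))"
    have 5: "\<kappa> (x + t *\<^sub>R u) = \<phi> (\<rho> t)" if t: "t \<notin> Z" for t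
    proof -
      define s where "s = (SOME s. s \<notin> Z \<and> \<rho> s = \<rho> t)"
      have s: "s \<notin> Z \<and> \<rho> s = \<rho> t" unfolding s_def by (rule someI[of _ t]) (use t in auto)
      have "\<kappa> (x + t *\<^sub>R u) = \<kappa> (x + s *\<^sub>R u)"
      proof (cases t s rule: linorder_cases)
        case less
        then show ?thesis using same[of t s] s t by simp
      next
        case greater
        then show ?thesis using same[of s t] s t by simp
      qed simp
      then show ?thesis by (simp add: \<phi>_def s_def)
    qed
    have sub: "\<kappa> ` {y. y \<in> range (\<lambda>t. x + t *\<^sub>R u) \<and> f y \<noteq> 0} \<subseteq> \<phi> ` {..D}"
    proof clarify
      fix t assume "f (x + t *\<^sub>R u) \<noteq> 0"
      then have "t \<notin> Z" using g(2)[of t] by (simp add: Z_def)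
      then show "\<kappa> (x + t *\<^sub>R u) \<in> \<phi> ` {..D}" using 5 rho by blast
    qed
    have "card (\<phi> ` {..D}) \<le> Suc D" using card_image_le[of "{..D}" \<phi>] by simp
    then show ?thesis using sub finite_subset[OF sub] card_mono[OF _ sub] by force
  qed
  then have 4: "few_cells D f \<kappa>" unfolding few_cells_def by blast
  show thesis by (rule that[OF 1 2 3 4])
qed

section \<open>Incidences and the Szemeredi-Trotter theorem\<close>

definition aline :: "'a::euclidean_space set \<Rightarrow> bool" where
  "aline l \<longleftrightarrow> (\<exists>x u. u \<noteq> 0 \<and> l = range (\<lambda>t. x + t *\<^sub>R u))"

lemma aline_through:
  assumes "aline l" "x \<in> l" "y \<in> l" "x \<noteq> y"
  shows "l = range (\<lambda>t. x + t *\<^sub>R (y - x))"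
proof -
  obtain z u where l: "u \<noteq> 0" "l = range (\<lambda>t. z + t *\<^sub>R u)" using assms(1) by (auto simp: aline_def)
  obtain s t where st: "x = z + s *\<^sub>R u" "y = z + t *\<^sub>R u" using assms l by blast
  have ts: "t - s \<noteq> 0" using st assms(4) by auto
  have yx: "y - x = (t - s) *\<^sub>R u" by (simp add: st scaleR_diff_left)
  show ?thesis
  proof (intro equalityI subsetI)
    fix p assume "p \<in> l"
    then obtain r where r: "p = z + r *\<^sub>R u" using l by blast
    have "x + ((r - s) / (t - s)) *\<^sub>R (y - x) = x + (r - s) *\<^sub>R u" using ts by (simp add: yx)
    also have "\<dots> = p" by (simp add: r st scaleR_diff_left)
    finally show "p \<in> range (\<lambda>t. x + t *\<^sub>R (y - x))" by (metis rangeI)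
  next
    fix p assume "p \<in> range (\<lambda>t. x + t *\<^sub>R (y - x))"
    then obtain r where "p = x + r *\<^sub>R (y - x)" by blast
    then have "p = x + r *\<^sub>R ((t - s) *\<^sub>R u)" by (simp only: yx)
    then have "p = z + (s + r * (t - s)) *\<^sub>R u" by (simp add: st scaleR_add_left)
    then show "p \<in> l" using l by blast
  qed
qed

lemma aline_unique:
  assumes "aline l" "aline l'" "x \<in> l" "y \<in> l" "x \<in> l'" "y \<in> l'" "x \<noteq> y"
  shows "l = l'"
  using aline_through[OF assms(1,3,4,7)] aline_through[OF assms(2,5,6,7)] by simp

lemma aline_at:
  assumes "aline l" "x \<in> l"
  obtains u where "u \<noteq> 0" "l = range (\<lambda>t. x + t *\<^sub>R u)"
proof -
  obtain z u where l: "u \<noteq> 0" "l = range (\<lambda>t. z + t *\<^sub>R u)" using assms(1) by (auto simp: aline_def)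
  have zu: "z + 0 *\<^sub>R u \<in> l" "z + 1 *\<^sub>R u \<in> l" using l(2) by blast+
  obtain y where y: "y \<in> l" "x \<noteq> y"
  proof (cases "x = z + 0 *\<^sub>R u")
    case True
    then have "x \<noteq> z + 1 *\<^sub>R u" using l(1) by simp
    then show ?thesis using that zu by blast
  qed (use that zu in blast)
  show thesis using that[of "y - x"] aline_through[OF assms y] y by auto
qed

lemma card_filter_sum: "finite A \<Longrightarrow> card {x \<in> A. P x} = (\<Sum>x\<in>A. if P x then 1 else 0)"
  by (simp flip: sum.inter_filter)

definition incidences :: "'a set \<Rightarrow> 'a set set \<Rightarrow> nat" where
  "incidences G \<Lambda> = card {(g, l). g \<in> G \<and> l \<in> \<Lambda> \<and> g \<in> l}"

lemma incidences_finite: "finite G \<Longrightarrow> finite \<Lambda> \<Longrightarrow> finite {(g, l). g \<in> G \<and> l \<in> \<Lambda> \<and> g \<in> l}"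
  by (rule finite_subset[of _ "G \<times> \<Lambda>"]) auto

lemma incidences_sum_points:
  assumes "finite G" "finite \<Lambda>"
  shows "incidences G \<Lambda> = (\<Sum>g\<in>G. card {l \<in> \<Lambda>. g \<in> l})"
proof -
  have "{(g, l). g \<in> G \<and> l \<in> \<Lambda> \<and> g \<in> l} = (SIGMA g:G. {l \<in> \<Lambda>. g \<in> l})" by auto
  then show ?thesis unfolding incidences_def using assms by simp
qed

lemma incidences_sum_lines:
  assumes "finite G" "finite \<Lambda>"
  shows "incidences G \<Lambda> = (\<Sum>l\<in>\<Lambda>. card {g \<in> G. g \<in> l})"
proof -
  have "incidences G \<Lambda> = card ((\<lambda>(l, g). (g, l)) ` (SIGMA l:\<Lambda>. {g \<in> G. g \<in> l}))"
    unfolding incidences_def by (rule arg_cong[where f=card]) (auto simp: image_iff)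
  also have "\<dots> = card (SIGMA l:\<Lambda>. {g \<in> G. g \<in> l})"
    by (rule card_image) (auto simp: inj_on_def)
  finally show ?thesis using assms by simp
qed

text \<open>The Kovari-Sos-Turan argument for relations without a \<open>2 \<times> 2\<close>
  rectangle. Choose one partner \<open>b y\<close> for each \<open>y\<close>; these make up
  \<open>card Y\<close> pairs. For any other pair \<open>(x, y)\<close>, the two partners
  \<open>b y\<close> and \<open>x\<close> already determine \<open>y\<close>.\<close>

lemma card_relation_le:
  assumes X: "finite X" and Y: "finite Y" and I: "I \<subseteq> X \<times> Y"
    and one: "\<And>x x' y y'. (x, y) \<in> I \<Longrightarrow> (x', y) \<in> I \<Longrightarrow> (x, y') \<in> I \<Longrightarrow> (x', y') \<in> I \<Longrightarrow> x = x' \<or> y = y'"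
  shows "card I \<le> card Y + (card X)\<^sup>2"
proof -
  define b where "b = (\<lambda>y. SOME x. (x, y) \<in> I)"
  define \<phi> where "\<phi> = (\<lambda>(x, y). if x = b y then Inl y else Inr (b y, x))"
  have b: "(b y, y) \<in> I" if "(x, y) \<in> I" for x y
    unfolding b_def by (rule someI[of _ x]) (rule that)
  have inj: "inj_on \<phi> I"
  proof (rule inj_onI, clarify)
    fix x y x' y'
    assume i: "(x, y) \<in> I" "(x', y') \<in> I" and eq: "\<phi> (x, y) = \<phi> (x', y')"
    show "x = x' \<and> y = y'"
    proof (cases "x = b y")
      case True
      then show ?thesis using eq by (auto simp: \<phi>_def split: if_splits)
    next
      case False
      then have *: "x = x'" "b y = b y'" using eq by (auto simp: \<phi>_def split: if_splits)
      then show ?thesis using one[of "b y" y x y'] i b[OF i(1)] b[OF i(2)] False by auto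
    qed
  qed
  have sub: "\<phi> ` I \<subseteq> Y <+> (X \<times> X)"
  proof
    fix z assume "z \<in> \<phi> ` I"
    then obtain x y where xy: "(x, y) \<in> I" "z = \<phi> (x, y)" by auto
    then show "z \<in> Y <+> (X \<times> X)" using I b[OF xy(1)] by (auto simp: \<phi>_def)
  qed
  have "card I \<le> card (Y <+> (X \<times> X))"
    using card_inj_on_le[OF inj sub] X Y by simp
  then show ?thesis using X Y by (simp add: card_Plus card_cartesian_product power2_eq_square)
qed

lemma incidences_le_lines:
  assumes "finite G" "finite \<Lambda>" "\<And>l. l \<in> \<Lambda> \<Longrightarrow> aline l"
  shows "incidences G \<Lambda> \<le> card \<Lambda> + (card G)\<^sup>2"
  unfolding incidences_def
proof (rule card_relation_le[OF assms(1,2)])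
  fix x x' l l'
  assume "(x, l) \<in> {(g, l). g \<in> G \<and> l \<in> \<Lambda> \<and> g \<in> l}" "(x', l) \<in> {(g, l). g \<in> G \<and> l \<in> \<Lambda> \<and> g \<in> l}"
    "(x, l') \<in> {(g, l). g \<in> G \<and> l \<in> \<Lambda> \<and> g \<in> l}" "(x', l') \<in> {(g, l). g \<in> G \<and> l \<in> \<Lambda> \<and> g \<in> l}"
  then show "x = x' \<or> l = l'" using aline_unique[of l l' x x'] assms(3) by simp blast
qed auto

lemma incidences_le_points:
  assumes "finite G" "finite \<Lambda>" "\<And>l. l \<in> \<Lambda> \<Longrightarrow> aline l"
  shows "incidences G \<Lambda> \<le> card G + (card \<Lambda>)\<^sup>2"
proof -
  let ?I = "{(l, g). g \<in> G \<and> l \<in> \<Lambda> \<and> g \<in> l}"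
  have "incidences G \<Lambda> = card (prod.swap ` ?I)"
    unfolding incidences_def by (rule arg_cong[where f=card]) (auto simp: image_iff)
  also have "\<dots> = card ?I" by (rule card_image) simp
  also have "\<dots> \<le> card G + (card \<Lambda>)\<^sup>2"
  proof (rule card_relation_le[OF assms(2,1)])
    fix l l' x x'
    assume "(l, x) \<in> ?I" "(l', x) \<in> ?I" "(l, x') \<in> ?I" "(l', x') \<in> ?I"
    then show "l = l' \<or> x = x'" using aline_unique[of l l' x x'] assms(3) by simp blast
  qed auto
  finally show ?thesis .
qed

lemma incidences_split:
  assumes "finite G" "finite \<Lambda>" "\<Lambda>' \<subseteq> \<Lambda>"
  shows "incidences G \<Lambda> = incidences G (\<Lambda> - \<Lambda>') + incidences G \<Lambda>'"
  using assms finite_subset[OF assms(3)]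
  by (simp add: incidences_sum_lines sum.subset_diff[of \<Lambda>' \<Lambda>])

lemma poly_fun_zeros_on_line:
  assumes f: "poly_fun D f" and l: "aline l" "y \<in> l" "f y \<noteq> 0"
  shows "finite {x \<in> l. f x = 0} \<and> card {x \<in> l. f x = 0} \<le> D"
proof -
  obtain x u where xu: "u \<noteq> 0" "l = range (\<lambda>t. x + t *\<^sub>R u)" using l(1) by (auto simp: aline_def)
  obtain q where q: "degree q \<le> D" "\<And>t. f (x + t *\<^sub>R u) = poly q t" using poly_fun_line[OF f] by blast
  obtain t where "y = x + t *\<^sub>R u" using l(2) xu(2) by blast
  then have q0: "q \<noteq> 0" using l(3) q(2)[of t] by auto
  have eq: "{x \<in> l. f x = 0} = (\<lambda>t. x + t *\<^sub>R u) ` {t. poly q t = 0}"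
    using xu(2) q(2) by auto
  have fin: "finite {t. poly q t = 0}" by (rule poly_roots_finite[OF q0])
  have "card {x \<in> l. f x = 0} \<le> card {t. poly q t = 0}" unfolding eq by (rule card_image_le[OF fin])
  also have "\<dots> \<le> D" using card_poly_roots_bound[OF q0] q(1) by simp
  finally show ?thesis using fin eq by simp
qed

text \<open>Each line has at most \<open>D\<close> points on the zero set. Inside a cell the bound
  lines plus points squared is used; a line enters at most \<open>D + 1\<close> cells, which
  accounts for \<open>2 * D + 1\<close>, and the squares sum to at most \<open>card G\<close> times
  the largest cell.\<close>

lemma incidences_cells:
  fixes \<kappa> :: "'a::euclidean_space \<Rightarrow> 'b"
  assumes f: "poly_fun D f" and G: "finite G" and L: "finite \<Lambda>" "\<And>l. l \<in> \<Lambda> \<Longrightarrow> aline l"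
    and nz: "\<And>l. l \<in> \<Lambda> \<Longrightarrow> \<exists>x\<in>l. f x \<noteq> 0"
    and cell: "\<And>\<sigma>. K * card {x \<in> G. f x \<noteq> 0 \<and> \<kappa> x = \<sigma>} \<le> card G" and K: "K > 0"
    and cross: "few_cells D f \<kappa>"
  shows "real (incidences G \<Lambda>) \<le> real (card \<Lambda>) * (2 * real D + 1) + (real (card G))\<^sup>2 / real K"
proof -
  define G0 where "G0 = {x \<in> G. f x = 0}"
  define Gs where "Gs = (\<lambda>\<sigma>. {x \<in> G. f x \<noteq> 0 \<and> \<kappa> x = \<sigma>})"
  define Ls where "Ls = (\<lambda>\<sigma>. {l \<in> \<Lambda>. \<sigma> \<in> \<kappa> ` {y. y \<in> l \<and> f y \<noteq> 0}})"
  define \<Sigma> where "\<Sigma> = \<kappa> ` G"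
  have fS: "finite \<Sigma>" using G by (simp add: \<Sigma>_def)
  have fin: "finite G0" "finite (Gs \<sigma>)" "finite (Ls \<sigma>)" for \<sigma> using G L by (auto simp: G0_def Gs_def Ls_def)
  have zero: "incidences G0 \<Lambda> \<le> card \<Lambda> * D"
  proof -
    have "card {g \<in> G0. g \<in> l} \<le> D" if l: "l \<in> \<Lambda>" for l
    proof -
      obtain y where "y \<in> l" "f y \<noteq> 0" using nz[OF l] by blast
      then have *: "finite {x \<in> l. f x = 0} \<and> card {x \<in> l. f x = 0} \<le> D"
        using poly_fun_zeros_on_line[OF f L(2)[OF l]] by blast
      have "{g \<in> G0. g \<in> l} \<subseteq> {x \<in> l. f x = 0}" by (auto simp: G0_def)
      then show ?thesis using * card_mono by (meson le_trans)
    qed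
    then have "(\<Sum>l\<in>\<Lambda>. card {g \<in> G0. g \<in> l}) \<le> (\<Sum>l\<in>\<Lambda>. D)" by (intro sum_mono) auto
    then show ?thesis unfolding incidences_sum_lines[OF fin(1) L(1)] by simp
  qed
  have "{(g, l). g \<in> G \<and> l \<in> \<Lambda> \<and> g \<in> l} \<subseteq> {(g, l). g \<in> G0 \<and> l \<in> \<Lambda> \<and> g \<in> l} \<union>
      (\<Union>\<sigma>\<in>\<Sigma>. {(g, l). g \<in> Gs \<sigma> \<and> l \<in> Ls \<sigma> \<and> g \<in> l})"
    by (auto simp: G0_def Gs_def Ls_def \<Sigma>_def)
  then have "incidences G \<Lambda> \<le> card ({(g, l). g \<in> G0 \<and> l \<in> \<Lambda> \<and> g \<in> l} \<union>
      (\<Union>\<sigma>\<in>\<Sigma>. {(g, l). g \<in> Gs \<sigma> \<and> l \<in> Ls \<sigma> \<and> g \<in> l}))"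
    unfolding incidences_def using fS fin L by (intro card_mono) (auto intro!: incidences_finite)
  also have "\<dots> \<le> incidences G0 \<Lambda> + card (\<Union>\<sigma>\<in>\<Sigma>. {(g, l). g \<in> Gs \<sigma> \<and> l \<in> Ls \<sigma> \<and> g \<in> l})"
    unfolding incidences_def by (rule card_Un_le)
  also have "card (\<Union>\<sigma>\<in>\<Sigma>. {(g, l). g \<in> Gs \<sigma> \<and> l \<in> Ls \<sigma> \<and> g \<in> l}) \<le> (\<Sum>\<sigma>\<in>\<Sigma>. incidences (Gs \<sigma>) (Ls \<sigma>))"
    unfolding incidences_def by (rule card_UN_le[OF fS])
  also have "\<dots> \<le> (\<Sum>\<sigma>\<in>\<Sigma>. card (Ls \<sigma>) + (card (Gs \<sigma>))\<^sup>2)"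
    using fin L by (intro sum_mono incidences_le_lines) (auto simp: Ls_def)
  finally have A: "incidences G \<Lambda> \<le> card \<Lambda> * D + ((\<Sum>\<sigma>\<in>\<Sigma>. card (Ls \<sigma>)) + (\<Sum>\<sigma>\<in>\<Sigma>. (card (Gs \<sigma>))\<^sup>2))"
    using zero by (simp add: sum.distrib)
  have B: "(\<Sum>\<sigma>\<in>\<Sigma>. card (Ls \<sigma>)) \<le> card \<Lambda> * Suc D"
  proof -
    have "(\<Sum>\<sigma>\<in>\<Sigma>. card (Ls \<sigma>)) = (\<Sum>\<sigma>\<in>\<Sigma>. \<Sum>l\<in>\<Lambda>. if \<sigma> \<in> \<kappa> ` {y. y \<in> l \<and> f y \<noteq> 0} then 1 else 0)"
      unfolding Ls_def card_filter_sum[OF L(1)] ..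
    also have "\<dots> = (\<Sum>l\<in>\<Lambda>. \<Sum>\<sigma>\<in>\<Sigma>. if \<sigma> \<in> \<kappa> ` {y. y \<in> l \<and> f y \<noteq> 0} then 1 else 0)"
      by (rule sum.swap)
    also have "\<dots> = (\<Sum>l\<in>\<Lambda>. card {\<sigma> \<in> \<Sigma>. \<sigma> \<in> \<kappa> ` {y. y \<in> l \<and> f y \<noteq> 0}})"
      unfolding card_filter_sum[OF fS] ..
    also have "\<dots> \<le> (\<Sum>l\<in>\<Lambda>. Suc D)"
    proof (rule sum_mono)
      fix l assume l: "l \<in> \<Lambda>"
      obtain x u where xu: "l = range (\<lambda>t. x + t *\<^sub>R u)" using L(2)[OF l] by (auto simp: aline_def)
      obtain t where "f (x + t *\<^sub>R u) \<noteq> 0" using nz[OF l] xu by auto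
      then have *: "finite (\<kappa> ` {y. y \<in> l \<and> f y \<noteq> 0})" "card (\<kappa> ` {y. y \<in> l \<and> f y \<noteq> 0}) \<le> Suc D"
        using cross unfolding few_cells_def xu by blast+
      have "card {\<sigma> \<in> \<Sigma>. \<sigma> \<in> \<kappa> ` {y. y \<in> l \<and> f y \<noteq> 0}} \<le> card (\<kappa> ` {y. y \<in> l \<and> f y \<noteq> 0})"
        by (rule card_mono[OF *(1)]) auto
      with *(2) show "card {\<sigma> \<in> \<Sigma>. \<sigma> \<in> \<kappa> ` {y. y \<in> l \<and> f y \<noteq> 0}} \<le> Suc D" by linarith
    qed
    finally show ?thesis by simp
  qed
  have C: "(\<Sum>\<sigma>\<in>\<Sigma>. (real (card (Gs \<sigma>)))\<^sup>2) \<le> (real (card G))\<^sup>2 / real K"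
  proof -
    have each: "real (card (Gs \<sigma>)) \<le> real (card G) / real K" for \<sigma>
    proof -
      have "real (K * card (Gs \<sigma>)) \<le> real (card G)" using cell[of \<sigma>] unfolding Gs_def of_nat_le_iff .
      then show ?thesis using K by (simp add: field_simps)
    qed
    have tot: "(\<Sum>\<sigma>\<in>\<Sigma>. card (Gs \<sigma>)) \<le> card G"
    proof -
      have "(\<Sum>\<sigma>\<in>\<Sigma>. card (Gs \<sigma>)) = card (\<Union>\<sigma>\<in>\<Sigma>. Gs \<sigma>)"
        using fS fin by (subst card_UN_disjoint) (auto simp: Gs_def)
      also have "\<dots> \<le> card G" using G by (intro card_mono) (auto simp: Gs_def)
      finally show ?thesis .
    qed
    have "(\<Sum>\<sigma>\<in>\<Sigma>. (real (card (Gs \<sigma>)))\<^sup>2) \<le> (\<Sum>\<sigma>\<in>\<Sigma>. real (card (Gs \<sigma>)) * (real (card G) / real K))"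
      unfolding power2_eq_square by (intro sum_mono mult_left_mono each) auto
    also have "\<dots> = real (\<Sum>\<sigma>\<in>\<Sigma>. card (Gs \<sigma>)) * (real (card G) / real K)"
      by (simp only: sum_distrib_right of_nat_sum)
    also have "\<dots> \<le> real (card G) * (real (card G) / real K)"
      using tot by (intro mult_right_mono of_nat_mono) auto
    finally show ?thesis by (simp add: power2_eq_square)
  qed
  have "real (incidences G \<Lambda>) \<le> real (card \<Lambda> * D + (card \<Lambda> * Suc D + (\<Sum>\<sigma>\<in>\<Sigma>. (card (Gs \<sigma>))\<^sup>2)))"
    using A B by linarith
  also have "\<dots> = real (card \<Lambda>) * (2 * real D + 1) + (\<Sum>\<sigma>\<in>\<Sigma>. (real (card (Gs \<sigma>)))\<^sup>2)"
    by (simp add: algebra_simps)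
  finally show ?thesis using C by linarith
qed

section \<open>Lines in the plane and the Szemeredi-Trotter bound\<close>

definition pline :: "(real ^ 2) set \<Rightarrow> bool" where
  "pline l \<longleftrightarrow> (\<exists>n c. n \<noteq> 0 \<and> l = {p. n \<bullet> p = c})"

lemma inner_real2: "(x :: real ^ 2) \<bullet> y = x $ 1 * y $ 1 + x $ 2 * y $ 2"
  by (simp add: inner_vec_def sum_2)

lemma pline_imp_aline:
  assumes "pline l" shows "aline l"
proof -
  obtain n c where n: "n \<noteq> 0" "l = {p. n \<bullet> p = c}" using assms by (auto simp: pline_def)
  define u :: "real ^ 2" where "u = vector [- (n $ 2), n $ 1]"
  define x where "x = (c / (n \<bullet> n)) *\<^sub>R n"
  have nn: "n \<bullet> n \<noteq> 0" using n(1) by simp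
  have u1: "u $ 1 = - (n $ 2)" "u $ 2 = n $ 1" by (auto simp: u_def)
  have u0: "u \<noteq> 0" using n(1) u1 by (auto simp: vec_eq_iff forall_2)
  have nu: "n \<bullet> u = 0" by (simp add: inner_real2 u1)
  have "l = range (\<lambda>t. x + t *\<^sub>R u)"
  proof (intro equalityI subsetI)
    fix p assume "p \<in> l"
    then have p: "n \<bullet> p = c" using n by simp
    define t where "t = (u \<bullet> p) / (n \<bullet> n)"
    have nn': "n \<bullet> n = n $ 1 * n $ 1 + n $ 2 * n $ 2" by (simp add: inner_real2)
    have "p $ 1 * (n \<bullet> n) = c * n $ 1 + (u \<bullet> p) * u $ 1" "p $ 2 * (n \<bullet> n) = c * n $ 2 + (u \<bullet> p) * u $ 2"
      unfolding p[symmetric] nn' by (simp_all add: inner_real2 u1 algebra_simps)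
    then have "p $ 1 = (c * n $ 1 + (u \<bullet> p) * u $ 1) / (n \<bullet> n)" "p $ 2 = (c * n $ 2 + (u \<bullet> p) * u $ 2) / (n \<bullet> n)"
      using nn by (metis nonzero_mult_div_cancel_right)+
    then have "p = x + t *\<^sub>R u"
      by (simp add: vec_eq_iff forall_2 x_def t_def add_divide_distrib)
    then show "p \<in> range (\<lambda>t. x + t *\<^sub>R u)" by blast
  next
    fix p assume "p \<in> range (\<lambda>t. x + t *\<^sub>R u)"
    then obtain t where "p = x + t *\<^sub>R u" by blast
    then have "n \<bullet> p = c" using nn by (simp add: inner_add_right nu x_def)
    then show "p \<in> l" using n by simp
  qed
  then show ?thesis using u0 by (auto simp: aline_def)
qed

text \<open>A generic line through \<open>x0\<close> meets the given lines in distinct points, and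
  all of these are roots of the nonzero restriction of \<open>f\<close>.\<close>

lemma card_plines_in_zero_set:
  assumes f: "poly_fun D f" "f x0 \<noteq> 0" and L: "finite \<Lambda>" "\<And>l. l \<in> \<Lambda> \<Longrightarrow> pline l \<and> (\<forall>x\<in>l. f x = 0)"
  shows "card \<Lambda> \<le> D"
proof -
  \<comment> \<open>Since \<open>x0\<close> is on no line, the equations can be normalized. The line
    from \<open>x0\<close> in direction \<open>u\<close> then crosses \<open>l\<close> at parameter
    \<open>1 / (m l \<bullet> u)\<close>.\<close>
  have "\<exists>m. l = {p. m \<bullet> (p - x0) = 1}" if l: "l \<in> \<Lambda>" for l
  proof -
    obtain n c where n: "n \<noteq> 0" "l = {p. n \<bullet> p = c}" using L(2)[OF l] by (auto simp: pline_def)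
    have "x0 \<notin> l" using L(2)[OF l] f(2) by blast
    then have e: "c - n \<bullet> x0 \<noteq> 0" using n(2) by auto
    have "n \<bullet> p = c \<longleftrightarrow> ((1 / (c - n \<bullet> x0)) *\<^sub>R n) \<bullet> (p - x0) = 1" for p
    proof -
      have "((1 / (c - n \<bullet> x0)) *\<^sub>R n) \<bullet> (p - x0) = (n \<bullet> p - n \<bullet> x0) / (c - n \<bullet> x0)"
        by (simp add: inner_diff_right diff_divide_distrib)
      then show ?thesis using e by auto
    qed
    then show ?thesis using n(2) by blast
  qed
  then obtain m where m: "\<And>l. l \<in> \<Lambda> \<Longrightarrow> l = {p. m l \<bullet> (p - x0) = 1}" by metis
  have minj: "m l \<noteq> m l'" if "l \<in> \<Lambda>" "l' \<in> \<Lambda>" "l \<noteq> l'" for l l' using m that by metis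
  have m0: "m l \<noteq> 0" if l: "l \<in> \<Lambda>" for l
  proof
    assume "m l = 0"
    then have "l = {}" using m[OF l] by simp
    moreover have "aline l" using L(2)[OF l] pline_imp_aline by blast
    ultimately show False by (auto simp: aline_def)
  qed
  define u :: "real \<Rightarrow> real ^ 2" where "u = (\<lambda>s. vector [1, s])"
  have iu: "v \<bullet> u s = v $ 1 + v $ 2 * s" for v s by (simp add: inner_real2 u_def)
  have fin1: "finite {s. v \<bullet> u s = 0}" if "v \<noteq> 0" for v
  proof -
    have "{s. v \<bullet> u s = 0} \<subseteq> {- (v $ 1) / v $ 2}"
    proof
      fix s assume "s \<in> {s. v \<bullet> u s = 0}"
      then have s: "v $ 1 + v $ 2 * s = 0" by (simp add: iu)
      have "v $ 2 \<noteq> 0"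
      proof
        assume "v $ 2 = 0"
        with s have "v = 0" by (simp add: vec_eq_iff forall_2)
        with that show False by blast
      qed
      then show "s \<in> {- (v $ 1) / v $ 2}" using s by (simp add: field_simps)
    qed
    then show ?thesis using finite_subset by blast
  qed
  \<comment> \<open>The forbidden slopes: those parallel to some line, and those for which two lines
    are crossed at the same parameter. Each condition excludes at most one slope.\<close>
  define B where "B = (\<Union>l\<in>\<Lambda>. {s. m l \<bullet> u s = 0}) \<union> (\<Union>l\<in>\<Lambda>. \<Union>l'\<in>\<Lambda> - {l}. {s. (m l - m l') \<bullet> u s = 0})"
  have fin2: "finite {s. (m l - m l') \<bullet> u s = 0}" if "l \<in> \<Lambda>" "l' \<in> \<Lambda> - {l}" for l l'
  proof (rule fin1)
    have "l \<noteq> l'" using that by blast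
    then show "m l - m l' \<noteq> 0" using minj[of l l'] that by simp
  qed
  have "finite B"
    unfolding B_def
    by (intro finite_UnI finite_UN_I fin1 fin2 m0) (use L(1) in auto)
  then obtain s where s: "s \<notin> B" using ex_new_if_finite infinite_UNIV_char_0 by blast
  have s1: "m l \<bullet> u s \<noteq> 0" if "l \<in> \<Lambda>" for l using s that by (auto simp: B_def)
  have s2: "m l \<bullet> u s \<noteq> m l' \<bullet> u s" if "l \<in> \<Lambda>" "l' \<in> \<Lambda>" "l \<noteq> l'" for l l'
    using s that by (auto simp: B_def inner_diff_left)
  obtain q where q: "degree q \<le> D" "\<And>t. f (x0 + t *\<^sub>R u s) = poly q t" using poly_fun_line[OF f(1)] by blast
  have q0: "q \<noteq> 0" using q(2)[of 0] f(2) by auto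
  have "inj_on (\<lambda>l. 1 / (m l \<bullet> u s)) \<Lambda>"
    using s1 s2 by (intro inj_onI) (metis divide_cancel_left one_neq_zero)
  moreover have "(\<lambda>l. 1 / (m l \<bullet> u s)) ` \<Lambda> \<subseteq> {t. poly q t = 0}"
  proof clarify
    fix l assume l: "l \<in> \<Lambda>"
    have "m l \<bullet> (x0 + (1 / (m l \<bullet> u s)) *\<^sub>R u s - x0) = 1" using s1[OF l] by simp
    then have "x0 + (1 / (m l \<bullet> u s)) *\<^sub>R u s \<in> l" using m[OF l] by blast
    then show "poly q (1 / (m l \<bullet> u s)) = 0" using L(2)[OF l] q(2) by metis
  qed
  ultimately have "card \<Lambda> \<le> card {t. poly q t = 0}"
    using card_inj_on_le poly_roots_finite[OF q0] by blast
  also have "\<dots> \<le> D" using card_poly_roots_bound[OF q0] q(1) by simp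
  finally show ?thesis .
qed


text \<open>The \<open>m * k\<close> incidences are compared with the bound from a partition into
  \<open>4 ^ q\<close> cells. At most \<open>D\<close> lines lie in the zero set, and
  \<open>k \<ge> 64\<close> absorbs the \<open>m\<close> incidences that they may have beyond
  \<open>D\<^sup>2\<close>.\<close>

theorem Szemeredi_Trotter_rich:
  fixes G :: "(real ^ 2) set"
  assumes G: "finite G" and L: "finite \<Lambda>" "\<And>l. l \<in> \<Lambda> \<Longrightarrow> pline l"
    and rich: "\<And>g. g \<in> G \<Longrightarrow> k \<le> card {l \<in> \<Lambda>. g \<in> l}" and k: "64 \<le> k"
  shows "real (card G) \<le> 147456 * ((real (card \<Lambda>))\<^sup>2 / real k ^ 3 + real (card \<Lambda>) / real k)"
proof (cases "G = {}")
  case True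
  then show ?thesis by simp
next
  case False
  define m n where "m = card G" and "n = card \<Lambda>"
  have m0: "m > 0" using False G by (simp add: m_def card_gt_0_iff)
  obtain g0 where "g0 \<in> G" using False by blast
  then have "k \<le> card {l \<in> \<Lambda>. g0 \<in> l}" by (rule rich)
  also have "\<dots> \<le> n" unfolding n_def using L(1) by (intro card_mono) auto
  finally have kn: "k \<le> n" .
  have al: "aline l" if "l \<in> \<Lambda>" for l using L(2)[OF that] pline_imp_aline by blast
  \<comment> \<open>The coarsest partition for which the cell term \<open>m\<^sup>2 / 4 ^ q\<close>
    is at most a quarter of \<open>m * k\<close>.\<close>
  define q where "q = (LEAST q. 4 * m \<le> 4 ^ q * k)"
  have "4 * m \<le> 4 ^ Suc m * k"
  proof -
    have "m \<le> 2 ^ m" using less_exp[of m] by simp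
    also have "\<dots> \<le> (4::nat) ^ m" by (rule power_mono) auto
    also have "\<dots> \<le> 4 ^ m * k" using k by simp
    finally show ?thesis by simp
  qed
  then have q1: "4 * m \<le> 4 ^ q * k" unfolding q_def by (rule LeastI)
  define D where "D = 2 * 2\<^sup>2 * (2::nat) ^ q"
  define b :: "nat \<Rightarrow> real ^ 2" where "b = (\<lambda>i. if i = 0 then axis 1 1 else axis 2 1)"
  have orth: "b i \<bullet> b j = (if i = j then 1 else 0)" if "i < 2" "j < 2" for i j
    using that by (auto simp: b_def inner_axis_axis less_2_cases_iff)
  obtain f and \<kappa> :: "real ^ 2 \<Rightarrow> nat \<Rightarrow> bool" where f: "poly_fun D f" "\<exists>x. f x \<noteq> 0"
    "\<And>\<sigma>. 2 ^ (2 * q) * card {x \<in> G. f x \<noteq> 0 \<and> \<kappa> x = \<sigma>} \<le> card G"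
    "few_cells D f \<kappa>"
    using polynomial_partitioning[of 2 b G D q, OF orth _ G D_def] by auto
  define LZ where "LZ = {l \<in> \<Lambda>. \<forall>x\<in>l. f x = 0}"
  obtain x0 where x0: "f x0 \<noteq> 0" using f(2) by blast
  have LZ: "finite LZ" "finite (\<Lambda> - LZ)" using L(1) by (simp_all add: LZ_def)
  have LZD: "card LZ \<le> D"
    by (rule card_plines_in_zero_set[OF f(1) x0 LZ(1)]) (use L(2) in \<open>auto simp: LZ_def\<close>)
  have "real (incidences G (\<Lambda> - LZ)) \<le> real (card (\<Lambda> - LZ)) * (2 * real D + 1) + (real (card G))\<^sup>2 / real (2 ^ (2 * q))"
    by (rule incidences_cells[OF f(1) G LZ(2) _ _ f(3) _ f(4)]) (use al in \<open>auto simp: LZ_def\<close>)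
  also have "\<dots> \<le> real n * (2 * real D + 1) + (real m)\<^sup>2 / 4 ^ q"
    using L(1) by (intro add_mono mult_right_mono) (auto simp: n_def m_def power_mult intro!: card_mono)
  finally have A: "real (incidences G (\<Lambda> - LZ)) \<le> real n * (2 * real D + 1) + (real m)\<^sup>2 / 4 ^ q" .
  have "incidences G LZ \<le> card G + (card LZ)\<^sup>2" using G LZ al by (intro incidences_le_points) (auto simp: LZ_def)
  also have "\<dots> \<le> m + D\<^sup>2" using LZD by (simp add: m_def power_mono)
  finally have "incidences G LZ \<le> m + D\<^sup>2" .
  then have B: "real (incidences G LZ) \<le> real m + (real D)\<^sup>2"
    by (metis of_nat_add of_nat_le_iff of_nat_power)
  have "incidences G \<Lambda> = incidences G (\<Lambda> - LZ) + incidences G LZ"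
    by (rule incidences_split) (use G L(1) in \<open>auto simp: LZ_def\<close>)
  moreover have "(\<Sum>g\<in>G. k) \<le> incidences G \<Lambda>"
    unfolding incidences_sum_points[OF G L(1)] by (rule sum_mono) (rule rich)
  then have "m * k \<le> incidences G \<Lambda>" by (simp add: m_def)
  ultimately have "m * k \<le> incidences G (\<Lambda> - LZ) + incidences G LZ" by linarith
  then have "real (m * k) \<le> real (incidences G (\<Lambda> - LZ)) + real (incidences G LZ)" by (metis of_nat_add of_nat_le_iff)
  then have C: "real m * real k \<le> real n * (2 * real D + 1) + (real m)\<^sup>2 / 4 ^ q + real m + (real D)\<^sup>2"
    using A B by simp
  have "real (4 * m) \<le> real (4 ^ q * k)" using q1 of_nat_le_iff by blast
  then have "real m * (4 * real m) \<le> real m * (4 ^ q * real k)" by (intro mult_left_mono) auto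
  then have E: "(real m)\<^sup>2 / 4 ^ q \<le> real m * real k / 4"
    by (simp add: power2_eq_square field_simps)
  have k': "real k \<ge> 64" using k by simp
  have "real m * 64 \<le> real m * real k" by (intro mult_left_mono k') auto
  then have C2: "real m * real k / 2 \<le> real n * (2 * real D + 1) + (real D)\<^sup>2"
    using C E by linarith
  have nk: "real n \<ge> real k" using kn by simp
  show ?thesis
  \<comment> \<open>For \<open>q = 0\<close> the degree is 8 and the term \<open>n / k\<close>
    results. Otherwise minimality of \<open>q\<close> gives \<open>D\<^sup>2 * k < 1024 * m\<close>,
    and squaring \<open>m * k \<le> 12 * n * D\<close> produces the constant
    \<open>147456 = 144 * 1024\<close>.\<close>
  proof (cases "q = 0")
    case True
    then have "real D = 8" by (simp add: D_def)
    then have "real m * real k \<le> 34 * real n + 128" using C2 by (simp add: field_simps)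
    then have "real m * real k \<le> 36 * real n" using nk k' by linarith
    then have "real m \<le> 36 * real n / real k" using k' by (simp add: field_simps)
    also have "\<dots> \<le> 147456 * (real n / real k)" using k' by (simp add: field_simps)
    also have "\<dots> \<le> 147456 * ((real n)\<^sup>2 / real k ^ 3 + real n / real k)" by simp
    finally show ?thesis by (simp add: m_def n_def)
  next
    case False
    then have "\<not> 4 * m \<le> 4 ^ (q - 1) * k"
      unfolding q_def using not_less_Least[of "q - 1" "\<lambda>q. 4 * m \<le> 4 ^ q * k"] by (simp add: q_def)
    then have "4 ^ (q - 1) * k < 4 * m" by simp
    moreover have "(4::nat) ^ q = 4 * 4 ^ (q - 1)" using False by (cases q) auto
    ultimately have "4 ^ q * k < 16 * m" by (simp add: mult.commute)
    then have "real (4 ^ q * k) < real (16 * m)" using of_nat_less_iff by blast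
    then have qk: "4 ^ q * real k < 16 * real m" by simp
    have D2: "(real D)\<^sup>2 = 64 * 4 ^ q"
    proof -
      have "((2::real) ^ q)\<^sup>2 = (2\<^sup>2) ^ q" by (metis mult.commute power_mult)
      then show ?thesis by (simp add: D_def power_mult_distrib)
    qed
    have Dk: "(real D)\<^sup>2 * real k < 1024 * real m" using qk D2 by (simp add: mult.commute)
    have "(real D)\<^sup>2 * (64 * 64) \<le> (real D)\<^sup>2 * (real k * real k)"
      using k' by (intro mult_left_mono mult_mono) auto
    also have "\<dots> \<le> 1024 * real m * real k"
      using mult_right_mono[OF less_imp_le[OF Dk], of "real k"] by (simp add: mult.assoc)
    finally have "(real D)\<^sup>2 \<le> real m * real k / 4" by (simp add: algebra_simps)
    then have "real m * real k / 4 \<le> real n * (2 * real D + 1)" using C2 by linarith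
    also have "\<dots> \<le> real n * (3 * real D)"
    proof (intro mult_left_mono)
      have "D \<ge> 1" by (simp add: D_def)
      then show "2 * real D + 1 \<le> 3 * real D" by simp
    qed simp
    finally have "real m * real k \<le> 12 * real n * real D" by simp
    then have "(real m * real k)\<^sup>2 \<le> (12 * real n * real D)\<^sup>2" by (intro power_mono) auto
    then have "(real m * real k)\<^sup>2 * real k \<le> (12 * real n * real D)\<^sup>2 * real k" by (intro mult_right_mono) auto
    also have "\<dots> = 144 * (real n)\<^sup>2 * ((real D)\<^sup>2 * real k)" by (simp add: power_mult_distrib)
    also have "\<dots> \<le> 144 * (real n)\<^sup>2 * (1024 * real m)" using Dk by (intro mult_left_mono) auto
    finally have "real m * (real m * real k ^ 3) \<le> real m * (147456 * (real n)\<^sup>2)"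
      by (simp add: power2_eq_square power3_eq_cube algebra_simps)
    then have "real m * real k ^ 3 \<le> 147456 * (real n)\<^sup>2" using m0 by simp
    then have "real m \<le> 147456 * ((real n)\<^sup>2 / real k ^ 3)" using k' by (simp add: field_simps)
    also have "\<dots> \<le> 147456 * ((real n)\<^sup>2 / real k ^ 3 + real n / real k)" by simp
    finally show ?thesis by (simp add: m_def n_def)
  qed
qed

text \<open>Summation by parts: a square is \<open>K\<^sup>2\<close> plus the increments
  \<open>2 * k - 1\<close> for \<open>k\<close> above \<open>K\<close>, rounded up to
  \<open>2 * k\<close>. Exchanging the sums leaves the sizes of the level sets, to which bounds on
  rich points apply.\<close>

lemma sum_squares_layers:
  fixes d :: "'a \<Rightarrow> nat"
  assumes G: "finite G" and dM: "\<And>g. g \<in> G \<Longrightarrow> d g \<le> M"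
  shows "(\<Sum>g | g \<in> G \<and> K \<le> d g. (d g)\<^sup>2) \<le>
     K\<^sup>2 * card {g \<in> G. K \<le> d g} + (\<Sum>k=Suc K..M. 2 * k * card {g \<in> G. k \<le> d g})"
proof -
  let ?H = "{g \<in> G. K \<le> d g}"
  have H: "finite ?H" using G by simp
  have one: "x\<^sup>2 \<le> K\<^sup>2 + (\<Sum>k=Suc K..x. 2 * k)" if "K \<le> x" for x
    using that by (induction x rule: dec_induct) (auto simp: power2_eq_square)
  have each: "(d g)\<^sup>2 \<le> K\<^sup>2 + (\<Sum>k=Suc K..M. if k \<le> d g then 2 * k else 0)" if g: "g \<in> ?H" for g
  proof -
    have "(\<Sum>k=Suc K..d g. 2 * k) = (\<Sum>k=Suc K..d g. if k \<le> d g then 2 * k else 0)"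
      by (intro sum.cong) auto
    also have "\<dots> \<le> (\<Sum>k=Suc K..M. if k \<le> d g then 2 * k else 0)"
      using dM g by (intro sum_mono2) auto
    finally show ?thesis using one[of "d g"] g by auto
  qed
  have "(\<Sum>g\<in>?H. (d g)\<^sup>2) \<le> (\<Sum>g\<in>?H. K\<^sup>2 + (\<Sum>k=Suc K..M. if k \<le> d g then 2 * k else 0))"
    by (rule sum_mono) (rule each)
  also have "\<dots> = K\<^sup>2 * card ?H + (\<Sum>k=Suc K..M. \<Sum>g\<in>?H. if k \<le> d g then 2 * k else 0)"
    by (simp add: sum.distrib sum.swap[of _ ?H])
  also have "(\<Sum>k=Suc K..M. \<Sum>g\<in>?H. if k \<le> d g then 2 * k else 0) = (\<Sum>k=Suc K..M. 2 * k * card {g \<in> G. k \<le> d g})"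
  proof (intro sum.cong refl)
    fix k assume k: "k \<in> {Suc K..M}"
    have "(\<Sum>g\<in>?H. if k \<le> d g then 2 * k else 0) = 2 * k * card {g \<in> ?H. k \<le> d g}"
      using H by (simp flip: sum.inter_filter)
    also have "{g \<in> ?H. k \<le> d g} = {g \<in> G. k \<le> d g}" using k by auto
    finally show "(\<Sum>g\<in>?H. if k \<le> d g then 2 * k else 0) = 2 * k * card {g \<in> G. k \<le> d g}" .
  qed
  finally show ?thesis by simp
qed

lemma sum_inverse_squares_le:
  assumes "K \<ge> 1"
  shows "(\<Sum>k=Suc K..M. 1 / (real k)\<^sup>2) \<le> 1 / real K"
proof (cases "K \<le> M")
  case True
  have "(\<Sum>k=Suc K..M. 1 / (real k)\<^sup>2) \<le> 1 / real K - 1 / real M"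
    using True
  proof (induction M rule: dec_induct)
    case (step m)
    have "1 / (real (Suc m))\<^sup>2 \<le> 1 / real m - 1 / real (Suc m)"
    proof -
      have m: "real m > 0" using step assms by simp
      then have "1 / real m - 1 / real (Suc m) = 1 / (real m * real (Suc m))" by (simp add: field_simps)
      moreover have "1 / (real (Suc m))\<^sup>2 \<le> 1 / (real m * real (Suc m))"
        using m by (intro divide_left_mono) (auto simp: power2_eq_square intro!: mult_right_mono)
      ultimately show ?thesis by simp
    qed
    then show ?case using step by simp
  qed simp
  moreover have "1 / real M \<ge> 0" by simp
  ultimately show ?thesis by linarith
qed simp

text \<open>In layer \<open>k\<close> the two Szemeredi-Trotter terms become
  \<open>n\<^sup>2 / k\<^sup>2\<close>, which sums to \<open>n\<^sup>2 / K\<close>, and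
  \<open>n\<close>, which is paid at most \<open>M\<close> times. The constant is
  \<open>3 * 147456\<close>.\<close>

lemma sum_squares_rich_points:
  fixes G :: "(real ^ 2) set"
  assumes G: "finite G" and L: "finite \<Lambda>" "\<And>l. l \<in> \<Lambda> \<Longrightarrow> pline l"
    and dM: "\<And>g. g \<in> G \<Longrightarrow> card {l \<in> \<Lambda>. g \<in> l} \<le> M" and K: "64 \<le> K"
  shows "(\<Sum>g | g \<in> G \<and> K \<le> card {l \<in> \<Lambda>. g \<in> l}. (real (card {l \<in> \<Lambda>. g \<in> l}))\<^sup>2)
    \<le> 442368 * ((real (card \<Lambda>))\<^sup>2 / real K + real (card \<Lambda>) * real M)"
proof (cases "\<exists>g\<in>G. K \<le> card {l \<in> \<Lambda>. g \<in> l}")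
  case False
  then have *: "{g. g \<in> G \<and> K \<le> card {l \<in> \<Lambda>. g \<in> l}} = {}" by auto
  show ?thesis unfolding * by simp
next
  case True
  then have KM: "K \<le> M" using dM by (meson le_trans)
  define d where "d = (\<lambda>g. card {l \<in> \<Lambda>. g \<in> l})"
  define n where "n = real (card \<Lambda>)"
  define C :: real where "C = 147456"
  have ST: "real (card {g \<in> G. k \<le> d g}) \<le> C * (n\<^sup>2 / real k ^ 3 + n / real k)" if "64 \<le> k" for k
    unfolding n_def C_def
    by (rule Szemeredi_Trotter_rich) (use G L that in \<open>auto simp: d_def\<close>)
  have n0: "n \<ge> 0" by (simp add: n_def)
  have K0: "real K > 0" using K by simp
  have "(\<Sum>g | g \<in> G \<and> K \<le> d g. (real (d g))\<^sup>2) = real (\<Sum>g | g \<in> G \<and> K \<le> d g. (d g)\<^sup>2)" by simp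
  also have "\<dots> \<le> real (K\<^sup>2 * card {g \<in> G. K \<le> d g} + (\<Sum>k=Suc K..M. 2 * k * card {g \<in> G. k \<le> d g}))"
    using sum_squares_layers[OF G, of d M K] dM unfolding d_def of_nat_le_iff by blast
  also have "\<dots> = (real K)\<^sup>2 * real (card {g \<in> G. K \<le> d g}) + (\<Sum>k=Suc K..M. 2 * real k * real (card {g \<in> G. k \<le> d g}))"
    by simp
  also have "\<dots> \<le> (real K)\<^sup>2 * (C * (n\<^sup>2 / real K ^ 3 + n / real K)) +
      (\<Sum>k=Suc K..M. 2 * real k * (C * (n\<^sup>2 / real k ^ 3 + n / real k)))"
    using K by (intro add_mono mult_left_mono sum_mono ST) auto
  also have "(\<Sum>k=Suc K..M. 2 * real k * (C * (n\<^sup>2 / real k ^ 3 + n / real k))) =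
      (\<Sum>k=Suc K..M. 2 * C * n\<^sup>2 * (1 / (real k)\<^sup>2) + 2 * C * n)"
    by (intro sum.cong refl) (auto simp: field_simps power2_eq_square power3_eq_cube)
  also have "\<dots> = 2 * C * n\<^sup>2 * (\<Sum>k=Suc K..M. 1 / (real k)\<^sup>2) + 2 * C * n * real (M - K)"
    by (simp add: sum.distrib sum_distrib_left)
  also have "\<dots> \<le> 2 * C * n\<^sup>2 * (1 / real K) + 2 * C * n * real M"
    using K n0 by (intro add_mono mult_left_mono sum_inverse_squares_le) (auto simp: C_def)
  also have "(real K)\<^sup>2 * (C * (n\<^sup>2 / real K ^ 3 + n / real K)) = C * (n\<^sup>2 / real K) + C * n * real K"
    using K0 by (simp add: field_simps power2_eq_square power3_eq_cube)
  also have "C * (n\<^sup>2 / real K) + C * n * real K \<le> C * (n\<^sup>2 / real K) + C * n * real M"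
    using KM n0 by (intro add_left_mono mult_left_mono) (auto simp: C_def)
  finally have "(\<Sum>g | g \<in> G \<and> K \<le> d g. (real (d g))\<^sup>2) \<le> 3 * C * (n\<^sup>2 / real K + n * real M)"
    by (simp add: algebra_simps)
  then show ?thesis by (simp add: C_def d_def n_def)
qed

section \<open>Rich points of lines in space\<close>

lemma DERIV_along_line:
  fixes f :: "'a::euclidean_space \<Rightarrow> real"
  assumes "\<And>x. (f has_derivative (\<lambda>w. g w x)) (at x)"
  shows "((\<lambda>t. f (x + t *\<^sub>R u)) has_field_derivative g u (x + t *\<^sub>R u)) (at t)"
proof -
  have lin: "linear (\<lambda>w. g w (x + t *\<^sub>R u))"
    using assms has_derivative_linear by blast
  have "((\<lambda>t. x + t *\<^sub>R u) has_derivative (\<lambda>s. s *\<^sub>R u)) (at t)"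
    by (rule derivative_eq_intros | simp)+
  then have "((\<lambda>t. f (x + t *\<^sub>R u)) has_derivative (\<lambda>s. g (s *\<^sub>R u) (x + t *\<^sub>R u))) (at t)"
    using has_derivative_compose assms by blast
  then show ?thesis
    unfolding has_field_derivative_def
    by (simp add: linear_scale[OF lin] mult_commute_abs)
qed

lemma zero_derivative_along_line:
  fixes f :: "'a::euclidean_space \<Rightarrow> real"
  assumes "\<And>x. (f has_derivative (\<lambda>w. g w x)) (at x)" and "\<And>t. f (x + t *\<^sub>R u) = 0"
  shows "g u (x + t *\<^sub>R u) = 0"
proof -
  have "((\<lambda>t. f (x + t *\<^sub>R u)) has_field_derivative 0) (at t)"
    unfolding assms(2) by simp
  then show ?thesis using DERIV_unique[OF DERIV_along_line[of f g x u t, OF assms(1)]] by simp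
qed

text \<open>If \<open>a\<close> had a zero of finite order \<open>n \<ge> 1\<close> at 0, then
  \<open>pderiv a * b\<close> would have order \<open>n - 1\<close> there, but
  \<open>a * pderiv b\<close> order at least \<open>n\<close>.\<close>

lemma Wronskian_zero_imp_zero:
  fixes a b :: "real poly"
  assumes W: "pderiv a * b = a * pderiv b" and "poly a 0 = 0" "poly b 0 \<noteq> 0"
  shows "a = 0"
proof (rule ccontr)
  assume a: "a \<noteq> 0"
  obtain c where c: "a = [:- 0, 1:] ^ Polynomial.order 0 a * c" "\<not> [:- 0, 1:] dvd c"
    using order_decomp[OF a] by blast
  define n where "n = Polynomial.order 0 a"
  have n0: "n > 0" using assms(2) a order_root[of a 0] by (simp add: n_def)
  then obtain k where k: "n = Suc k" by (cases n) auto
  have c0: "poly c 0 \<noteq> 0" using c(2) by (simp add: poly_eq_0_iff_dvd)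
  let ?X = "[:0, 1:] :: real poly"
  have ac: "a = ?X ^ Suc k * c" using c(1) k by (simp add: n_def)
  have pd: "pderiv a = ?X ^ k * (Polynomial.smult (real (Suc k)) c + ?X * pderiv c)"
  proof -
    have pX: "pderiv ?X = 1" by (simp add: pderiv_pCons)
    show ?thesis unfolding ac pderiv_mult pderiv_power_Suc pX by (simp add: algebra_simps smult_add_right)
  qed
  have "?X ^ k * ((Polynomial.smult (real (Suc k)) c + ?X * pderiv c) * b) = ?X ^ k * (?X * c * pderiv b)"
    using W unfolding pd by (simp add: ac algebra_simps)
  then have "(Polynomial.smult (real (Suc k)) c + ?X * pderiv c) * b = ?X * c * pderiv b"
    by (subst (asm) mult_cancel_left) simp
  then have "poly ((Polynomial.smult (real (Suc k)) c + ?X * pderiv c) * b) 0 = poly (?X * c * pderiv b) 0" by simp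
  then have "(1 + real k) * poly c 0 * poly b 0 = 0" by (simp add: algebra_simps)
  then show False using c0 assms(3) by (simp add: add_nonneg_eq_0_iff)
qed

lemma plane_spanned:
  fixes v u w :: "'a::euclidean_space"
  assumes dim: "DIM('a) = 3" and v: "v \<noteq> 0" and uw: "v \<bullet> u = 0" "v \<bullet> w = 0"
    and ind: "u \<noteq> 0" "\<And>c. w \<noteq> c *\<^sub>R u" and y: "v \<bullet> y = 0"
  obtains a b where "y = a *\<^sub>R u + b *\<^sub>R w"
proof -
  have "u \<noteq> w" using ind(2)[of 1] by auto
  have i: "independent {w, u}"
    unfolding independent_insert using ind \<open>u \<noteq> w\<close> by (auto simp: span_singleton independent_empty)
  have "dim {x. v \<bullet> x = 0} = 2" using dim_hyperplane[OF v] dim by simp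
  then have "{x. v \<bullet> x = 0} \<subseteq> span {w, u}"
    using uw i \<open>u \<noteq> w\<close> by (intro card_ge_dim_independent) auto
  then have "y \<in> span {w, u}" using y by blast
  then obtain k where "y - k *\<^sub>R w \<in> span {u}" using span_breakdown_eq by blast
  then obtain a where "y - k *\<^sub>R w = a *\<^sub>R u" by (auto simp: span_singleton)
  then have "y = a *\<^sub>R u + k *\<^sub>R w" by (simp add: algebra_simps)
  then show thesis by (rule that)
qed

lemma linear_functional_inner:
  fixes \<phi> :: "'a::euclidean_space \<Rightarrow> real"
  assumes "linear \<phi>"
  shows "\<phi> w = (\<Sum>b\<in>Basis. \<phi> b *\<^sub>R b) \<bullet> w"
proof -
  have "\<phi> w = \<phi> (\<Sum>b\<in>Basis. (w \<bullet> b) *\<^sub>R b)" by (simp add: euclidean_representation)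
  also have "\<dots> = (\<Sum>b\<in>Basis. (w \<bullet> b) * \<phi> b)" by (simp add: linear_sum[OF assms] linear_scale[OF assms])
  also have "\<dots> = (\<Sum>b\<in>Basis. \<phi> b *\<^sub>R b) \<bullet> w"
    unfolding inner_sum_left by (intro sum.cong) (auto simp: inner_commute)
  finally show ?thesis .
qed

lemma parallel_lines_through_point:
  assumes "range (\<lambda>t. x + t *\<^sub>R u) \<noteq> range (\<lambda>t. x + t *\<^sub>R w)" "u \<noteq> 0" "w \<noteq> (0::'a::euclidean_space)"
  shows "w \<noteq> c *\<^sub>R u"
proof
  assume w: "w = c *\<^sub>R u"
  then have c: "c \<noteq> 0" using assms(3) by auto
  have "x + t *\<^sub>R u = x + (t / c) *\<^sub>R w" for t using c w by simp
  moreover have "x + t *\<^sub>R w = x + (t * c) *\<^sub>R u" for t using w by simp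
  ultimately have "range (\<lambda>t. x + t *\<^sub>R u) = range (\<lambda>t. x + t *\<^sub>R w)" by blast
  with assms(1) show False by blast
qed

text \<open>At a regular point the three lines lie in the tangent plane, and the Hessian form
  vanishes on their pairwise independent directions. A quadratic form on a plane with three
  isotropic lines is zero.\<close>

lemma three_lines_flat:
  fixes f :: "'a::euclidean_space \<Rightarrow> real"
  assumes dim: "DIM('a) = 3"
    and g: "\<And>x. (f has_derivative (\<lambda>w. g w x)) (at x)"
    and h: "\<And>w x. (g w has_derivative (\<lambda>u. h u w x)) (at x)" and sym: "\<And>u w x. h u w x = h w u x"
    and lines: "\<And>l. l \<in> \<Lambda> \<Longrightarrow> aline l \<and> (\<forall>x\<in>l. f x = 0)"
    and three: "3 \<le> card {l \<in> \<Lambda>. x \<in> l}" and reg: "g z x \<noteq> 0"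
    and l: "l \<in> \<Lambda>" "l = range (\<lambda>t. x + t *\<^sub>R u)" "u \<noteq> 0" and w: "g w x = 0"
  shows "h u w x = 0"
proof -
  have ling: "linear (\<lambda>w. g w x)" using g has_derivative_linear by blast
  have linh: "linear (\<lambda>u. h u w x)" for w using h has_derivative_linear by blast
  have linh2: "linear (\<lambda>w. h u w x)" for u using linh[of u] unfolding sym[of _ u] .
  define v where "v = (\<Sum>b\<in>Basis. g b x *\<^sub>R b)"
  have gv: "g w x = v \<bullet> w" for w unfolding v_def by (rule linear_functional_inner[OF ling])
  have v0: "v \<noteq> 0" using reg gv[of z] by auto
  let ?A = "{l \<in> \<Lambda>. x \<in> l}"
  have xl: "x \<in> l" using l(2) by (metis add.right_neutral rangeI scaleR_zero_left)
  have fin: "finite ?A" by (rule card_ge_0_finite) (use three in simp)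
  have "card (?A - {l}) \<ge> 2" using three l(1) xl fin by (simp add: card_Diff_singleton)
  then obtain l2 l3 where l23: "l2 \<in> ?A - {l}" "l3 \<in> ?A - {l}" "l2 \<noteq> l3"
    using card_le_Suc0_iff_eq[of "?A - {l}"] fin by force
  obtain u2 where u2: "u2 \<noteq> 0" "l2 = range (\<lambda>t. x + t *\<^sub>R u2)" using aline_at[of l2 x] lines l23(1) by auto
  obtain u3 where u3: "u3 \<noteq> 0" "l3 = range (\<lambda>t. x + t *\<^sub>R u3)" using aline_at[of l3 x] lines l23(2) by auto
  have tang: "g y x = 0 \<and> h y y x = 0" if "range (\<lambda>t. x + t *\<^sub>R y) \<in> \<Lambda>" for y
  proof -
    have z: "f (x + t *\<^sub>R y) = 0" for t using lines[OF that] by blast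
    have z1: "g y (x + t *\<^sub>R y) = 0" for t by (rule zero_derivative_along_line[of f g, OF g z])
    have z2: "h y y (x + t *\<^sub>R y) = 0" for t by (rule zero_derivative_along_line[of "g y" "\<lambda>u. h u y", OF h z1])
    show ?thesis using z1[of 0] z2[of 0] by simp
  qed
  have t1: "g u x = 0" "h u u x = 0" and t2: "g u2 x = 0" "h u2 u2 x = 0" and t3: "g u3 x = 0" "h u3 u3 x = 0"
    using tang[of u] tang[of u2] tang[of u3] l u2 u3 l23 by auto
  have n12: "u2 \<noteq> c *\<^sub>R u" for c
    by (rule parallel_lines_through_point[of x]) (use l u2 l23 in auto)
  have n13: "u3 \<noteq> c *\<^sub>R u" for c
    by (rule parallel_lines_through_point[of x]) (use l u3 l23 in auto)
  have n23: "u3 \<noteq> c *\<^sub>R u2" for c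
    by (rule parallel_lines_through_point[of x]) (use u2 u3 l23 in auto)
  obtain a b where ab: "u3 = a *\<^sub>R u + b *\<^sub>R u2"
    using plane_spanned[OF dim v0, of u u2 u3] t1 t2 t3 gv l(3) n12 by metis
  have a0: "a \<noteq> 0" using n23[of b] ab by auto
  have b0: "b \<noteq> 0" using n13[of a] ab by auto
  have lin: "h (\<alpha> *\<^sub>R p + \<beta> *\<^sub>R q) w x = \<alpha> * h p w x + \<beta> * h q w x" for \<alpha> \<beta> p q w
    using linear_add[OF linh] linear_scale[OF linh] by simp
  have lin2: "h w (\<alpha> *\<^sub>R p + \<beta> *\<^sub>R q) x = \<alpha> * h w p x + \<beta> * h w q x" for \<alpha> \<beta> p q w
    using linear_add[OF linh2] linear_scale[OF linh2] by simp
  have "0 = h u3 u3 x" using t3 by simp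
  \<comment> \<open>The diagonal terms vanish because \<open>f\<close> is zero along the first two
    lines, so the third line controls the mixed term.\<close>
  also have "\<dots> = 2 * a * b * h u u2 x"
    unfolding ab lin lin2 using t1 t2 sym[of u2 u x] by simp
  finally have hu: "h u u2 x = 0" using a0 b0 by simp
  obtain c d where cd: "w = c *\<^sub>R u + d *\<^sub>R u2"
    using plane_spanned[OF dim v0, of u u2 w] t1 t2 w gv l(3) n12 by metis
  show ?thesis unfolding cd lin2 using hu t1 by simp
qed

text \<open>A nonzero polynomial of least degree vanishing on the lines has a line with few critical
  points. The remaining points \<open>R\<close> on it are regular and flat, and
  \<open>card R > 2 * D\<close> is enough to make the tangent plane constant along that
  line.\<close>

lemma rich_lines_in_plane:
  fixes \<Lambda> :: "'a::euclidean_space set set"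
  assumes dim: "DIM('a) = 3" and L: "finite \<Lambda>" "\<Lambda> \<noteq> {}" "\<And>l. l \<in> \<Lambda> \<Longrightarrow> aline l"
    and G: "finite G" and f0: "poly_fun D f0" "\<exists>x. f0 x \<noteq> 0" "\<And>l x. l \<in> \<Lambda> \<Longrightarrow> x \<in> l \<Longrightarrow> f0 x = 0"
    and three: "\<And>x. x \<in> G \<Longrightarrow> 3 \<le> card {l \<in> \<Lambda>. x \<in> l}"
    and many: "\<And>l. l \<in> \<Lambda> \<Longrightarrow> 3 * D < card {x \<in> G. x \<in> l}"
  shows "\<exists>l\<in>\<Lambda>. \<exists>R v c. v \<noteq> 0 \<and> R \<subseteq> {x \<in> G. x \<in> l} \<and> card {x \<in> G. x \<in> l} \<le> card R + D \<and>
    (\<forall>x\<in>R. \<forall>l'\<in>\<Lambda>. x \<in> l' \<longrightarrow> l' \<subseteq> {y. v \<bullet> y = c})"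
proof -
  define Q where "Q = (\<lambda>d. \<exists>f. poly_fun d f \<and> (\<exists>x. f x \<noteq> 0) \<and> (\<forall>l\<in>\<Lambda>. \<forall>x\<in>l. f (x::'a) = 0))"
  define d where "d = (LEAST d. Q d)"
  have QD: "Q D" using f0 by (auto simp: Q_def)
  have dD: "d \<le> D" unfolding d_def by (rule Least_le[of Q, OF QD])
  have "Q d" unfolding d_def by (rule LeastI[of Q, OF QD])
  then obtain f where f: "poly_fun d f" "\<exists>x. f x \<noteq> 0" "\<And>l x. l \<in> \<Lambda> \<Longrightarrow> x \<in> l \<Longrightarrow> f x = 0"
    unfolding Q_def by blast
  have notQ: "\<not> Q e" if "e < d" for e using that not_less_Least unfolding d_def by blast
  obtain g h where g: "\<And>x. (f has_derivative (\<lambda>w. g w x)) (at x)"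
     and h: "\<And>w x. (g w has_derivative (\<lambda>u. h u w x)) (at x)" and sym: "\<And>u w x. h u w x = h w u x"
     and gp: "\<And>w. poly_fun (d - 1) (g w)" and g0: "d = 0 \<Longrightarrow> (\<forall>w x. g w x = 0)"
    using poly_fun_derivatives[OF f(1)] by blast
  \<comment> \<open>Otherwise every derivative \<open>g w\<close>, of degree at most
    \<open>d - 1\<close>, has more than \<open>d\<close> zeros on each line and so vanishes on all
    of them. Minimality makes all derivatives zero, hence \<open>f\<close> constant and equal to its
    value 0 on a line.\<close>
  have "\<exists>l\<in>\<Lambda>. card {x \<in> G. x \<in> l \<and> (\<forall>w. g w x = 0)} \<le> d"
  proof (rule ccontr)
    assume "\<not> ?thesis"
    then have crit: "d < card {x \<in> G. x \<in> l \<and> (\<forall>w. g w x = 0)}" if "l \<in> \<Lambda>" for l using that by force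
    have van: "g w x = 0" if l: "l \<in> \<Lambda>" "x \<in> l" for w l x
    proof (rule ccontr)
      assume "g w x \<noteq> 0"
      then have *: "finite {x \<in> l. g w x = 0}" "card {x \<in> l. g w x = 0} \<le> d - 1"
        using poly_fun_zeros_on_line[OF gp L(3)[OF l(1)] l(2)] by blast+
      have "card {x \<in> G. x \<in> l \<and> (\<forall>w. g w x = 0)} \<le> card {x \<in> l. g w x = 0}"
        by (rule card_mono[OF *(1)]) auto
      then show False using *(2) crit[OF l(1)] by linarith
    qed
    have gz: "g w x = 0" for w x
    proof (rule ccontr)
      assume nz: "g w x \<noteq> 0"
      then have "d \<noteq> 0" using g0 by blast
      then have "\<not> Q (d - 1)" by (intro notQ) simp
      moreover have "Q (d - 1)" unfolding Q_def using gp[of w] nz van by blast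
      ultimately show False by blast
    qed
    have "(f has_derivative (\<lambda>w. 0)) (at x)" for x using g[of x] by (simp add: gz)
    then have "\<exists>c. \<forall>x\<in>UNIV. f x = c"
      by (intro has_derivative_zero_constant) auto
    then obtain c where c: "\<And>x. f x = c" by blast
    obtain l where l: "l \<in> \<Lambda>" using L(2) by blast
    obtain x where "x \<in> l" using L(3)[OF l] by (auto simp: aline_def)
    then have "c = 0" using f(3)[OF l] c by metis
    then show False using f(2) c by simp
  qed
  then obtain l where l: "l \<in> \<Lambda>" and crit: "card {x \<in> G. x \<in> l \<and> (\<forall>w. g w x = 0)} \<le> d" by blast
  define R where "R = {x \<in> G. x \<in> l \<and> (\<exists>w. g w x \<noteq> 0)}"
  have finR: "finite R" using G by (simp add: R_def)
  have "{x \<in> G. x \<in> l} = R \<union> {x \<in> G. x \<in> l \<and> (\<forall>w. g w x = 0)}" by (auto simp: R_def)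
  then have "card {x \<in> G. x \<in> l} \<le> card R + card {x \<in> G. x \<in> l \<and> (\<forall>w. g w x = 0)}"
    by (simp add: card_Un_le)
  then have cR: "card {x \<in> G. x \<in> l} \<le> card R + D" using crit dD by linarith
  have R2: "2 * D < card R" using cR many[OF l] by linarith
  then have "R \<noteq> {}" by auto
  then obtain x0 where x0: "x0 \<in> R" by blast
  obtain u where u: "u \<noteq> 0" "l = range (\<lambda>t. x0 + t *\<^sub>R u)"
    using aline_at[of l x0] L(3)[OF l] x0 by (auto simp: R_def)
  obtain z where z: "g z x0 \<noteq> 0" using x0 by (auto simp: R_def)
  have ling: "linear (\<lambda>w. g w x)" for x using g has_derivative_linear by blast
  have linh: "linear (\<lambda>u. h u w x)" for w x using h has_derivative_linear by blast
  have linh2: "linear (\<lambda>w. h u w x)" for u x using linh[of u x] unfolding sym[of _ u] .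
  have flat: "h u w x = 0" if x: "x \<in> R" and w: "g w x = 0" for x w
  proof -
    obtain y where y: "g y x \<noteq> 0" using x by (auto simp: R_def)
    have "x \<in> l" using x by (simp add: R_def)
    then obtain s where s: "x = x0 + s *\<^sub>R u" using u(2) by blast
    have lx: "l = range (\<lambda>t. x + t *\<^sub>R u)"
    proof -
      have "x0 + t *\<^sub>R u = x + (t - s) *\<^sub>R u" "x + t *\<^sub>R u = x0 + (s + t) *\<^sub>R u" for t
        by (simp_all add: s algebra_simps)
      then show ?thesis unfolding u(2) by blast
    qed
    show ?thesis
      by (rule three_lines_flat[OF dim g h sym _ three y l lx u(1) w])
        (use L(3) f(3) x in \<open>auto simp: R_def\<close>)
  qed
  \<comment> \<open>A direction tangent at \<open>x0\<close> is tangent along all of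
    \<open>l\<close>. Restricted to \<open>l\<close>, the derivative in direction \<open>w\<close>
    is compared with the one in the transversal direction \<open>z\<close>.\<close>
  have const: "g w x = 0" if w: "g w x0 = 0" and x: "x \<in> l" for w x
  proof -
    obtain a where a: "degree a \<le> d - 1" "\<And>t. g w (x0 + t *\<^sub>R u) = poly a t" using poly_fun_line[OF gp] by blast
    obtain b where b: "degree b \<le> d - 1" "\<And>t. g z (x0 + t *\<^sub>R u) = poly b t" using poly_fun_line[OF gp] by blast
    have da: "poly (pderiv a) t = h u w (x0 + t *\<^sub>R u)" for t
      using DERIV_unique[OF poly_DERIV[of a t]] DERIV_along_line[of "g w" "\<lambda>u. h u w" x0 u t, OF h]
      unfolding a(2) by blast
    have db: "poly (pderiv b) t = h u z (x0 + t *\<^sub>R u)" for t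
      using DERIV_unique[OF poly_DERIV[of b t]] DERIV_along_line[of "g z" "\<lambda>u. h u z" x0 u t, OF h]
      unfolding b(2) by blast
    \<comment> \<open>At a point of \<open>R\<close> the vector \<open>g z * w - g w * z\<close>
      (derivatives taken there) is tangent, so flatness annihilates its second derivative along
      \<open>u\<close>. This is exactly a zero of \<open>W\<close>, whose degree is less than
      \<open>card R\<close>.\<close>
    define W where "W = pderiv a * b - a * pderiv b"
    have root: "poly W t = 0" if "x0 + t *\<^sub>R u \<in> R" for t
    proof -
      let ?x = "x0 + t *\<^sub>R u"
      define y where "y = g z ?x *\<^sub>R w - g w ?x *\<^sub>R z"
      have "g y ?x = 0"
        unfolding y_def by (simp add: linear_diff[OF ling] linear_scale[OF ling])
      then have "h u y ?x = 0" using flat that by blast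
      then have "g z ?x * h u w ?x - g w ?x * h u z ?x = 0"
        unfolding y_def by (simp add: linear_diff[OF linh2] linear_scale[OF linh2])
      then show ?thesis unfolding W_def by (simp add: da db flip: a(2) b(2)) (simp add: algebra_simps)
    qed
    have "W = 0"
    proof (rule ccontr)
      assume W0: "W \<noteq> 0"
      have dW: "degree W \<le> 2 * D"
        unfolding W_def
      proof (rule degree_diff_le)
        show "degree (pderiv a * b) \<le> 2 * D"
          using degree_mult_le[of "pderiv a" b] degree_pderiv[of a] a(1) b(1) dD by simp
        show "degree (a * pderiv b) \<le> 2 * D"
          using degree_mult_le[of a "pderiv b"] degree_pderiv[of b] a(1) b(1) dD by simp
      qed
      have "R \<subseteq> (\<lambda>t. x0 + t *\<^sub>R u) ` {t. poly W t = 0}"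
      proof
        fix y assume y: "y \<in> R"
        then have "y \<in> l" by (simp add: R_def)
        then obtain t where t: "y = x0 + t *\<^sub>R u" using u(2) by blast
        then have "poly W t = 0" using root y by blast
        then show "y \<in> (\<lambda>t. x0 + t *\<^sub>R u) ` {t. poly W t = 0}" using t by blast
      qed
      then have "card R \<le> card {t. poly W t = 0}"
        using surj_card_le[OF poly_roots_finite[OF W0]] by blast
      also have "\<dots> \<le> 2 * D" using card_poly_roots_bound[OF W0] dW by linarith
      finally show False using R2 by linarith
    qed
    then have "pderiv a * b = a * pderiv b" by (simp add: W_def)
    moreover have "poly a 0 = 0" using a(2)[of 0] w by simp
    moreover have "poly b 0 \<noteq> 0" using b(2)[of 0] z by simp
    ultimately have "a = 0" by (rule Wronskian_zero_imp_zero)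
    then show ?thesis using x u(2) a(2) by auto
  qed
  define v where "v = (\<Sum>b\<in>Basis. g b x0 *\<^sub>R b)"
  have gv: "g w x0 = v \<bullet> w" for w unfolding v_def by (rule linear_functional_inner[OF ling])
  have v0: "v \<noteq> 0" using z gv[of z] by auto
  have gu: "g u x0 = 0"
    using zero_derivative_along_line[of f g x0 u 0, OF g] f(3)[OF l] u(2) by auto
  have "l' \<subseteq> {y. v \<bullet> y = v \<bullet> x0}" if x: "x \<in> R" and l': "l' \<in> \<Lambda>" "x \<in> l'" for x l'
  proof -
    have xl: "x \<in> l" using x by (simp add: R_def)
    obtain y where y: "g y x \<noteq> 0" using x by (auto simp: R_def)
    obtain w where w: "w \<noteq> 0" "l' = range (\<lambda>t. x + t *\<^sub>R w)" using aline_at[OF L(3)[OF l'(1)] l'(2)] .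
    have gw: "g w x = 0"
      using zero_derivative_along_line[of f g x w 0, OF g] f(3)[OF l'(1)] w(2) by auto
    \<comment> \<open>By \<open>const\<close> the kernel of the differential at \<open>x0\<close> is
      contained in the one at \<open>x\<close>, so the two functionals are proportional.\<close>
    have proportional: "g p x = (g p x0 / g z x0) * g z x" for p
    proof -
      have "g (p - (g p x0 / g z x0) *\<^sub>R z) x0 = 0"
        using z by (simp add: linear_diff[OF ling] linear_scale[OF ling])
      then have "g (p - (g p x0 / g z x0) *\<^sub>R z) x = 0" using const xl by blast
      then show ?thesis by (simp add: linear_diff[OF ling] linear_scale[OF ling])
    qed
    have "g z x \<noteq> 0" using proportional[of y] y by auto
    then have gw0: "g w x0 = 0" using proportional[of w] gw z by simp
    obtain s where s: "x = x0 + s *\<^sub>R u" using xl u(2) by blast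
    have "v \<bullet> (x + t *\<^sub>R w) = v \<bullet> x0" for t
      using gu gw0 by (simp add: s gv inner_add_right)
    then show ?thesis unfolding w(2) by auto
  qed
  then show ?thesis
    using l v0 cR by (intro bexI[of _ l] exI[of _ R] exI[of _ v] exI[of _ "v \<bullet> x0"]) (auto simp: R_def)
qed


section \<open>Pruning, and the bound on rich points in space\<close>

lemma incidences_remove_point:
  assumes "finite G" "finite \<Lambda>" "g \<in> G"
  shows "incidences G \<Lambda> = card {l \<in> \<Lambda>. g \<in> l} + incidences (G - {g}) \<Lambda>"
  using assms by (simp add: incidences_sum_points sum.remove)

lemma incidences_remove_line:
  assumes "finite G" "finite \<Lambda>" "l \<in> \<Lambda>"
  shows "incidences G \<Lambda> = card {g \<in> G. g \<in> l} + incidences G (\<Lambda> - {l})"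
  using assms by (simp add: incidences_sum_lines sum.remove)

text \<open>Take the subconfiguration that maximizes incidences minus \<open>\<alpha>\<close> times
  points minus \<open>\<beta>\<close> times lines. Deleting a single point or line cannot increase
  this, which gives the degree bounds, and the maximum is positive, so lines remain.\<close>

lemma incidences_prune:
  fixes G :: "'a set"
  assumes G: "finite G" and L: "finite \<Lambda>" and al: "\<alpha> > 0"
    and big: "real (incidences G \<Lambda>) > \<alpha> * real (card G) + \<beta> * real (card \<Lambda>)"
  obtains G' \<Lambda>' where "G' \<subseteq> G" "\<Lambda>' \<subseteq> \<Lambda>" "\<Lambda>' \<noteq> {}"
    "\<And>g. g \<in> G' \<Longrightarrow> \<alpha> \<le> real (card {l \<in> \<Lambda>'. g \<in> l})"
    "\<And>l. l \<in> \<Lambda>' \<Longrightarrow> \<beta> \<le> real (card {g \<in> G'. g \<in> l})"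
proof -
  define \<Phi> where "\<Phi> = (\<lambda>(H :: 'a set, M). real (incidences H M) - \<alpha> * real (card H) - \<beta> * real (card M))"
  let ?T = "Pow G \<times> Pow \<Lambda>"
  have fT: "finite (\<Phi> ` ?T)" using G L by simp
  have "Max (\<Phi> ` ?T) \<in> \<Phi> ` ?T" by (rule Max_in[OF fT]) auto
  then obtain H M where HM: "H \<subseteq> G" "M \<subseteq> \<Lambda>" "\<Phi> (H, M) = Max (\<Phi> ` ?T)" by auto
  have mx: "\<Phi> (H', M') \<le> \<Phi> (H, M)" if "H' \<subseteq> G" "M' \<subseteq> \<Lambda>" for H' M'
    unfolding HM(3) by (rule Max_ge[OF fT]) (use that in auto)
  have fin: "finite H" "finite M" using HM G L finite_subset by blast+
  have pos: "\<Phi> (H, M) > 0" using mx[of G \<Lambda>] big by (simp add: \<Phi>_def)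
  have ne: "M \<noteq> {}"
  proof
    assume "M = {}"
    then have "\<Phi> (H, M) = - \<alpha> * real (card H)" using fin by (simp add: \<Phi>_def incidences_sum_lines)
    then show False using pos al by (simp add: mult_less_0_iff)
  qed
  have p: "\<alpha> \<le> real (card {l \<in> M. g \<in> l})" if g: "g \<in> H" for g
  proof -
    have "\<Phi> (H - {g}, M) \<le> \<Phi> (H, M)" using HM by (intro mx) auto
    moreover have "real (card H) = 1 + real (card (H - {g}))"
      using card_Suc_Diff1[OF fin(1) g] by linarith
    ultimately show ?thesis using incidences_remove_point[OF fin g] by (simp add: \<Phi>_def algebra_simps)
  qed
  have q: "\<beta> \<le> real (card {g \<in> H. g \<in> l})" if l: "l \<in> M" for l
  proof -
    have "\<Phi> (H, M - {l}) \<le> \<Phi> (H, M)" using HM by (intro mx) auto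
    moreover have "real (card M) = 1 + real (card (M - {l}))"
      using card_Suc_Diff1[OF fin(2) l] by linarith
    ultimately show ?thesis using incidences_remove_line[OF fin l] by (simp add: \<Phi>_def algebra_simps)
  qed
  show thesis by (rule that[OF HM(1,2) ne p q])
qed

text \<open>If there were too many rich points, pruning the incidences on lines inside the
  partitioning surface would lead to a plane containing more than \<open>N\<close> of the
  lines.\<close>

theorem Guth_Katz_rich:
  fixes \<Lambda> :: "'a::euclidean_space set set"
  assumes dim: "DIM('a) = 3" and L: "finite \<Lambda>" "\<And>l. l \<in> \<Lambda> \<Longrightarrow> aline l" "card \<Lambda> \<le> N\<^sup>2"
    and planes: "\<And>v c. v \<noteq> 0 \<Longrightarrow> card {l \<in> \<Lambda>. l \<subseteq> {y. v \<bullet> y = c}} \<le> N"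
    and G: "finite G" and rich: "\<And>g. g \<in> G \<Longrightarrow> s \<le> card {l \<in> \<Lambda>. g \<in> l}"
    and s: "12 \<le> s" "s \<le> N"
  shows "card G * s\<^sup>2 \<le> 110592 * N ^ 3"
proof (rule ccontr)
  assume contra: "\<not> ?thesis"
  define C :: nat where "C = 110592"
  \<comment> \<open>Only just too many points are kept. The resulting upper bound
    \<open>S * s\<^sup>2 \<le> 2 * C * N ^ 3\<close> controls the cell term, which is quadratic in
    \<open>S\<close>.\<close>
  define S where "S = (LEAST S. C * N ^ 3 < S * s\<^sup>2)"
  have ex: "C * N ^ 3 < card G * s\<^sup>2" using contra by (simp add: C_def)
  have S1: "C * N ^ 3 < S * s\<^sup>2" unfolding S_def by (rule LeastI[of "\<lambda>S. C * N ^ 3 < S * s\<^sup>2", OF ex])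
  have SG: "S \<le> card G" unfolding S_def by (rule Least_le[of "\<lambda>S. C * N ^ 3 < S * s\<^sup>2", OF ex])
  have S0: "S > 0" using S1 by (cases S) auto
  have "\<not> C * N ^ 3 < (S - 1) * s\<^sup>2"
    using not_less_Least[of "S - 1" "\<lambda>S. C * N ^ 3 < S * s\<^sup>2"] S0 by (simp add: S_def)
  then have "(S - 1) * s\<^sup>2 \<le> C * N ^ 3" by simp
  moreover have "s\<^sup>2 \<le> C * N ^ 3"
  proof -
    have "s\<^sup>2 \<le> N\<^sup>2" using s(2) by (rule power_mono) simp
    also have "\<dots> \<le> N ^ 3" using s by (intro power_increasing) auto
    also have "\<dots> \<le> C * N ^ 3" by (simp add: C_def)
    finally show ?thesis .
  qed
  moreover have "S * s\<^sup>2 = (S - 1) * s\<^sup>2 + s\<^sup>2" using S0 by (cases S) auto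
  ultimately have S2: "S * s\<^sup>2 \<le> 2 * C * N ^ 3" by linarith
  obtain G1 where G1: "G1 \<subseteq> G" "card G1 = S" using obtain_subset_with_card_n[OF SG] by blast
  have fG1: "finite G1" using G1(1) G finite_subset by blast
  have rs: "real s \<ge> 12" "real s \<le> real N" "real s > 0" using s by auto
  have rN: "real N > 0" using rs by linarith
  have rS1: "110592 * real N ^ 3 < real S * (real s)\<^sup>2"
  proof -
    have "real (C * N ^ 3) < real (S * s\<^sup>2)" using S1 of_nat_less_iff by blast
    then show ?thesis by (simp add: C_def)
  qed
  have rS2: "real S * (real s)\<^sup>2 \<le> 2 * 110592 * real N ^ 3"
  proof -
    have "real (S * s\<^sup>2) \<le> real (2 * C * N ^ 3)" using S2 of_nat_le_iff by blast
    then show ?thesis by (simp add: C_def)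
  qed
  \<comment> \<open>This makes \<open>D = 18 * 2 ^ q\<close> of order \<open>N / s\<close>, with
    \<open>D * s < 18 * 256 * N\<close>. The lower bound handles the cell term, since
    \<open>128 ^ 3 \<ge> 16 * 110592\<close>, the upper bound the line crossings, since
    \<open>8 * 3 * 4608 = 110592\<close>.\<close>
  define q where "q = (LEAST q. 128 * N \<le> 2 ^ q * s)"
  have "128 * N \<le> 2 ^ (N + 7) * s"
  proof -
    have "N \<le> 2 ^ N" using less_exp[of N] by simp
    also have "\<dots> \<le> 2 ^ N * s" using s by simp
    finally show ?thesis by (simp add: power_add)
  qed
  then have q1: "128 * N \<le> 2 ^ q * s" unfolding q_def by (rule LeastI)
  have q0: "q \<noteq> 0"
  proof
    assume "q = 0"
    then show False using q1 s by simp
  qed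
  have "\<not> 128 * N \<le> 2 ^ (q - 1) * s"
    using not_less_Least[of "q - 1" "\<lambda>q. 128 * N \<le> 2 ^ q * s"] q0 by (simp add: q_def)
  moreover have "(2::nat) ^ q = 2 * 2 ^ (q - 1)" using q0 by (cases q) auto
  ultimately have q2: "2 ^ q * s < 256 * N" by (simp add: mult.commute)
  define D where "D = 2 * 3\<^sup>2 * (2::nat) ^ q"
  have Ds: "real D * real s < 4608 * real N"
  proof -
    have "real (2 ^ q * s) < real (256 * N)" using q2 of_nat_less_iff by blast
    then show ?thesis by (simp add: D_def algebra_simps)
  qed
  have "D \<ge> 1" by (simp add: D_def)
  then have D1: "real D \<ge> 1" by simp
  obtain b where b: "bij_betw b {0..<3::nat} (Basis :: 'a set)"
    using ex_bij_betw_nat_finite[of "Basis :: 'a set"] dim by auto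
  have orth: "b i \<bullet> b j = (if i = j then 1 else 0)" if "i < 3" "j < 3" for i j
  proof -
    have "b i \<in> Basis" "b j \<in> Basis" using b that by (auto simp: bij_betw_def)
    moreover have "b i = b j \<longleftrightarrow> i = j" using b that by (auto simp: bij_betw_def inj_on_def)
    ultimately show ?thesis by (simp add: inner_Basis)
  qed
  obtain f and \<kappa> :: "'a \<Rightarrow> nat \<Rightarrow> bool" where f: "poly_fun D f" "\<exists>x. f x \<noteq> 0"
    "\<And>\<sigma>. 2 ^ (3 * q) * card {x \<in> G1. f x \<noteq> 0 \<and> \<kappa> x = \<sigma>} \<le> card G1"
    "few_cells D f \<kappa>"
    using polynomial_partitioning[of 3 b G1 D q, OF orth _ fG1 D_def] by auto
  define LZ where "LZ = {l \<in> \<Lambda>. \<forall>x\<in>l. f x = 0}"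
  have LZ: "finite LZ" "finite (\<Lambda> - LZ)" using L(1) by (simp_all add: LZ_def)
  have A: "real (incidences G1 (\<Lambda> - LZ)) \<le> real (card (\<Lambda> - LZ)) * (2 * real D + 1) + (real (card G1))\<^sup>2 / real (2 ^ (3 * q))"
    by (rule incidences_cells[OF f(1) fG1 LZ(2) _ _ f(3) _ f(4)]) (use L(2) in \<open>auto simp: LZ_def\<close>)
  have B1: "real (card (\<Lambda> - LZ)) * (2 * real D + 1) \<le> real S * real s / 8"
  proof -
    have "card (\<Lambda> - LZ) \<le> N\<^sup>2" using card_mono[OF L(1), of "\<Lambda> - LZ"] L(3) by auto
    then have c: "real (card (\<Lambda> - LZ)) \<le> (real N)\<^sup>2" by (metis of_nat_le_iff of_nat_power)
    have "real (card (\<Lambda> - LZ)) * (2 * real D + 1) * real s \<le> (real N)\<^sup>2 * (3 * real D) * real s"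
      using c D1 by (intro mult_right_mono mult_mono) auto
    also have "\<dots> = 3 * (real N)\<^sup>2 * (real D * real s)" by simp
    also have "\<dots> \<le> 3 * (real N)\<^sup>2 * (4608 * real N)" using Ds by (intro mult_left_mono) auto
    also have "\<dots> = 110592 * real N ^ 3 / 8" by (simp add: power2_eq_square power3_eq_cube)
    also have "\<dots> \<le> real S * (real s)\<^sup>2 / 8" using rS1 by simp
    also have "\<dots> = (real S * real s / 8) * real s" by (simp add: power2_eq_square)
    finally show ?thesis using rs(3) by (rule mult_right_le_imp_le)
  qed
  have B2: "(real (card G1))\<^sup>2 / real (2 ^ (3 * q)) \<le> real S * real s / 8"
  proof -
    have "real (128 * N) \<le> real (2 ^ q * s)" using q1 of_nat_le_iff by blast
    then have "128 * real N \<le> 2 ^ q * real s" by simp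
    then have "(128 * real N) ^ 3 \<le> (2 ^ q * real s) ^ 3" by (intro power_mono) auto
    then have e: "2097152 * real N ^ 3 \<le> 2 ^ (3 * q) * real s ^ 3"
      by (simp add: power_mult_distrib power_mult mult.commute flip: power_mult)
    have "8 * real S * (real S * (real s)\<^sup>2) \<le> 8 * real S * (2 * 110592 * real N ^ 3)"
      using rS2 by (intro mult_left_mono) auto
    also have "\<dots> \<le> real S * (2097152 * real N ^ 3)" by simp
    also have "\<dots> \<le> real S * (2 ^ (3 * q) * real s ^ 3)" using e by (intro mult_left_mono) auto
    finally have "(8 * (real S)\<^sup>2) * (real s)\<^sup>2 \<le> (real S * real s * 2 ^ (3 * q)) * (real s)\<^sup>2"
      by (simp add: power2_eq_square power3_eq_cube algebra_simps)
    then have "8 * (real S)\<^sup>2 \<le> real S * real s * 2 ^ (3 * q)"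
      using rs(3) by (simp add: mult_le_cancel_right)
    then show ?thesis unfolding G1(2) by (simp add: field_simps)
  qed
  have C1: "real (incidences G1 (\<Lambda> - LZ)) \<le> real S * real s / 4" using A B1 B2 by linarith
  have "(\<Sum>g\<in>G1. s) \<le> incidences G1 \<Lambda>"
    unfolding incidences_sum_points[OF fG1 L(1)] by (rule sum_mono) (use rich G1(1) in blast)
  then have "S * s \<le> incidences G1 \<Lambda>" using G1(2) by simp
  moreover have "incidences G1 \<Lambda> = incidences G1 (\<Lambda> - LZ) + incidences G1 LZ"
    by (rule incidences_split) (use fG1 L(1) in \<open>auto simp: LZ_def\<close>)
  ultimately have "S * s \<le> incidences G1 (\<Lambda> - LZ) + incidences G1 LZ" by linarith
  then have "real (S * s) \<le> real (incidences G1 (\<Lambda> - LZ) + incidences G1 LZ)" by (rule of_nat_mono)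
  then have C2: "3 / 4 * (real S * real s) \<le> real (incidences G1 LZ)" using C1 by simp
  \<comment> \<open>As \<open>27648 = 110592 / 4\<close>, keeping \<open>X\<close> points on each
    line costs at most a quarter of \<open>S * s\<close> incidences. As
    \<open>27648 = 6 * 4608\<close>, it is also at least \<open>6 * D\<close>.\<close>
  define X where "X = 27648 * real N / real s"
  have NX: "X * real (card LZ) \<le> real S * real s / 4"
  proof -
    have "card LZ \<le> N\<^sup>2" using card_mono[OF L(1), of LZ] L(3) by (auto simp: LZ_def)
    then have "real (card LZ) \<le> (real N)\<^sup>2" by (metis of_nat_le_iff of_nat_power)
    then have "X * real (card LZ) * real s \<le> X * (real N)\<^sup>2 * real s"
      using rs rN by (intro mult_right_mono mult_left_mono) (auto simp: X_def)
    also have "\<dots> = 110592 * real N ^ 3 / 4" using rs by (simp add: X_def power2_eq_square power3_eq_cube)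
    also have "\<dots> \<le> (real S * real s / 4) * real s" using rS1 by (simp add: power2_eq_square)
    finally show ?thesis using rs(3) by (rule mult_right_le_imp_le)
  qed
  have Ss: "real S * real s > 0" using S0 rs by simp
  have "real s / 4 * real (card G1) + X * real (card LZ) < real (incidences G1 LZ)"
    using C2 NX Ss G1(2) by (simp add: mult.commute)
  then obtain H M where HM: "H \<subseteq> G1" "M \<subseteq> LZ" "M \<noteq> {}"
    "\<And>g. g \<in> H \<Longrightarrow> real s / 4 \<le> real (card {l \<in> M. g \<in> l})"
    "\<And>l. l \<in> M \<Longrightarrow> X \<le> real (card {g \<in> H. g \<in> l})"
    using incidences_prune[OF fG1 LZ(1), of "real s / 4" X] rs(3) by auto
  have fin: "finite H" "finite M" using HM fG1 LZ(1) finite_subset by blast+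
  have alM: "aline l" if "l \<in> M" for l using that HM(2) L(2) by (auto simp: LZ_def)
  have XD: "6 * real D \<le> X" using Ds rs(3) by (simp add: X_def field_simps)
  have "\<exists>l\<in>M. \<exists>R v c. v \<noteq> 0 \<and> R \<subseteq> {x \<in> H. x \<in> l} \<and> card {x \<in> H. x \<in> l} \<le> card R + D \<and>
    (\<forall>x\<in>R. \<forall>l'\<in>M. x \<in> l' \<longrightarrow> l' \<subseteq> {y. v \<bullet> y = c})"
  proof (rule rich_lines_in_plane[OF dim fin(2) HM(3) alM fin(1) f(1,2)])
    show "f x = 0" if "l \<in> M" "x \<in> l" for l x using that HM(2) by (auto simp: LZ_def)
    show "3 \<le> card {l \<in> M. x \<in> l}" if "x \<in> H" for x using HM(4)[OF that] rs(1) by simp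
    show "3 * D < card {x \<in> H. x \<in> l}" if "l \<in> M" for l
    proof -
      have "real (3 * D) < real (card {x \<in> H. x \<in> l})" using HM(5)[OF that] XD D1 by simp
      then show ?thesis using of_nat_less_iff by blast
    qed
  qed
  then obtain l R v c where lR: "l \<in> M" "v \<noteq> 0" "R \<subseteq> {x \<in> H. x \<in> l}" "card {x \<in> H. x \<in> l} \<le> card R + D"
    and "\<forall>x\<in>R. \<forall>l'\<in>M. x \<in> l' \<longrightarrow> l' \<subseteq> {y. v \<bullet> y = c}" by (elim bexE exE conjE)
  then have inplane: "l' \<subseteq> {y. v \<bullet> y = c}" if "x \<in> R" "l' \<in> M" "x \<in> l'" for x l' using that by blast
  have fR: "finite R" by (rule finite_subset[OF lR(3)]) (use fin(1) in simp)
  \<comment> \<open>The other lines through different points of \<open>l\<close> are distinct, there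
    are at least \<open>s / 4 - 1 \<ge> s / 8\<close> of them at each point of \<open>R\<close>, and
    all lie in one plane. Since \<open>card R \<ge> X / 2\<close>, these would be at least
    \<open>1728 * N\<close> lines.\<close>
  define T where "T = (\<lambda>x. {l' \<in> M. x \<in> l'} - {l})"
  have Tc: "real s / 8 \<le> real (card (T x))" if x: "x \<in> R" for x
  proof -
    have xH: "x \<in> H" "x \<in> l" using x lR(3) by auto
    have "card (T x) = card {l' \<in> M. x \<in> l'} - 1"
      unfolding T_def using fin(2) lR(1) xH(2) by (simp add: card_Diff_singleton)
    then have "real (card {l' \<in> M. x \<in> l'}) \<le> real (card (T x)) + 1" by linarith
    then show ?thesis using HM(4)[OF xH(1)] rs(1) by linarith
  qed
  have disj: "T x \<inter> T y = {}" if "x \<in> R" "y \<in> R" "x \<noteq> y" for x y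
  proof (rule ccontr)
    assume "T x \<inter> T y \<noteq> {}"
    then obtain l' where l': "l' \<in> M" "x \<in> l'" "y \<in> l'" "l' \<noteq> l" by (auto simp: T_def)
    have "x \<in> l" "y \<in> l" using that(1,2) lR(3) by auto
    then have "l' = l" by (intro aline_unique[OF alM[OF l'(1)] alM[OF lR(1)] l'(2,3)]) (use that(3) in auto)
    then show False using l'(4) by blast
  qed
  have "(\<Sum>x\<in>R. card (T x)) = card (\<Union>x\<in>R. T x)"
    using fR fin(2) disj by (subst card_UN_disjoint) (auto simp: T_def)
  also have "\<dots> \<le> card {l \<in> \<Lambda>. l \<subseteq> {y. v \<bullet> y = c}}"
  proof (rule card_mono)
    show "finite {l \<in> \<Lambda>. l \<subseteq> {y. v \<bullet> y = c}}" using L(1) by simp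
    show "(\<Union>x\<in>R. T x) \<subseteq> {l \<in> \<Lambda>. l \<subseteq> {y. v \<bullet> y = c}}"
    proof
      fix l' assume "l' \<in> (\<Union>x\<in>R. T x)"
      then obtain x where "x \<in> R" "l' \<in> M" "x \<in> l'" by (auto simp: T_def)
      then show "l' \<in> {l \<in> \<Lambda>. l \<subseteq> {y. v \<bullet> y = c}}" using inplane[of x l'] HM(2) by (auto simp: LZ_def)
    qed
  qed
  also have "\<dots> \<le> N" by (rule planes[OF lR(2)])
  finally have "real (\<Sum>x\<in>R. card (T x)) \<le> real N" by (rule of_nat_mono)
  moreover have "(\<Sum>x\<in>R. real s / 8) \<le> (\<Sum>x\<in>R. real (card (T x)))" by (rule sum_mono) (rule Tc)
  ultimately have up: "real (card R) * (real s / 8) \<le> real N" by simp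
  have "real (card {x \<in> H. x \<in> l}) \<le> real (card R + D)" using lR(4) by (rule of_nat_mono)
  then have "X / 2 \<le> real (card R)" using HM(5)[OF lR(1)] XD D1 by simp
  then have "X / 2 * (real s / 8) \<le> real (card R) * (real s / 8)" using rs by (intro mult_right_mono) auto
  moreover have "X / 2 * (real s / 8) = 1728 * real N" using rs by (simp add: X_def)
  ultimately show False using up rN by linarith
qed

section \<open>Perpendicular bisectors and rotations\<close>

definition rot90 :: "real ^ 2 \<Rightarrow> real ^ 2" where
  "rot90 p = vector [- (p $ 2), p $ 1]"

lemma rot90_nth [simp]: "rot90 p $ 1 = - (p $ 2)" "rot90 p $ 2 = p $ 1"
  by (simp_all add: rot90_def)

lemma vec2_eq_iff: "(x :: real ^ 2) = y \<longleftrightarrow> x $ 1 = y $ 1 \<and> x $ 2 = y $ 2"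
  by (simp add: vec_eq_iff forall_2)

lemma norm_eq_iff_real2:
  "norm (x :: real ^ 2) = norm (y :: real ^ 2) \<longleftrightarrow> (x $ 1)\<^sup>2 + (x $ 2)\<^sup>2 = (y $ 1)\<^sup>2 + (y $ 2)\<^sup>2"
  by (simp add: norm_eq_sqrt_inner inner_real2 power2_eq_square)

lemma perp_bisector_eq: "perp_bisector a b = {x. (b - a) \<bullet> x = (b \<bullet> b - a \<bullet> a) / 2}"
proof -
  have "norm (a - x) = norm (b - x) \<longleftrightarrow> (b - a) \<bullet> x = (b \<bullet> b - a \<bullet> a) / 2" for x
    by (simp add: norm_eq_sqrt_inner inner_diff_left inner_diff_right inner_commute field_simps)
  then show ?thesis unfolding perp_bisector_def by blast
qed

lemma perp_bisector_commute: "perp_bisector a b = perp_bisector b a"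
  by (auto simp: perp_bisector_def)

lemma pline_perp_bisector: "a \<noteq> b \<Longrightarrow> pline (perp_bisector a b)"
  unfolding pline_def perp_bisector_eq by (metis right_minus_eq)

lemma point_not_on_perp_bisector: "a \<noteq> b \<Longrightarrow> a \<notin> perp_bisector a b"
  by (simp add: perp_bisector_def)

text \<open>Equal components along the unit vector \<open>d\<close> and equal norms leave only
  opposite components across \<open>d\<close>. The coefficients are the cosine and sine of twice the
  angle of \<open>d\<close>.\<close>

lemma reflection_formula:
  fixes d1 d2 y1 y2 z1 z2 :: real
  assumes d: "d1\<^sup>2 + d2\<^sup>2 = 1" and s: "y1 * d1 + y2 * d2 = z1 * d1 + z2 * d2"
    and n: "y1\<^sup>2 + y2\<^sup>2 = z1\<^sup>2 + z2\<^sup>2" and ne: "y1 \<noteq> z1 \<or> y2 \<noteq> z2"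
  shows "z1 = (d1\<^sup>2 - d2\<^sup>2) * y1 + 2 * d1 * d2 * y2" "z2 = 2 * d1 * d2 * y1 - (d1\<^sup>2 - d2\<^sup>2) * y2"
proof -
  define m m' \<sigma> where "m = y2 * d1 - y1 * d2" and "m' = z2 * d1 - z1 * d2" and "\<sigma> = y1 * d1 + y2 * d2"
  have y: "y1 = \<sigma> * d1 - m * d2" "y2 = \<sigma> * d2 + m * d1"
  proof -
    have "\<sigma> * d1 - m * d2 = y1 * (d1\<^sup>2 + d2\<^sup>2)" "\<sigma> * d2 + m * d1 = y2 * (d1\<^sup>2 + d2\<^sup>2)"
      by (simp_all add: \<sigma>_def m_def power2_eq_square algebra_simps)
    then show "y1 = \<sigma> * d1 - m * d2" "y2 = \<sigma> * d2 + m * d1" using d by simp_all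
  qed
  have z: "z1 = \<sigma> * d1 - m' * d2" "z2 = \<sigma> * d2 + m' * d1"
  proof -
    have "\<sigma> * d1 - m' * d2 = z1 * (d1\<^sup>2 + d2\<^sup>2)" "\<sigma> * d2 + m' * d1 = z2 * (d1\<^sup>2 + d2\<^sup>2)"
      unfolding \<sigma>_def s by (simp_all add: m'_def power2_eq_square algebra_simps)
    then show "z1 = \<sigma> * d1 - m' * d2" "z2 = \<sigma> * d2 + m' * d1" using d by simp_all
  qed
  have "\<sigma>\<^sup>2 + m\<^sup>2 = (y1\<^sup>2 + y2\<^sup>2) * (d1\<^sup>2 + d2\<^sup>2)"
    by (simp add: \<sigma>_def m_def power2_eq_square algebra_simps)
  moreover have "\<sigma>\<^sup>2 + m'\<^sup>2 = (z1\<^sup>2 + z2\<^sup>2) * (d1\<^sup>2 + d2\<^sup>2)"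
    unfolding \<sigma>_def s by (simp add: m'_def power2_eq_square algebra_simps)
  ultimately have "m\<^sup>2 = m'\<^sup>2" using n d by simp
  then have "m' = m \<or> m' = - m" by (metis power2_eq_iff)
  moreover have "m' \<noteq> m" using y z ne by auto
  ultimately have m': "m' = - m" by blast
  show "z1 = (d1\<^sup>2 - d2\<^sup>2) * y1 + 2 * d1 * d2 * y2"
  proof -
    have "(d1\<^sup>2 - d2\<^sup>2) * y1 + 2 * d1 * d2 * y2 = (\<sigma> * d1 + m * d2) * (d1\<^sup>2 + d2\<^sup>2)"
      unfolding y by (simp add: power2_eq_square algebra_simps)
    then show ?thesis using z m' d by simp
  qed
  show "z2 = 2 * d1 * d2 * y1 - (d1\<^sup>2 - d2\<^sup>2) * y2"
  proof -
    have "2 * d1 * d2 * y1 - (d1\<^sup>2 - d2\<^sup>2) * y2 = (\<sigma> * d2 - m * d1) * (d1\<^sup>2 + d2\<^sup>2)"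
      unfolding y by (simp add: power2_eq_square algebra_simps)
    then show ?thesis using z m' d by simp
  qed
qed

lemma perp_bisector_direction:
  assumes "a \<noteq> b" "x \<in> perp_bisector a b"
  obtains d :: "real ^ 2" where "(d $ 1)\<^sup>2 + (d $ 2)\<^sup>2 = 1" "x + d \<in> perp_bisector a b"
proof -
  define e where "e = rot90 (b - a)"
  have e0: "e \<noteq> 0" using assms(1) by (auto simp: e_def vec2_eq_iff)
  define d where "d = (1 / norm e) *\<^sub>R e"
  have "norm d = 1" using e0 by (simp add: d_def)
  then have "d \<bullet> d = 1" by (simp add: norm_eq_1)
  then have 1: "(d $ 1)\<^sup>2 + (d $ 2)\<^sup>2 = 1" by (simp add: inner_real2 power2_eq_square)
  have "(b - a) \<bullet> e = 0" by (simp add: e_def inner_real2 algebra_simps)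
  then have "(b - a) \<bullet> d = 0" by (simp add: d_def)
  then have "x + d \<in> perp_bisector a b" using assms(2) by (simp add: perp_bisector_eq inner_add_right)
  with 1 show thesis by (rule that)
qed

lemma perp_bisector_reflection:
  assumes d: "(d $ 1)\<^sup>2 + (d $ 2)\<^sup>2 = 1" and xl: "x \<in> perp_bisector a b" "x + d \<in> perp_bisector a b" and ne: "a \<noteq> b"
  shows "(b - x) $ 1 = ((d $ 1)\<^sup>2 - (d $ 2)\<^sup>2) * (a - x) $ 1 + 2 * d $ 1 * d $ 2 * (a - x) $ 2"
    "(b - x) $ 2 = 2 * d $ 1 * d $ 2 * (a - x) $ 1 - ((d $ 1)\<^sup>2 - (d $ 2)\<^sup>2) * (a - x) $ 2"
proof -
  have n1: "((a - x) $ 1)\<^sup>2 + ((a - x) $ 2)\<^sup>2 = ((b - x) $ 1)\<^sup>2 + ((b - x) $ 2)\<^sup>2"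
    using xl(1) by (simp add: perp_bisector_def norm_eq_iff_real2)
  have eq2: "((a - x) $ 1 - d $ 1)\<^sup>2 + ((a - x) $ 2 - d $ 2)\<^sup>2 = ((b - x) $ 1 - d $ 1)\<^sup>2 + ((b - x) $ 2 - d $ 2)\<^sup>2"
    using xl(2) by (simp add: perp_bisector_def norm_eq_iff_real2 diff_diff_eq)
  have s: "(a - x) $ 1 * d $ 1 + (a - x) $ 2 * d $ 2 = (b - x) $ 1 * d $ 1 + (b - x) $ 2 * d $ 2"
  proof -
    have "y1 * d1 + y2 * d2 = z1 * d1 + z2 * d2" if "y1\<^sup>2 + y2\<^sup>2 = z1\<^sup>2 + z2\<^sup>2"
      "(y1 - d1)\<^sup>2 + (y2 - d2)\<^sup>2 = (z1 - d1)\<^sup>2 + (z2 - d2)\<^sup>2" for y1 y2 z1 z2 d1 d2 :: real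
      using that by (simp add: power2_diff)
    then show ?thesis using n1 eq2 by blast
  qed
  have "(a - x) $ 1 \<noteq> (b - x) $ 1 \<or> (a - x) $ 2 \<noteq> (b - x) $ 2" using ne by (auto simp: vec2_eq_iff)
  from reflection_formula[OF d s n1 this]
  show "(b - x) $ 1 = ((d $ 1)\<^sup>2 - (d $ 2)\<^sup>2) * (a - x) $ 1 + 2 * d $ 1 * d $ 2 * (a - x) $ 2"
    "(b - x) $ 2 = 2 * d $ 1 * d $ 2 * (a - x) $ 1 - ((d $ 1)\<^sup>2 - (d $ 2)\<^sup>2) * (a - x) $ 2" .
qed

lemma perp_bisector_nonempty: "\<exists>x. x \<in> perp_bisector a b"
  by (rule exI[of _ "(1/2) *\<^sub>R (a + b)"])
    (simp add: perp_bisector_eq inner_add_right inner_diff_left inner_commute[of b a] field_simps)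

lemma perp_bisector_inj:
  assumes "a \<noteq> p" "a \<noteq> p'" "perp_bisector a p = perp_bisector a p'"
  shows "p = p'"
proof -
  obtain x where x: "x \<in> perp_bisector a p" using perp_bisector_nonempty by blast
  obtain d where d: "(d $ 1)\<^sup>2 + (d $ 2)\<^sup>2 = 1" "x + d \<in> perp_bisector a p"
    by (rule perp_bisector_direction[OF assms(1) x])
  have "(p - x) $ 1 = (p' - x) $ 1" "(p - x) $ 2 = (p' - x) $ 2"
    using perp_bisector_reflection[OF d(1) x d(2) assms(1)]
      perp_bisector_reflection[OF d(1), of x a p'] x d(2) assms by simp_all
  then show ?thesis by (simp add: vec2_eq_iff)
qed

text \<open>The pair \<open>(x, \<tau>)\<close> stands for the rotation about \<open>x\<close> by the angle \<open>\<theta>\<close> with \<open>cot (\<theta> / 2) = \<tau>\<close>;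
  in these coordinates the rotations that map \<open>p\<close> to \<open>p'\<close> form a line.\<close>

definition rotline :: "real ^ 2 \<Rightarrow> real ^ 2 \<Rightarrow> ((real ^ 2) \<times> real) set" where
  "rotline p p' = {((1/2) *\<^sub>R (p + p') + (\<tau>/2) *\<^sub>R rot90 (p' - p), \<tau>) | \<tau>. True}"

text \<open>The sum of the vectors from \<open>x\<close> to \<open>p\<close> and \<open>p'\<close>
  is \<open>\<tau>\<close> times their difference turned clockwise by a right angle. This half-angle
  form of a rotation is affine in \<open>(x, \<tau>)\<close>, which is why a line arises.\<close>

lemma mem_rotline_iff:
  "(x, \<tau>) \<in> rotline p p' \<longleftrightarrow>
     (p - x) $ 1 + (p' - x) $ 1 = \<tau> * ((p' - x) $ 2 - (p - x) $ 2) \<and>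
     (p - x) $ 2 + (p' - x) $ 2 = - \<tau> * ((p' - x) $ 1 - (p - x) $ 1)"
  unfolding rotline_def by (auto simp: vec2_eq_iff field_simps)

lemma rotline_range:
  "rotline p p' = range (\<lambda>t. ((1/2) *\<^sub>R (p + p'), 0) + t *\<^sub>R ((1/2) *\<^sub>R rot90 (p' - p), 1))"
  unfolding rotline_def by auto

lemma aline_rotline: "aline (rotline p p')"
  unfolding aline_def rotline_range
  by (intro exI[of _ "((1/2) *\<^sub>R (p + p'), 0)"] exI[of _ "((1/2) *\<^sub>R rot90 (p' - p), 1)"]) (auto simp: prod_eq_iff)

text \<open>A rotation sends \<open>p\<close> to one point only; algebraically, the difference of
  two images solves a linear system with determinant \<open>1 + \<tau>\<^sup>2\<close>.\<close>

lemma rotline_unique: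
  assumes "G \<in> rotline p p'" "G \<in> rotline p p''"
  shows "p' = p''"
proof -
  obtain x \<tau> where G: "G = (x, \<tau>)" by (cases G)
  define e where "e = p' - p''"
  have e: "e $ 1 = \<tau> * e $ 2" "e $ 2 = - \<tau> * e $ 1"
    using assms unfolding G mem_rotline_iff e_def by (auto simp: algebra_simps)
  then have "e $ 1 * (1 + \<tau>\<^sup>2) = 0" by (simp add: algebra_simps power2_eq_square)
  moreover have "1 + \<tau>\<^sup>2 > 0" by (simp add: add_pos_nonneg)
  ultimately have "e $ 1 = 0" by auto
  moreover from this have "e $ 2 = 0" using e(2) by simp
  ultimately have "e = 0" by (simp add: vec2_eq_iff)
  then show ?thesis by (simp add: e_def)
qed

lemma rotline_inj:
  assumes "rotline p p' = rotline q q'"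
  shows "p = q \<and> p' = q'"
proof -
  have "((1/2) *\<^sub>R (p + p') + (0/2) *\<^sub>R rot90 (p' - p), 0) \<in> rotline p p'"
    unfolding rotline_def by blast
  then have "((1/2) *\<^sub>R (p + p') + (0/2) *\<^sub>R rot90 (p' - p), 0) \<in> rotline q q'"
    using assms by simp
  then have 0: "p + p' = q + q'" unfolding rotline_def by auto
  have "((1/2) *\<^sub>R (p + p') + (1/2) *\<^sub>R rot90 (p' - p), 1) \<in> rotline p p'"
    unfolding rotline_def by blast
  then have "((1/2) *\<^sub>R (p + p') + (1/2) *\<^sub>R rot90 (p' - p), 1) \<in> rotline q q'"
    using assms by simp
  then have 1: "rot90 (p' - p) = rot90 (q' - q)" unfolding rotline_def using 0 by auto
  then have "p' - p = q' - q" by (simp add: vec2_eq_iff)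
  with 0 show ?thesis by (auto simp: vec2_eq_iff)
qed

text \<open>This caps the number of lines in a plane at one per point \<open>p\<close>. With
  \<open>v = (w, k)\<close>, the vector \<open>w\<close> is orthogonal to \<open>p' - p''\<close>
  and to its quarter turn, so one of the two is zero, and \<open>w = 0\<close> would force
  \<open>k = 0\<close>.\<close>

lemma rotline_in_plane_unique:
  assumes v: "v \<noteq> 0" and p: "rotline p p' \<subseteq> {y. v \<bullet> y = c}" "rotline p p'' \<subseteq> {y. v \<bullet> y = c}"
  shows "p' = p''"
proof -
  obtain w k where wk: "v = (w, k)" by (cases v)
  have pl: "w \<bullet> (p + q) = 2 * c \<and> w \<bullet> rot90 (q - p) = - 2 * k" if "rotline p q \<subseteq> {y. v \<bullet> y = c}" for q
  proof -
    have eq: "w \<bullet> ((1/2) *\<^sub>R (p + q) + (\<tau>/2) *\<^sub>R rot90 (q - p)) + k * \<tau> = c" for \<tau>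
      using that unfolding rotline_def wk by auto
    have "w \<bullet> (p + q) = 2 * c" using eq[of 0] by simp
    moreover have "w \<bullet> rot90 (q - p) = - 2 * k" using eq[of 1] eq[of 0] by (simp add: inner_add_right)
    ultimately show ?thesis by blast
  qed
  define e where "e = p' - p''"
  have we: "w $ 1 * e $ 1 + w $ 2 * e $ 2 = 0" "- (w $ 1 * e $ 2) + w $ 2 * e $ 1 = 0"
    using pl[OF p(1)] pl[OF p(2)] by (auto simp: e_def inner_real2 algebra_simps)
  have "(w $ 1) * ((e $ 1)\<^sup>2 + (e $ 2)\<^sup>2) = e $ 1 * (w $ 1 * e $ 1 + w $ 2 * e $ 2) - e $ 2 * (- (w $ 1 * e $ 2) + w $ 2 * e $ 1)"
    "(w $ 2) * ((e $ 1)\<^sup>2 + (e $ 2)\<^sup>2) = e $ 2 * (w $ 1 * e $ 1 + w $ 2 * e $ 2) + e $ 1 * (- (w $ 1 * e $ 2) + w $ 2 * e $ 1)"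
    by (simp_all add: algebra_simps power2_eq_square)
  then have *: "w $ 1 = 0 \<and> w $ 2 = 0 \<or> (e $ 1)\<^sup>2 + (e $ 2)\<^sup>2 = 0" unfolding we by auto
  show ?thesis
  proof (cases "w = 0")
    case True
    then have "k = 0" using pl[OF p(1)] by simp
    then show ?thesis using v wk True by (simp add: zero_prod_def)
  next
    case False
    then have "(e $ 1)\<^sup>2 + (e $ 2)\<^sup>2 = 0" using * by (auto simp: vec2_eq_iff)
    then have "e = 0" by (simp add: vec2_eq_iff sum_power2_eq_zero_iff)
    then show ?thesis by (simp add: e_def)
  qed
qed

text \<open>The composition of the reflections in two lines through \<open>x\<close> is a rotation about \<open>x\<close>;
  \<open>\<tau>\<close> is the cotangent of half its angle.\<close>

lemma reflections_compose_rotation: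
  assumes x: "x \<in> l" "x \<in> l'" and ll: "l \<noteq> l'"
  shows "\<exists>\<tau>. \<forall>a p p'. a \<noteq> p \<longrightarrow> a \<noteq> p' \<longrightarrow> perp_bisector a p = l \<longrightarrow> perp_bisector a p' = l' \<longrightarrow> (x, \<tau>) \<in> rotline p p'"
proof (cases "\<exists>a p p'. a \<noteq> p \<and> a \<noteq> p' \<and> perp_bisector a p = l \<and> perp_bisector a p' = l'")
  case True
  then obtain a0 p0 p0' where 0: "a0 \<noteq> p0" "a0 \<noteq> p0'" "perp_bisector a0 p0 = l" "perp_bisector a0 p0' = l'" by blast
  obtain d where d: "(d $ 1)\<^sup>2 + (d $ 2)\<^sup>2 = 1" "x + d \<in> l"
    using perp_bisector_direction[OF 0(1), of x] x(1) 0(3) by metis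
  obtain e where e: "(e $ 1)\<^sup>2 + (e $ 2)\<^sup>2 = 1" "x + e \<in> l'"
    using perp_bisector_direction[OF 0(2), of x] x(2) 0(4) by metis
  define \<alpha> \<beta> \<alpha>' \<beta>' where "\<alpha> = (d $ 1)\<^sup>2 - (d $ 2)\<^sup>2" and "\<beta> = 2 * d $ 1 * d $ 2"
    and "\<alpha>' = (e $ 1)\<^sup>2 - (e $ 2)\<^sup>2" and "\<beta>' = 2 * e $ 1 * e $ 2"
  have R: "(p - x) $ 1 = \<alpha> * (a - x) $ 1 + \<beta> * (a - x) $ 2" "(p - x) $ 2 = \<beta> * (a - x) $ 1 - \<alpha> * (a - x) $ 2"
    if "a \<noteq> p" "perp_bisector a p = l" for a p
    using perp_bisector_reflection[OF d(1), of x a p] that x d(2) by (simp_all add: \<alpha>_def \<beta>_def)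
  have R': "(p - x) $ 1 = \<alpha>' * (a - x) $ 1 + \<beta>' * (a - x) $ 2" "(p - x) $ 2 = \<beta>' * (a - x) $ 1 - \<alpha>' * (a - x) $ 2"
    if "a \<noteq> p" "perp_bisector a p = l'" for a p
    using perp_bisector_reflection[OF e(1), of x a p] that x e(2) by (simp_all add: \<alpha>'_def \<beta>'_def)
  have "\<alpha>\<^sup>2 + \<beta>\<^sup>2 = ((d $ 1)\<^sup>2 + (d $ 2)\<^sup>2)\<^sup>2" "\<alpha>'\<^sup>2 + \<beta>'\<^sup>2 = ((e $ 1)\<^sup>2 + (e $ 2)\<^sup>2)\<^sup>2"
    by (simp_all add: \<alpha>_def \<beta>_def \<alpha>'_def \<beta>'_def power2_eq_square algebra_simps)
  then have sq: "\<alpha>\<^sup>2 + \<beta>\<^sup>2 = \<alpha>'\<^sup>2 + \<beta>'\<^sup>2" using d e by simp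
  have ne: "\<alpha> \<noteq> \<alpha>' \<or> \<beta> \<noteq> \<beta>'"
  proof (rule ccontr)
    assume "\<not> ?thesis"
    then have "(p0 - x) $ 1 = (p0' - x) $ 1" "(p0 - x) $ 2 = (p0' - x) $ 2"
      using R[OF 0(1,3)] R'[OF 0(2,4)] by simp_all
    then have "p0 = p0'" by (simp add: vec2_eq_iff)
    then show False using 0 ll by simp
  qed
  \<comment> \<open>The vectors \<open>(\<alpha>, \<beta>)\<close> and
    \<open>(\<alpha>', \<beta>')\<close> have equal norm, so their sum is orthogonal to their
    nonzero difference and is a multiple of its quarter turn.\<close>
  have "\<exists>\<tau>. \<alpha> + \<alpha>' = \<tau> * (\<beta>' - \<beta>) \<and> \<beta> + \<beta>' = - \<tau> * (\<alpha>' - \<alpha>)"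
  proof (cases "\<beta>' = \<beta>")
    case True
    then have "\<alpha>' \<noteq> \<alpha>" "\<alpha>\<^sup>2 = \<alpha>'\<^sup>2" using ne sq by auto
    then have "\<alpha>' = - \<alpha>" by (metis power2_eq_iff)
    then show ?thesis using True \<open>\<alpha>' \<noteq> \<alpha>\<close> by (intro exI[of _ "- (\<beta> + \<beta>') / (\<alpha>' - \<alpha>)"]) auto
  next
    case False
    have "(\<beta> + \<beta>') * (\<beta>' - \<beta>) = - (\<alpha> + \<alpha>') * (\<alpha>' - \<alpha>)"
      using sq by (simp add: power2_eq_square algebra_simps)
    then have "\<beta> + \<beta>' = - ((\<alpha> + \<alpha>') / (\<beta>' - \<beta>)) * (\<alpha>' - \<alpha>)" using False by (simp add: field_simps)
    then show ?thesis using False by (intro exI[of _ "(\<alpha> + \<alpha>') / (\<beta>' - \<beta>)"]) simp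
  qed
  then obtain \<tau> where \<tau>: "\<alpha> + \<alpha>' = \<tau> * (\<beta>' - \<beta>)" "\<beta> + \<beta>' = - \<tau> * (\<alpha>' - \<alpha>)" by blast
  have "(x, \<tau>) \<in> rotline p p'" if h: "a \<noteq> p" "a \<noteq> p'" "perp_bisector a p = l" "perp_bisector a p' = l'" for a p p'
  proof -
    define y1 y2 where "y1 = (a - x) $ 1" and "y2 = (a - x) $ 2"
    have P: "(p - x) $ 1 = \<alpha> * y1 + \<beta> * y2" "(p - x) $ 2 = \<beta> * y1 - \<alpha> * y2"
      using R[OF h(1,3)] by (simp_all add: y1_def y2_def)
    have P': "(p' - x) $ 1 = \<alpha>' * y1 + \<beta>' * y2" "(p' - x) $ 2 = \<beta>' * y1 - \<alpha>' * y2"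
      using R'[OF h(2,4)] by (simp_all add: y1_def y2_def)
    have "(p - x) $ 1 + (p' - x) $ 1 = (\<alpha> + \<alpha>') * y1 + (\<beta> + \<beta>') * y2"
      unfolding P P' by (simp add: algebra_simps)
    also have "\<dots> = \<tau> * ((p' - x) $ 2 - (p - x) $ 2)" unfolding \<tau> P P' by (simp add: algebra_simps)
    finally have 1: "(p - x) $ 1 + (p' - x) $ 1 = \<tau> * ((p' - x) $ 2 - (p - x) $ 2)" .
    have "(p - x) $ 2 + (p' - x) $ 2 = (\<beta> + \<beta>') * y1 - (\<alpha> + \<alpha>') * y2"
      unfolding P P' by (simp add: algebra_simps)
    also have "\<dots> = - \<tau> * ((p' - x) $ 1 - (p - x) $ 1)" unfolding \<tau> P P' by (simp add: algebra_simps)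
    finally have 2: "(p - x) $ 2 + (p' - x) $ 2 = - \<tau> * ((p' - x) $ 1 - (p - x) $ 1)" .
    show ?thesis unfolding mem_rotline_iff using 1 2 by blast
  qed
  then show ?thesis by blast
qed blast

text \<open>If the normals \<open>p - a\<close> and \<open>p' - a\<close> were independent, Cramer's
  rule would give a common point of the two bisectors.\<close>

lemma disjoint_perp_bisectors_parallel:
  assumes "a \<noteq> p" "a \<noteq> p'" "perp_bisector a p \<inter> perp_bisector a p' = {}"
  shows "\<exists>t. p' = a + t *\<^sub>R (p - a)"
proof (rule ccontr)
  assume contra: "\<not> ?thesis"
  define n m where "n = p - a" and "m = p' - a"
  define det where "det = n $ 1 * m $ 2 - n $ 2 * m $ 1"
  have "det \<noteq> 0"
  proof
    assume det: "det = 0"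
    have "n $ 1 \<noteq> 0 \<or> n $ 2 \<noteq> 0" using assms(1) by (auto simp: n_def vec2_eq_iff)
    then have "\<exists>t. m = t *\<^sub>R n"
    proof
      assume "n $ 1 \<noteq> 0"
      then show ?thesis using det by (intro exI[of _ "m $ 1 / n $ 1"]) (simp add: det_def vec2_eq_iff field_simps)
    next
      assume "n $ 2 \<noteq> 0"
      then show ?thesis using det by (intro exI[of _ "m $ 2 / n $ 2"]) (simp add: det_def vec2_eq_iff field_simps)
    qed
    then show False using contra by (auto simp: n_def m_def algebra_simps)
  qed
  define c c' where "c = (p \<bullet> p - a \<bullet> a) / 2" and "c' = (p' \<bullet> p' - a \<bullet> a) / 2"
  define x :: "real ^ 2" where "x = vector [(c * m $ 2 - c' * n $ 2) / det, (c' * n $ 1 - c * m $ 1) / det]"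
  have x12: "x $ 1 = (c * m $ 2 - c' * n $ 2) / det" "x $ 2 = (c' * n $ 1 - c * m $ 1) / det"
    by (simp_all add: x_def)
  have "n \<bullet> x * det = c * det"
    using \<open>det \<noteq> 0\<close> unfolding inner_real2 x12 by (simp add: distrib_right) (simp add: det_def algebra_simps)
  moreover have "m \<bullet> x * det = c' * det"
    using \<open>det \<noteq> 0\<close> unfolding inner_real2 x12 by (simp add: distrib_right) (simp add: det_def algebra_simps)
  ultimately have "x \<in> perp_bisector a p \<inter> perp_bisector a p'"
    using \<open>det \<noteq> 0\<close> by (simp add: perp_bisector_eq n_def m_def c_def c'_def)
  then show False using assms(3) by blast
qed

lemma is_line_through:
  fixes a u :: "real ^ 2"
  assumes "u \<noteq> 0"
  shows "is_line (range (\<lambda>t. a + t *\<^sub>R u))"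
proof -
  have eq: "range (\<lambda>t. a + t *\<^sub>R u) = affine hull {a, a + u}"
  proof -
    have "affine hull {a, a + u} = {x *\<^sub>R a + y *\<^sub>R (a + u) | x y. x + y = 1}" by (rule affine_hull_2)
    also have "\<dots> = range (\<lambda>t. a + t *\<^sub>R u)"
    proof (intro equalityI subsetI)
      fix z assume "z \<in> {x *\<^sub>R a + y *\<^sub>R (a + u) | x y. x + y = 1}"
      then obtain x y where xy: "x + y = 1" and z: "z = x *\<^sub>R a + y *\<^sub>R (a + u)" by blast
      have "z = (x + y) *\<^sub>R a + y *\<^sub>R u" unfolding z by (simp add: algebra_simps)
      then have "z = a + y *\<^sub>R u" by (simp only: xy scaleR_one)
      then show "z \<in> range (\<lambda>t. a + t *\<^sub>R u)" by blast
    next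
      fix z assume "z \<in> range (\<lambda>t. a + t *\<^sub>R u)"
      then obtain t where "z = a + t *\<^sub>R u" by blast
      then have "z = (1 - t) *\<^sub>R a + t *\<^sub>R (a + u) \<and> (1 - t) + t = 1" by (simp add: algebra_simps)
      then show "z \<in> {x *\<^sub>R a + y *\<^sub>R (a + u) | x y. x + y = 1}" by blast
    qed
    finally show ?thesis by simp
  qed
  have "aff_dim {a, a + u} = 1" using assms by (simp add: aff_dim_2)
  then show ?thesis unfolding is_line_def eq by simp
qed

section \<open>Counting bisectors\<close>

text \<open>The reflection of \<open>a\<close> in \<open>l\<close>. It is specified only if
  \<open>l\<close> is a bisector of \<open>a\<close> and another point, and is then unique by
  \<open>perp_bisector_inj\<close>.\<close>

definition mirror :: "(real ^ 2) set \<Rightarrow> real ^ 2 \<Rightarrow> real ^ 2" where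
  "mirror l a = (SOME p. p \<noteq> a \<and> perp_bisector a p = l)"

lemma mirror_eq:
  assumes "p \<noteq> a" "perp_bisector a p = l"
  shows "mirror l a = p"
proof -
  have "mirror l a \<noteq> a \<and> perp_bisector a (mirror l a) = l"
    unfolding mirror_def by (rule someI[of _ p]) (use assms in auto)
  then show ?thesis using perp_bisector_inj[of a "mirror l a" p] assms by auto
qed

definition crossing :: "(real ^ 2) set \<Rightarrow> (real ^ 2) set \<Rightarrow> real ^ 2" where
  "crossing l l' = (SOME x. x \<in> l \<inter> l')"

text \<open>The reflection in \<open>l\<close> followed backwards and then the one in
  \<open>l'\<close>. A single \<open>\<tau>\<close> serves all \<open>a\<close> at once, so that
  different points \<open>a\<close> and \<open>c\<close> yield incidences with the same
  rotation.\<close>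

definition rotation :: "(real ^ 2) set \<Rightarrow> (real ^ 2) set \<Rightarrow> (real ^ 2) \<times> real" where
  "rotation l l' = (crossing l l', SOME \<tau>. \<forall>a p p'. a \<noteq> p \<longrightarrow> a \<noteq> p' \<longrightarrow> perp_bisector a p = l \<longrightarrow>
     perp_bisector a p' = l' \<longrightarrow> (crossing l l', \<tau>) \<in> rotline p p')"

lemma crossing_mem: "l \<inter> l' \<noteq> {} \<Longrightarrow> crossing l l' \<in> l \<and> crossing l l' \<in> l'"
  unfolding crossing_def using someI_ex[of "\<lambda>x. x \<in> l \<inter> l'"] by blast

lemma rotation_mem_rotline:
  assumes "l \<noteq> l'" "l \<inter> l' \<noteq> {}" "a \<noteq> p" "a \<noteq> p'" "perp_bisector a p = l" "perp_bisector a p' = l'"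
  shows "rotation l l' \<in> rotline p p'"
  using someI_ex[OF reflections_compose_rotation[of "crossing l l'" l l']] crossing_mem[OF assms(2)] assms
  unfolding rotation_def by blast

lemma sum_inverse_le_ln:
  assumes "1 \<le> K"
  shows "(\<Sum>k=Suc K..n. 1 / real k) \<le> ln (real (max n 1))"
proof (cases "K \<le> n")
  case True
  have "(\<Sum>k=Suc K..n. 1 / real k) \<le> ln (real n) - ln (real K)"
    using True
  proof (induction n rule: dec_induct)
    case (step m)
    have m: "real m > 0" using step assms by simp
    have "ln (real m / real (Suc m)) \<le> real m / real (Suc m) - 1" using m by (intro ln_le_minus_one) simp
    also have "\<dots> = - (1 / real (Suc m))" by (simp add: field_simps)
    finally have "1 / real (Suc m) \<le> ln (real (Suc m)) - ln (real m)" using m by (simp add: ln_div)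
    then show ?case using step by simp
  qed simp
  moreover have "ln (real K) \<ge> 0" using assms by simp
  moreover have "max n 1 = n" using True assms by simp
  ultimately show ?thesis by simp
qed simp

lemma card_Sigma_le:
  fixes b :: "'a \<Rightarrow> nat"
  assumes "finite A" "\<And>a. a \<in> A \<Longrightarrow> finite (B a)" "\<And>a. a \<in> A \<Longrightarrow> card (B a) \<le> b a"
  shows "card (Sigma A B) \<le> (\<Sum>a\<in>A. b a)"
proof -
  have "card (Sigma A B) = (\<Sum>a\<in>A. card (B a))" using assms by simp
  also have "\<dots> \<le> (\<Sum>a\<in>A. b a)" by (rule sum_mono) (rule assms(3))
  finally show ?thesis .
qed

section \<open>Pencils of common bisectors, and rotations that map many points of the set into
  it\<close>

locale point_set =
  fixes A :: "(real ^ 2) set" and M :: nat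
  assumes finA: "finite A"
    and lineM: "\<And>L. is_line L \<Longrightarrow> card (A \<inter> L) \<le> M"
    and circleM: "\<And>S. is_circle S \<Longrightarrow> card (A \<inter> S) \<le> M"
begin

definition bis :: "real ^ 2 \<Rightarrow> (real ^ 2) set set" where
  "bis a = perp_bisector a ` (A - {a})"

definition cbis :: "(real ^ 2) \<times> (real ^ 2) \<Rightarrow> (real ^ 2) set set" where
  "cbis v = bis (fst v) \<inter> bis (snd v)"

definition pencil :: "(real ^ 2) \<times> (real ^ 2) \<Rightarrow> real ^ 2 \<Rightarrow> (real ^ 2) set set" where
  "pencil v x = {l \<in> cbis v. x \<in> l}"

text \<open>A finite stock of candidate centers, common to all pairs \<open>v\<close>; pairs of
  disjoint lines merely add an arbitrary point.\<close>

definition crossings :: "(real ^ 2) set" where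
  "crossings = (\<lambda>(l, l'). crossing l l') ` ((\<Union>a\<in>A. bis a) \<times> (\<Union>a\<in>A. bis a))"

definition rich :: "(real ^ 2) \<times> real \<Rightarrow> nat" where
  "rich G = card {(p, p'). p \<in> A \<and> p' \<in> A \<and> G \<in> rotline p p'}"

lemma finite_bis: "finite (bis a)"
  using finA by (simp add: bis_def)

lemma card_bis_le: "card (bis a) \<le> card A"
proof -
  have "card (bis a) \<le> card (A - {a})" unfolding bis_def using finA by (intro card_image_le) simp
  also have "\<dots> \<le> card A" using finA by (intro card_mono) auto
  finally show ?thesis .
qed

lemma finite_cbis: "finite (cbis v)"
  using finite_bis by (simp add: cbis_def)

lemma finite_pencil: "finite (pencil v x)"
  using finite_cbis by (simp add: pencil_def)

lemma mirror_bis: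
  assumes "l \<in> bis a"
  shows "mirror l a \<in> A" "mirror l a \<noteq> a" "perp_bisector a (mirror l a) = l"
proof -
  obtain p where p: "p \<in> A" "p \<noteq> a" "l = perp_bisector a p" using assms by (auto simp: bis_def)
  then have "mirror l a = p" by (intro mirror_eq) auto
  then show "mirror l a \<in> A" "mirror l a \<noteq> a" "perp_bisector a (mirror l a) = l" using p by auto
qed

lemma mirror_back:
  assumes "l \<in> bis a" "a \<in> A"
  shows "l \<in> bis (mirror l a)" "mirror l (mirror l a) = a"
proof -
  have l: "l = perp_bisector (mirror l a) a" using mirror_bis(3)[OF assms(1)] perp_bisector_commute by metis
  have ne: "a \<noteq> mirror l a" using mirror_bis(2)[OF assms(1)] by simp
  show "mirror l (mirror l a) = a" by (rule mirror_eq[OF ne l[symmetric]])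
  show "l \<in> bis (mirror l a)" unfolding bis_def using l ne assms(2) by blast
qed

lemma pline_bis: "l \<in> bis a \<Longrightarrow> pline l"
  using mirror_bis[of l a] pline_perp_bisector by metis

lemma inj_on_mirror: "L \<subseteq> bis a \<Longrightarrow> inj_on (\<lambda>l. mirror l a) L"
  by (rule inj_onI) (metis mirror_bis(3) subsetD)

lemma card_pencil_le: "card (pencil v x) \<le> M"
proof (cases "pencil v x = {}")
  case False
  let ?a = "fst v"
  have sub: "pencil v x \<subseteq> bis ?a" by (auto simp: pencil_def cbis_def)
  obtain l where l: "l \<in> bis ?a" "x \<in> l" using False by (auto simp: pencil_def cbis_def)
  \<comment> \<open>Circles have positive radius, so \<open>a\<close> must differ from the center
    \<open>x\<close>; indeed \<open>a\<close> is never on its own bisector.\<close>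
  have "?a \<noteq> x"
    using point_not_on_perp_bisector[of ?a "mirror l ?a"] mirror_bis[OF l(1)] l(2) by metis
  then have circ: "is_circle (sphere x (norm (?a - x)))" unfolding is_circle_def by (intro exI[of _ x] exI[of _ "norm (?a - x)"]) auto
  have "(\<lambda>l. mirror l ?a) ` pencil v x \<subseteq> A \<inter> sphere x (norm (?a - x))"
  proof clarify
    fix l assume l: "l \<in> pencil v x"
    then have lb: "l \<in> bis ?a" "x \<in> l" using sub by (auto simp: pencil_def)
    have "x \<in> perp_bisector ?a (mirror l ?a)" using mirror_bis(3)[OF lb(1)] lb(2) by simp
    then have "norm (?a - x) = norm (mirror l ?a - x)" by (simp add: perp_bisector_def)
    then show "mirror l ?a \<in> A \<inter> sphere x (norm (?a - x))"
      using mirror_bis(1)[OF lb(1)] by (simp add: dist_norm norm_minus_commute)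
  qed
  then have "card (pencil v x) \<le> card (A \<inter> sphere x (norm (?a - x)))"
    using card_inj_on_le[OF inj_on_mirror[OF sub]] finA by blast
  also have "\<dots> \<le> M" by (rule circleM[OF circ])
  finally show ?thesis .
qed simp

lemma card_parallel_le:
  assumes l: "l \<in> bis a"
  shows "card {l' \<in> bis a. l' = l \<or> l \<inter> l' = {}} \<le> M"
proof -
  let ?P = "{l' \<in> bis a. l' = l \<or> l \<inter> l' = {}}"
  define p where "p = mirror l a"
  have p: "p \<noteq> a" "perp_bisector a p = l" using mirror_bis[OF l] by (auto simp: p_def)
  have line: "is_line (range (\<lambda>t. a + t *\<^sub>R (p - a)))" using p(1) by (intro is_line_through) simp
  have "(\<lambda>l'. mirror l' a) ` ?P \<subseteq> A \<inter> range (\<lambda>t. a + t *\<^sub>R (p - a))"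
  proof clarify
    fix l' assume l': "l' \<in> bis a" "l' = l \<or> l \<inter> l' = {}"
    note m = mirror_bis[OF l'(1)]
    have "mirror l' a \<in> range (\<lambda>t. a + t *\<^sub>R (p - a))"
    proof (cases "l' = l")
      case True
      then have "mirror l' a = a + 1 *\<^sub>R (p - a)" by (simp add: p_def)
      then show ?thesis by blast
    next
      case False
      then obtain t where "mirror l' a = a + t *\<^sub>R (p - a)"
        using disjoint_perp_bisectors_parallel[of a p "mirror l' a"] m p l'(2) by auto
      then show ?thesis by blast
    qed
    then show "mirror l' a \<in> A \<inter> range (\<lambda>t. a + t *\<^sub>R (p - a))" using m(1) by blast
  qed
  then have "card ?P \<le> card (A \<inter> range (\<lambda>t. a + t *\<^sub>R (p - a)))"
    using card_inj_on_le[OF inj_on_mirror[of ?P a]] finA by blast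
  also have "\<dots> \<le> M" by (rule lineM[OF line])
  finally show ?thesis .
qed

lemma finite_crossings: "finite crossings"
  unfolding crossings_def using finA finite_bis by auto

lemma crossing_in_crossings:
  "v \<in> A \<times> A \<Longrightarrow> l \<in> cbis v \<Longrightarrow> l' \<in> cbis v \<Longrightarrow> crossing l l' \<in> crossings"
  unfolding crossings_def cbis_def by force

definition heavy :: "nat \<Rightarrow> (real ^ 2) \<times> (real ^ 2) \<Rightarrow> (real ^ 2) set" where
  "heavy K v = {x \<in> crossings. K \<le> card (pencil v x)}"

lemma finite_heavy: "finite (heavy K v)"
  using finite_crossings by (simp add: heavy_def)

lemma sum_heavy_le:
  assumes "64 \<le> K"
  shows "(\<Sum>x\<in>heavy K v. (real (card (pencil v x)))\<^sup>2) \<le>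
     442368 * ((real (card (cbis v)))\<^sup>2 / real K + real (card (cbis v)) * real M)"
  unfolding heavy_def pencil_def
  by (rule sum_squares_rich_points[OF finite_crossings finite_cbis])
    (use assms pline_bis card_pencil_le[of v] in \<open>auto simp: cbis_def pencil_def\<close>)

lemma rich_eq_card_lines:
  "rich G = card {l \<in> (\<lambda>(p, p'). rotline p p') ` (A \<times> A). G \<in> l}"
proof -
  have "{l \<in> (\<lambda>(p, p'). rotline p p') ` (A \<times> A). G \<in> l} =
      (\<lambda>(p, p'). rotline p p') ` {(p, p'). p \<in> A \<and> p' \<in> A \<and> G \<in> rotline p p'}" by auto
  moreover have "inj_on (\<lambda>(p, p'). rotline p p') {(p, p'). p \<in> A \<and> p' \<in> A \<and> G \<in> rotline p p'}"
    by (rule inj_onI) (auto dest: rotline_inj)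
  ultimately show ?thesis unfolding rich_def by (simp add: card_image)
qed

lemma rich_le: "rich G \<le> card A"
proof -
  have "inj_on fst {(p, p'). p \<in> A \<and> p' \<in> A \<and> G \<in> rotline p p'}"
    by (rule inj_onI) (auto dest: rotline_unique)
  then show ?thesis unfolding rich_def by (rule card_inj_on_le) (use finA in auto)
qed

text \<open>The space bound for the lines \<open>rotline p p'\<close>: a plane contains at most one
  of them for each \<open>p\<close>. For \<open>s\<close> above \<open>card A\<close> nothing is
  counted, because a rotation maps each \<open>p\<close> to one point.\<close>

lemma card_rich_rotations:
  assumes "finite \<G>" and s: "12 \<le> s"
  shows "card {G \<in> \<G>. s \<le> rich G} * s\<^sup>2 \<le> 110592 * card A ^ 3"
proof (cases "s \<le> card A")
  case True
  let ?L = "(\<lambda>(p, p'). rotline p p') ` (A \<times> A)"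
  show ?thesis
  proof (rule Guth_Katz_rich[of ?L])
    show "DIM((real ^ 2) \<times> real) = 3" by simp
    show "finite ?L" using finA by simp
    show "aline l" if "l \<in> ?L" for l using that aline_rotline by auto
    have "card ?L \<le> card (A \<times> A)" using finA by (intro card_image_le) simp
    then show "card ?L \<le> (card A)\<^sup>2" by (simp add: card_cartesian_product power2_eq_square)
    show "card {l \<in> ?L. l \<subseteq> {y. v \<bullet> y = c}} \<le> card A" if v: "v \<noteq> 0" for v :: "(real ^ 2) \<times> real" and c
    proof -
      let ?P = "{(p, p') \<in> A \<times> A. rotline p p' \<subseteq> {y. v \<bullet> y = c}}"
      have "{l \<in> ?L. l \<subseteq> {y. v \<bullet> y = c}} \<subseteq> (\<lambda>(p, p'). rotline p p') ` ?P" by auto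
      moreover have fP: "finite ?P" by (rule finite_subset[of _ "A \<times> A"]) (use finA in auto)
      ultimately have "card {l \<in> ?L. l \<subseteq> {y. v \<bullet> y = c}} \<le> card ?P"
        by (meson card_image_le card_mono finite_imageI le_trans)
      also have "card ?P \<le> card A"
      proof (rule card_inj_on_le)
        show "inj_on fst ?P"
          by (rule inj_onI, clarsimp) (rule rotline_in_plane_unique[OF v])
      qed (use finA in auto)
      finally show ?thesis .
    qed
    show "finite {G \<in> \<G>. s \<le> rich G}" using assms by simp
    show "s \<le> card {l \<in> ?L. G \<in> l}" if "G \<in> {G \<in> \<G>. s \<le> rich G}" for G
      using that rich_eq_card_lines[of G] by simp
  qed (use s True in auto)
next
  case False
  then have *: "{G \<in> \<G>. s \<le> rich G} = {}" using rich_le by (metis (mono_tags, lifting) Collect_empty_eq le_trans)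
  show ?thesis unfolding * by simp
qed

text \<open>In layers, \<open>k\<close> times \<open>N ^ 3 / k\<^sup>2\<close> leaves the harmonic
  sum of \<open>N ^ 3 / k\<close>; this is the origin of the logarithm.\<close>

lemma sum_rich_squares_le:
  assumes G: "finite \<G>" and N: "1 \<le> card A"
  shows "(\<Sum>G | G \<in> \<G> \<and> 12 \<le> rich G. (real (rich G))\<^sup>2) \<le> 110592 * real (card A) ^ 3 * (1 + 2 * ln (real (card A)))"
proof -
  define N where "N = card A"
  define C where "C = 110592 * real N ^ 3"
  have each: "(real k)\<^sup>2 * real (card {G \<in> \<G>. k \<le> rich G}) \<le> C" if "12 \<le> k" for k
  proof -
    have "real (card {G \<in> \<G>. k \<le> rich G} * k\<^sup>2) \<le> real (110592 * card A ^ 3)"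
      using card_rich_rotations[OF G that] by (rule of_nat_mono)
    then show ?thesis by (simp add: C_def N_def mult.commute)
  qed
  have "(\<Sum>G | G \<in> \<G> \<and> 12 \<le> rich G. (real (rich G))\<^sup>2) = real (\<Sum>G | G \<in> \<G> \<and> 12 \<le> rich G. (rich G)\<^sup>2)" by simp
  also have "\<dots> \<le> real (12\<^sup>2 * card {G \<in> \<G>. 12 \<le> rich G} + (\<Sum>k=Suc 12..N. 2 * k * card {G \<in> \<G>. k \<le> rich G}))"
    using sum_squares_layers[OF G, of rich N 12] rich_le unfolding N_def by (intro of_nat_mono) blast
  also have "\<dots> = (real 12)\<^sup>2 * real (card {G \<in> \<G>. 12 \<le> rich G}) + (\<Sum>k=Suc 12..N. 2 * real k * real (card {G \<in> \<G>. k \<le> rich G}))"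
    by simp
  also have "\<dots> \<le> C + (\<Sum>k=Suc 12..N. 2 * C * (1 / real k))"
  proof (intro add_mono sum_mono)
    show "(real 12)\<^sup>2 * real (card {G \<in> \<G>. 12 \<le> rich G}) \<le> C" by (rule each) simp
    fix k assume k: "k \<in> {Suc 12..N}"
    then have k0: "real k > 0" by simp
    have "2 * real k * real (card {G \<in> \<G>. k \<le> rich G}) = 2 * ((real k)\<^sup>2 * real (card {G \<in> \<G>. k \<le> rich G})) / real k"
      using k0 by (simp add: power2_eq_square)
    also have "\<dots> \<le> 2 * C / real k"
      using each[of k] k k0 by (intro divide_right_mono) auto
    finally show "2 * real k * real (card {G \<in> \<G>. k \<le> rich G}) \<le> 2 * C * (1 / real k)" by simp
  qed
  also have "(\<Sum>k=Suc 12..N. 2 * C * (1 / real k)) = 2 * C * (\<Sum>k=Suc 12..N. 1 / real k)"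
    by (simp only: sum_distrib_left)
  also have "\<dots> \<le> 2 * C * ln (real (max N 1))"
    by (intro mult_left_mono sum_inverse_le_ln) (auto simp: C_def)
  also have "max N 1 = N" using N by (simp add: N_def)
  finally show ?thesis by (simp add: C_def N_def algebra_simps)
qed

section \<open>Pairs of common bisectors, sorted by type\<close>

definition paths :: "(((real ^ 2) \<times> (real ^ 2)) \<times> (real ^ 2) set \<times> (real ^ 2) set) set" where
  "paths = (SIGMA v:A \<times> A. cbis v \<times> cbis v)"

text \<open>On the vertex set \<open>A \<times> A\<close> each \<open>l\<close> in
  \<open>cbis v\<close> is an edge from \<open>v\<close> to \<open>mirror2 l v\<close>. An element
  \<open>(v, l, l')\<close> of \<open>paths\<close> is then a path of length two with middle vertex
  \<open>v\<close>.\<close>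

definition mirror2 :: "(real ^ 2) set \<Rightarrow> (real ^ 2) \<times> (real ^ 2) \<Rightarrow> (real ^ 2) \<times> (real ^ 2)" where
  "mirror2 l v = (mirror l (fst v), mirror l (snd v))"

lemma mirror2_cbis:
  assumes "v \<in> A \<times> A" "l \<in> cbis v"
  shows "mirror2 l v \<in> A \<times> A" "l \<in> cbis (mirror2 l v)" "mirror2 l (mirror2 l v) = v"
  using assms mirror_bis[of l "fst v"] mirror_bis[of l "snd v"] mirror_back[of l "fst v"] mirror_back[of l "snd v"]
  by (auto simp: mirror2_def cbis_def)

lemma finite_paths: "finite paths"
  using finA finite_cbis by (simp add: paths_def)

lemma card_paths: "card paths = (\<Sum>v\<in>A \<times> A. (card (cbis v))\<^sup>2)"
  using finA finite_cbis by (simp add: paths_def card_cartesian_product power2_eq_square)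

lemma card_parallel_paths:
  "card {(v, l, l') \<in> paths. l' = l \<or> l \<inter> l' = {}} \<le> M * (\<Sum>v\<in>A \<times> A. card (cbis v))"
proof -
  let ?B = "\<lambda>v l. {l' \<in> bis (fst v). l' = l \<or> l \<inter> l' = {}}"
  let ?S = "SIGMA v:A \<times> A. SIGMA l:cbis v. ?B v l"
  have fin: "finite ?S" using finA finite_cbis finite_bis by (intro finite_SigmaI) auto
  have "{(v, l, l') \<in> paths. l' = l \<or> l \<inter> l' = {}} \<subseteq> ?S"
    by (auto simp: paths_def cbis_def)
  then have "card {(v, l, l') \<in> paths. l' = l \<or> l \<inter> l' = {}} \<le> card ?S" by (rule card_mono[OF fin])
  also have "\<dots> \<le> (\<Sum>v\<in>A \<times> A. \<Sum>l\<in>cbis v. M)"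
    using finA finite_cbis finite_bis
    by (intro card_Sigma_le) (auto simp: cbis_def intro!: card_parallel_le)
  finally show ?thesis by (simp add: sum_distrib_left mult.commute)
qed

lemma card_heavy_paths:
  "card {(v, l, l') \<in> paths. l \<inter> l' \<noteq> {} \<and> K \<le> card (pencil v (crossing l l'))}
     \<le> (\<Sum>v\<in>A \<times> A. \<Sum>x\<in>heavy K v. (card (pencil v x))\<^sup>2)"
proof -
  let ?S = "SIGMA v:A \<times> A. SIGMA x:heavy K v. pencil v x \<times> pencil v x"
  have fin: "finite ?S" using finA finite_heavy finite_pencil by (intro finite_SigmaI) auto
  have "{(v, l, l') \<in> paths. l \<inter> l' \<noteq> {} \<and> K \<le> card (pencil v (crossing l l'))} \<subseteq> (\<lambda>(v, x, l, l'). (v, l, l')) ` ?S"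
  proof clarify
    fix a c l l' assume p: "((a, c), l, l') \<in> paths" and ne: "l \<inter> l' \<noteq> {}" and K: "K \<le> card (pencil (a, c) (crossing l l'))"
    have m: "(a, c) \<in> A \<times> A" "l \<in> cbis (a, c)" "l' \<in> cbis (a, c)" using p by (auto simp: paths_def)
    have "((a, c), crossing l l', l, l') \<in> ?S"
      using m K crossing_mem[OF ne] crossing_in_crossings[OF m] by (auto simp: heavy_def pencil_def)
    then show "((a, c), l, l') \<in> (\<lambda>(v, x, l, l'). (v, l, l')) ` ?S" by force
  qed
  then have "card {(v, l, l') \<in> paths. l \<inter> l' \<noteq> {} \<and> K \<le> card (pencil v (crossing l l'))} \<le> card ?S"
    by (rule surj_card_le[OF fin])
  also have "\<dots> = (\<Sum>v\<in>A \<times> A. \<Sum>x\<in>heavy K v. (card (pencil v x))\<^sup>2)"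
    using finA finite_heavy finite_pencil by (simp add: card_cartesian_product power2_eq_square)
  finally show ?thesis .
qed

text \<open>Count from the end \<open>u = mirror2 l v\<close>. Once \<open>l\<close> is chosen in
  the heavy pencil of \<open>u\<close>, the vertex \<open>v\<close> is known, and \<open>l'\<close>
  is one of fewer than \<open>K\<close> lines; \<open>K\<close> in turn is at most the size of the
  heavy pencil.\<close>

lemma card_heavy_end_paths:
  "card {(v, l, l') \<in> paths. l \<inter> l' \<noteq> {} \<and> card (pencil v (crossing l l')) < K \<and>
       K \<le> card (pencil (mirror2 l v) (crossing l l'))}
     \<le> (\<Sum>v\<in>A \<times> A. \<Sum>x\<in>heavy K v. (card (pencil v x))\<^sup>2)"
proof -
  let ?E = "\<lambda>u x l. {l' \<in> pencil (mirror2 l u) x. card (pencil (mirror2 l u) x) < K}"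
  let ?S = "SIGMA u:A \<times> A. SIGMA x:heavy K u. SIGMA l:pencil u x. ?E u x l"
  let ?P = "{(v, l, l') \<in> paths. l \<inter> l' \<noteq> {} \<and> card (pencil v (crossing l l')) < K \<and>
       K \<le> card (pencil (mirror2 l v) (crossing l l'))}"
  have fin: "finite ?S" using finA finite_heavy finite_pencil by (intro finite_SigmaI) auto
  have "?P \<subseteq> (\<lambda>(u, x, l, l'). (mirror2 l u, l, l')) ` ?S"
  proof
    fix z assume zP: "z \<in> ?P"
    obtain v l l' where z: "z = (v, l, l')" by (metis prod.exhaust)
    have p: "(v, l, l') \<in> paths" and ne: "l \<inter> l' \<noteq> {}"
      and K: "card (pencil v (crossing l l')) < K" "K \<le> card (pencil (mirror2 l v) (crossing l l'))"
      using zP unfolding z by simp_all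
    have m: "v \<in> A \<times> A" "l \<in> cbis v" "l' \<in> cbis v" using p by (auto simp: paths_def)
    note mm = mirror2_cbis[OF m(1,2)]
    have "(mirror2 l v, crossing l l', l, l') \<in> ?S"
      using m mm K crossing_mem[OF ne] crossing_in_crossings[OF m] by (auto simp: heavy_def pencil_def)
    moreover have "z = (\<lambda>(u, x, l, l'). (mirror2 l u, l, l')) (mirror2 l v, crossing l l', l, l')"
      using mm(3) z by simp
    ultimately show "z \<in> (\<lambda>(u, x, l, l'). (mirror2 l u, l, l')) ` ?S" by (rule rev_image_eqI)
  qed
  then have "card ?P \<le> card ?S" by (rule surj_card_le[OF fin])
  also have "\<dots> \<le> (\<Sum>v\<in>A \<times> A. \<Sum>x\<in>heavy K v. (card (pencil v x))\<^sup>2)"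
  proof (rule card_Sigma_le)
    fix u assume "u \<in> A \<times> A"
    show "card (SIGMA x:heavy K u. SIGMA l:pencil u x. ?E u x l) \<le> (\<Sum>x\<in>heavy K u. (card (pencil u x))\<^sup>2)"
    proof (rule card_Sigma_le)
      fix x assume x: "x \<in> heavy K u"
      have "card (SIGMA l:pencil u x. ?E u x l) \<le> (\<Sum>l\<in>pencil u x. K)"
      proof (rule card_Sigma_le)
        fix l
        show "card (?E u x l) \<le> K" by (cases "card (pencil (mirror2 l u) x) < K") auto
      qed (use finite_pencil in auto)
      also have "\<dots> = card (pencil u x) * K" by simp
      also have "\<dots> \<le> (card (pencil u x))\<^sup>2" using x by (simp add: heavy_def power2_eq_square)
      finally show "card (SIGMA l:pencil u x. ?E u x l) \<le> (card (pencil u x))\<^sup>2" .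
    qed (use finite_heavy finite_pencil in \<open>auto intro!: finite_SigmaI\<close>)
  qed (use finA finite_heavy finite_pencil in \<open>auto intro!: finite_SigmaI\<close>)
  finally show ?thesis .
qed

text \<open>The choice of \<open>a\<close>, \<open>l\<close>, \<open>l'\<close> costs
  \<open>N ^ 3\<close> and fixes the rotation. Then \<open>c\<close> is determined by the pair of
  its two mirror images, which is among the fewer than 12 pairs that \<open>rich\<close>
  counts.\<close>

lemma card_poor_rotation_paths:
  "card {(v, l, l') \<in> paths. l \<noteq> l' \<and> l \<inter> l' \<noteq> {} \<and> rich (rotation l l') < 12} \<le> 12 * card A ^ 3"
proof -
  let ?C = "\<lambda>l l'. {c \<in> A. l \<in> bis c \<and> l' \<in> bis c \<and> l \<noteq> l' \<and> l \<inter> l' \<noteq> {} \<and> rich (rotation l l') < 12}"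
  let ?S = "SIGMA a:A. SIGMA l:bis a. SIGMA l':bis a. ?C l l'"
  let ?P = "{(v, l, l') \<in> paths. l \<noteq> l' \<and> l \<inter> l' \<noteq> {} \<and> rich (rotation l l') < 12}"
  have fin: "finite ?S" using finA finite_bis by (intro finite_SigmaI) auto
  have "?P \<subseteq> (\<lambda>(a, l, l', c). ((a, c), l, l')) ` ?S"
  proof
    fix z assume z: "z \<in> ?P"
    obtain a c l l' where zz: "z = ((a, c), l, l')" by (metis prod.exhaust)
    have "(a, l, l', c) \<in> ?S" using z unfolding zz by (auto simp: paths_def cbis_def)
    then show "z \<in> (\<lambda>(a, l, l', c). ((a, c), l, l')) ` ?S" by (rule rev_image_eqI) (simp add: zz)
  qed
  then have "card ?P \<le> card ?S" by (rule surj_card_le[OF fin])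
  also have "\<dots> \<le> (\<Sum>a\<in>A. card A * (card A * 12))"
  proof (rule card_Sigma_le)
    fix a assume "a \<in> A"
    have "card (SIGMA l:bis a. SIGMA l':bis a. ?C l l') \<le> (\<Sum>l\<in>bis a. card A * 12)"
    proof (rule card_Sigma_le)
      fix l
      have "card (SIGMA l':bis a. ?C l l') \<le> (\<Sum>l'\<in>bis a. 12)"
      proof (rule card_Sigma_le)
        fix l'
        show "card (?C l l') \<le> 12"
        proof (cases "?C l l' = {}")
          case False
          then have ll: "l \<noteq> l'" "l \<inter> l' \<noteq> {}" "rich (rotation l l') < 12" by auto
          have "inj_on (\<lambda>c. (mirror l c, mirror l' c)) (?C l l')"
          proof (rule inj_onI)
            fix c c' assume "c \<in> ?C l l'" "c' \<in> ?C l l'" "(mirror l c, mirror l' c) = (mirror l c', mirror l' c')"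
            then have "l \<in> bis c" "c \<in> A" "l \<in> bis c'" "c' \<in> A" "mirror l c = mirror l c'" by simp_all
            then show "c = c'" using mirror_back(2) by metis
          qed
          moreover have "(\<lambda>c. (mirror l c, mirror l' c)) ` ?C l l' \<subseteq> {(p, p'). p \<in> A \<and> p' \<in> A \<and> rotation l l' \<in> rotline p p'}"
          proof clarify
            fix c assume c: "l \<in> bis c" "l' \<in> bis c"
            have "rotation l l' \<in> rotline (mirror l c) (mirror l' c)"
              using ll mirror_bis[OF c(1)] mirror_bis[OF c(2)] by (intro rotation_mem_rotline[where a=c]) auto
            then show "mirror l c \<in> A \<and> mirror l' c \<in> A \<and> rotation l l' \<in> rotline (mirror l c) (mirror l' c)"
              using mirror_bis(1) c by blast
          qed
          moreover have "finite {(p, p'). p \<in> A \<and> p' \<in> A \<and> rotation l l' \<in> rotline p p'}"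
            by (rule finite_subset[of _ "A \<times> A"]) (use finA in auto)
          ultimately have "card (?C l l') \<le> rich (rotation l l')"
            unfolding rich_def by (rule card_inj_on_le)
          then show ?thesis using ll(3) by simp
        next
          case True
          show ?thesis unfolding True by simp
        qed
      qed (use finite_bis finA in auto)
      also have "\<dots> \<le> card A * 12" using card_bis_le[of a] by simp
      finally show "card (SIGMA l':bis a. ?C l l') \<le> card A * 12" .
    qed (use finite_bis finA in \<open>auto intro!: finite_SigmaI\<close>)
    also have "\<dots> \<le> card A * (card A * 12)" using card_bis_le[of a] by simp
    finally show "card (SIGMA l:bis a. SIGMA l':bis a. ?C l l') \<le> card A * (card A * 12)" .
  qed (use finite_bis finA in \<open>auto intro!: finite_SigmaI\<close>)
  finally show ?thesis by (simp add: power3_eq_cube algebra_simps)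
qed

lemma card_rich_rotation_paths:
  assumes N: "1 \<le> card A"
  shows "real (card {(v, l, l') \<in> paths. l \<noteq> l' \<and> l \<inter> l' \<noteq> {} \<and> card (pencil (mirror2 l v) (crossing l l')) < K \<and>
       12 \<le> rich (rotation l l')}) \<le> real K * (110592 * real (card A) ^ 3 * (1 + 2 * ln (real (card A))))"
proof -
  define LL where "LL = (\<Union>a\<in>A. bis a)"
  define \<G> where "\<G> = (\<lambda>(l, l'). rotation l l') ` (LL \<times> LL)"
  have fG: "finite \<G>" using finA finite_bis by (simp add: \<G>_def LL_def)
  define X where "X = (\<lambda>G. {p \<in> A. \<exists>p'\<in>A. G \<in> rotline p p'})"
  have fX: "finite (X G)" for G using finA by (simp add: X_def)
  have cX: "card (X G) \<le> rich G" for G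
  proof -
    have "X G \<subseteq> fst ` {(p, p'). p \<in> A \<and> p' \<in> A \<and> G \<in> rotline p p'}" by (force simp: X_def)
    moreover have "finite {(p, p'). p \<in> A \<and> p' \<in> A \<and> G \<in> rotline p p'}"
      by (rule finite_subset[of _ "A \<times> A"]) (use finA in auto)
    ultimately show ?thesis unfolding rich_def by (intro surj_card_le) auto
  qed
  let ?E = "\<lambda>G u. {l \<in> pencil u (fst G). card (pencil u (fst G)) < K}"
  let ?S = "SIGMA G:{G \<in> \<G>. 12 \<le> rich G}. SIGMA u:X G \<times> X G. ?E G u"
  let ?P = "{(v, l, l') \<in> paths. l \<noteq> l' \<and> l \<inter> l' \<noteq> {} \<and> card (pencil (mirror2 l v) (crossing l l')) < K \<and>
       12 \<le> rich (rotation l l')}"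
  \<comment> \<open>The decoding of a rotation \<open>G\<close>, an end \<open>u\<close> and a line
    \<open>l\<close> of its small pencil at the center: reflecting \<open>u\<close> back gives
    \<open>v\<close>, and \<open>l'\<close> is the bisector of its first point and the image under
    \<open>G\<close> of the first point of \<open>u\<close>.\<close>
  define \<phi> where "\<phi> = (\<lambda>(G, u, l). (mirror2 l u, l,
     perp_bisector (mirror l (fst u)) (SOME p'. p' \<in> A \<and> G \<in> rotline (fst u) p')))"
  have fin: "finite ?S" using fG fX finite_pencil by (intro finite_SigmaI) auto
  have "?P \<subseteq> \<phi> ` ?S"
  proof
    fix z assume z: "z \<in> ?P"
    obtain a c l l' where zz: "z = ((a, c), l, l')" by (metis prod.exhaust)
    have p: "((a, c), l, l') \<in> paths" and ne: "l \<noteq> l'" "l \<inter> l' \<noteq> {}"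
      and K: "card (pencil (mirror2 l (a, c)) (crossing l l')) < K" "12 \<le> rich (rotation l l')"
      using z unfolding zz by auto
    have m: "(a, c) \<in> A \<times> A" "l \<in> cbis (a, c)" "l' \<in> cbis (a, c)" using p by (auto simp: paths_def)
    note mm = mirror2_cbis[OF m(1,2)]
    have la: "l \<in> bis a" "l' \<in> bis a" "l \<in> bis c" "l' \<in> bis c" "a \<in> A" "c \<in> A" using m by (auto simp: cbis_def)
    let ?G = "rotation l l'"
    have Ga: "?G \<in> rotline (mirror l a) (mirror l' a)"
      using ne mirror_bis[OF la(1)] mirror_bis[OF la(2)] by (intro rotation_mem_rotline[where a=a]) auto
    have Gc: "?G \<in> rotline (mirror l c) (mirror l' c)"
      using ne mirror_bis[OF la(3)] mirror_bis[OF la(4)] by (intro rotation_mem_rotline[where a=c]) auto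
    have "?G \<in> \<G>" using la by (force simp: \<G>_def LL_def)
    moreover have "mirror2 l (a, c) \<in> X ?G \<times> X ?G"
      using Ga Gc mirror_bis(1) la by (auto simp: X_def mirror2_def)
    moreover have "l \<in> ?E ?G (mirror2 l (a, c))"
      using mm(2) crossing_mem[OF ne(2)] K(1) by (simp add: pencil_def rotation_def)
    ultimately have S: "(?G, mirror2 l (a, c), l) \<in> ?S" using K(2) by auto
    have sm: "(SOME p'. p' \<in> A \<and> ?G \<in> rotline (mirror l a) p') = mirror l' a"
      by (rule some_equality) (use Ga mirror_bis(1)[OF la(2)] rotline_unique in blast)+
    have "\<phi> (?G, mirror2 l (a, c), l) = z"
      using mm(3) sm mirror_back(2)[OF la(1,5)] mirror_bis(3)[OF la(2)] unfolding zz by (simp add: \<phi>_def mirror2_def)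
    then show "z \<in> \<phi> ` ?S" by (intro rev_image_eqI[OF S]) simp
  qed
  then have "card ?P \<le> card ?S" by (rule surj_card_le[OF fin])
  also have "\<dots> \<le> (\<Sum>G | G \<in> \<G> \<and> 12 \<le> rich G. (rich G)\<^sup>2 * K)"
  proof (rule card_Sigma_le)
    fix G
    have "card (SIGMA u:X G \<times> X G. ?E G u) \<le> (\<Sum>u\<in>X G \<times> X G. K)"
    proof (rule card_Sigma_le)
      fix u
      show "card (?E G u) \<le> K" by (cases "card (pencil u (fst G)) < K") auto
    qed (use fX finite_pencil in auto)
    also have "\<dots> = (card (X G))\<^sup>2 * K" by (simp add: card_cartesian_product power2_eq_square)
    also have "\<dots> \<le> (rich G)\<^sup>2 * K" using cX[of G] by (intro mult_right_mono power_mono) auto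
    finally show "card (SIGMA u:X G \<times> X G. ?E G u) \<le> (rich G)\<^sup>2 * K" .
  qed (use fG fX finite_pencil in \<open>auto intro!: finite_SigmaI\<close>)
  finally have "card ?P \<le> (\<Sum>G | G \<in> \<G> \<and> 12 \<le> rich G. (rich G)\<^sup>2 * K)" .
  then have "real (card ?P) \<le> real (\<Sum>G | G \<in> \<G> \<and> 12 \<le> rich G. (rich G)\<^sup>2 * K)" by (rule of_nat_mono)
  also have "\<dots> = real K * (\<Sum>G | G \<in> \<G> \<and> 12 \<le> rich G. (real (rich G))\<^sup>2)"
    by (simp add: sum_distrib_left mult.commute)
  also have "\<dots> \<le> real K * (110592 * real (card A) ^ 3 * (1 + 2 * ln (real (card A))))"
    by (intro mult_left_mono sum_rich_squares_le fG N) auto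
  finally show ?thesis .
qed

text \<open>A quadruple is determined by \<open>a\<close>, \<open>c\<close> and the shared line,
  since \<open>b\<close> and \<open>d\<close> are the reflections of \<open>a\<close> and
  \<open>c\<close> in it.\<close>

lemma bisector_energy_le: "bisector_energy A \<le> (\<Sum>v\<in>A \<times> A. card (cbis v))"
proof -
  let ?E = "{(a, b, c, d). a \<in> A \<and> b \<in> A \<and> c \<in> A \<and> d \<in> A \<and> a \<noteq> b \<and> c \<noteq> d \<and> perp_bisector a b = perp_bisector c d}"
  let ?f = "\<lambda>(a, b, c, d). ((a, c), perp_bisector a b)"
  have "inj_on ?f ?E"
  proof (rule inj_onI)
    fix z w assume zw: "z \<in> ?E" "w \<in> ?E" "?f z = ?f w"
    obtain a b c d where z: "z = (a, b, c, d)" by (metis prod.exhaust)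
    obtain a' b' c' d' where w: "w = (a', b', c', d')" by (metis prod.exhaust)
    have eq: "a' = a" "c' = c" "perp_bisector a b = perp_bisector a b'" using zw(3) by (auto simp: z w)
    have h: "a \<noteq> b" "c \<noteq> d" "perp_bisector a b = perp_bisector c d"
      "a \<noteq> b'" "c \<noteq> d'" "perp_bisector a b' = perp_bisector c d'" using zw(1,2) eq by (simp_all add: z w)
    have "b = b'" by (rule perp_bisector_inj[OF h(1,4) eq(3)])
    moreover have "d = d'" by (rule perp_bisector_inj[OF h(2,5)]) (use h eq in simp)
    ultimately show "z = w" using eq by (simp add: z w)
  qed
  moreover have "?f ` ?E \<subseteq> (SIGMA v:A \<times> A. cbis v)"
    by (auto simp: cbis_def bis_def)
  moreover have "finite (SIGMA v:A \<times> A. cbis v)" using finA finite_cbis by (intro finite_SigmaI) auto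
  ultimately have "card ?E \<le> card (SIGMA v:A \<times> A. cbis v)" by (rule card_inj_on_le)
  then show ?thesis unfolding bisector_energy_def using finA finite_cbis by simp
qed

lemma card_paths_le:
  assumes N: "2 \<le> card A"
  defines "Q \<equiv> (\<Sum>v\<in>A \<times> A. real (card (cbis v)))"
  shows "real (card paths) \<le> 1769474 * real M * Q + 1565515579440 * (real (card A) ^ 3 * ln (real (card A)))"
proof -
  \<comment> \<open>Four times the constant 442368 of \<open>sum_heavy_le\<close>: each of the two
    heavy classes then contains at most \<open>S / 4\<close> plus a multiple of
    \<open>M * Q\<close>, and both are absorbed into \<open>S\<close>.\<close>
  define K :: nat where "K = 1769472"
  define T where "T = real (card A) ^ 3"
  define S where "S = real (card paths)"
  define H where "H = (\<Sum>v\<in>A \<times> A. \<Sum>x\<in>heavy K v. (real (card (pencil v x)))\<^sup>2)"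
  have Sq: "S = (\<Sum>v\<in>A \<times> A. (real (card (cbis v)))\<^sup>2)" by (simp add: S_def card_paths)
  let ?P0 = "{(v, l, l') \<in> paths. l' = l \<or> l \<inter> l' = {}}"
  let ?P1 = "{(v, l, l') \<in> paths. l \<inter> l' \<noteq> {} \<and> K \<le> card (pencil v (crossing l l'))}"
  let ?P2 = "{(v, l, l') \<in> paths. l \<inter> l' \<noteq> {} \<and> card (pencil v (crossing l l')) < K \<and>
       K \<le> card (pencil (mirror2 l v) (crossing l l'))}"
  let ?P3 = "{(v, l, l') \<in> paths. l \<noteq> l' \<and> l \<inter> l' \<noteq> {} \<and> rich (rotation l l') < 12}"
  let ?P4 = "{(v, l, l') \<in> paths. l \<noteq> l' \<and> l \<inter> l' \<noteq> {} \<and> card (pencil (mirror2 l v) (crossing l l')) < K \<and>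
       12 \<le> rich (rotation l l')}"
  have "paths \<subseteq> ?P0 \<union> (?P1 \<union> (?P2 \<union> (?P3 \<union> ?P4)))" by (auto simp: not_le not_less)
  then have "card paths \<le> card (?P0 \<union> (?P1 \<union> (?P2 \<union> (?P3 \<union> ?P4))))"
    by (rule card_mono[rotated]) (intro finite_UnI; rule finite_subset[OF _ finite_paths]; force)
  also have "\<dots> \<le> card ?P0 + (card ?P1 + (card ?P2 + (card ?P3 + card ?P4)))"
    by (intro order_trans[OF card_Un_le] add_left_mono) simp
  finally have "S \<le> real (card ?P0 + (card ?P1 + (card ?P2 + (card ?P3 + card ?P4))))"
    unfolding S_def by (rule of_nat_mono)
  then have all: "S \<le> real (card ?P0) + real (card ?P1) + real (card ?P2) + real (card ?P3) + real (card ?P4)" by simp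
  have 0: "real (card ?P0) \<le> real M * Q"
    using of_nat_mono[OF card_parallel_paths, where 'a=real] by (simp add: Q_def)
  have 1: "real (card ?P1) \<le> H"
    using of_nat_mono[OF card_heavy_paths[of K], where 'a=real] by (simp add: H_def)
  have 2: "real (card ?P2) \<le> H"
    using of_nat_mono[OF card_heavy_end_paths[of K], where 'a=real] by (simp add: H_def)
  have 3: "real (card ?P3) \<le> 12 * T"
    using of_nat_mono[OF card_poor_rotation_paths, where 'a=real] by (simp add: T_def)
  have 4: "real (card ?P4) \<le> real K * (110592 * T * (1 + 2 * ln (real (card A))))"
    using card_rich_rotation_paths[of K] N by (simp add: T_def)
  have "H \<le> (\<Sum>v\<in>A \<times> A. 442368 * ((real (card (cbis v)))\<^sup>2 / real K + real (card (cbis v)) * real M))"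
    unfolding H_def by (intro sum_mono sum_heavy_le) (simp add: K_def)
  also have "\<dots> = 442368 * (S / real K + Q * real M)"
    by (simp add: Sq Q_def sum.distrib sum_distrib_left sum_distrib_right sum_divide_distrib)
  finally have H: "H \<le> S / 4 + 442368 * (real M * Q)" by (simp add: K_def algebra_simps)
  \<comment> \<open>With at least two points this lets the terms in \<open>T\<close> without a
    logarithm be replaced by \<open>2 * T * ln N\<close>.\<close>
  have "ln 2 \<ge> (1/2 :: real)" using exp_half_le2 by (subst ln_ge_iff) auto
  moreover have "ln (real (card A)) \<ge> ln 2" using N by simp
  ultimately have ln: "1 \<le> 2 * ln (real (card A))" by linarith
  have "T * 1 \<le> T * (2 * ln (real (card A)))" using ln by (intro mult_left_mono) (auto simp: T_def)
  then have TL: "T \<le> 2 * (T * ln (real (card A)))" by simp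
  have "real K * (110592 * T * (1 + 2 * ln (real (card A)))) = 195689447424 * T + 391378894848 * (T * ln (real (card A)))"
    by (simp add: K_def algebra_simps)
  then have "S / 2 \<le> 884737 * (real M * Q) + 195689447436 * T + 391378894848 * (T * ln (real (card A)))"
    using all 0 1 2 3 4 H by linarith
  then have "S \<le> 1769474 * (real M * Q) + 1565515579440 * (T * ln (real (card A)))" using TL by linarith
  then show ?thesis by (simp add: S_def T_def)
qed

text \<open>Cauchy-Schwarz turns the bound on \<open>paths\<close> into
  \<open>Q\<^sup>2 \<le> \<alpha> * Q + \<beta>\<close>, and this quadratic inequality implies
  \<open>Q \<le> \<alpha> + sqrt \<beta>\<close>.\<close>

lemma bisector_energy_bound:
  assumes N: "2 \<le> card A"
  shows "real (bisector_energy A) \<le> 1769474 * (real M * real (card A) ^ 2) +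
     sqrt 1565515579440 * (sqrt (ln (real (card A))) * real (card A) powr (5 / 2))"
proof -
  define n where "n = real (card A)"
  define Q where "Q = (\<Sum>v\<in>A \<times> A. real (card (cbis v)))"
  have n: "n \<ge> 2" using N by (simp add: n_def)
  have Q0: "Q \<ge> 0" by (simp add: Q_def sum_nonneg)
  have "Q\<^sup>2 = (\<Sum>v\<in>A \<times> A. 1 * real (card (cbis v)))\<^sup>2" by (simp add: Q_def)
  also have "\<dots> \<le> (\<Sum>v\<in>A \<times> A. 1\<^sup>2) * (\<Sum>v\<in>A \<times> A. (real (card (cbis v)))\<^sup>2)"
    by (rule Cauchy_Schwarz_ineq_sum)
  also have "\<dots> = n\<^sup>2 * real (card paths)"
    by (simp add: card_paths card_cartesian_product n_def power2_eq_square)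
  also have "\<dots> \<le> n\<^sup>2 * (1769474 * real M * Q + 1565515579440 * (n ^ 3 * ln n))"
    using card_paths_le[OF N] by (intro mult_left_mono) (auto simp: Q_def n_def)
  also have "\<dots> = (1769474 * (real M * n\<^sup>2)) * Q + 1565515579440 * (n ^ 5 * ln n)"
    by (simp add: algebra_simps flip: power_add)
  finally have quad: "Q\<^sup>2 \<le> (1769474 * (real M * n\<^sup>2)) * Q + 1565515579440 * (n ^ 5 * ln n)" .
  define \<alpha> where "\<alpha> = 1769474 * (real M * n\<^sup>2)"
  define \<beta> where "\<beta> = 1565515579440 * (n ^ 5 * ln n)"
  have ab: "\<alpha> \<ge> 0" "\<beta> \<ge> 0" using n by (auto simp: \<alpha>_def \<beta>_def)
  have "Q \<le> \<alpha> + sqrt \<beta>"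
  proof (rule ccontr)
    assume "\<not> ?thesis"
    then have gt: "Q - \<alpha> > sqrt \<beta>" by simp
    have "sqrt \<beta> * sqrt \<beta> \<le> Q * sqrt \<beta>" using gt ab by (intro mult_right_mono) auto
    also have "\<dots> < Q * (Q - \<alpha>)"
    proof (rule mult_strict_left_mono[OF gt])
      show "0 < Q" using gt ab real_sqrt_ge_zero[of \<beta>] by linarith
    qed
    finally have "\<beta> < Q\<^sup>2 - \<alpha> * Q" using ab by (simp add: power2_eq_square algebra_simps)
    then show False using quad by (simp add: \<alpha>_def \<beta>_def)
  qed
  moreover have "sqrt \<beta> = sqrt 1565515579440 * (sqrt (ln n) * n powr (5 / 2))"
  proof -
    have "sqrt (n ^ 5) = n powr (5 / 2)"
    proof -
      have "n ^ 5 = n powr 5" using n by (simp add: powr_numeral)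
      then have "sqrt (n ^ 5) = (n powr 5) powr (1 / 2)" using n by (simp add: powr_half_sqrt)
      also have "\<dots> = n powr (5 / 2)" by (simp add: powr_powr)
      finally show ?thesis .
    qed
    then show ?thesis by (simp add: \<beta>_def real_sqrt_mult)
  qed
  moreover have "real (bisector_energy A) \<le> Q"
    using of_nat_mono[OF bisector_energy_le, where 'a=real] by (simp add: Q_def)
  ultimately show ?thesis by (simp add: \<alpha>_def n_def)
qed

end

theorem theorem2:
  "\<exists>C::real. 0 < C \<and>
     (\<forall>(A :: (real ^ 2) set) (N :: nat) (M :: nat).
        finite A \<longrightarrow> card A = N \<longrightarrow>
        (\<forall>L. is_line L \<longrightarrow> card (A \<inter> L) \<le> M) \<longrightarrow>
        (\<forall>S. is_circle S \<longrightarrow> card (A \<inter> S) \<le> M) \<longrightarrow>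
        real (bisector_energy A)
          \<le> C * (real M * real N ^ 2 + sqrt (ln (real N)) * real N powr (5 / 2)))"
proof (intro exI[of _ "1769474 + sqrt 1565515579440"] conjI allI impI)
  show "0 < 1769474 + sqrt 1565515579440" by (intro add_pos_nonneg) auto
  fix A :: "(real ^ 2) set" and N M :: nat
  assume A: "finite A" "card A = N"
    and lines: "\<forall>L. is_line L \<longrightarrow> card (A \<inter> L) \<le> M"
    and circles: "\<forall>S. is_circle S \<longrightarrow> card (A \<inter> S) \<le> M"
  interpret point_set A M
    by unfold_locales (use A lines circles in auto)
  define X Y where "X = real M * real N ^ 2" and "Y = sqrt (ln (real N)) * real N powr (5 / 2)"
  show "real (bisector_energy A) \<le> (1769474 + sqrt 1565515579440) * (real M * real N ^ 2 + sqrt (ln (real N)) * real N powr (5 / 2))"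
  proof (cases "2 \<le> card A")
    case True
    then have "X \<ge> 0" "Y \<ge> 0" using A by (auto simp: X_def Y_def)
    then have "1769474 * X + sqrt 1565515579440 * Y \<le> (1769474 + sqrt 1565515579440) * (X + Y)"
      by (simp add: algebra_simps)
    then show ?thesis using bisector_energy_bound[OF True] A(2) by (simp add: X_def Y_def)
  next
    case False
    then have "card A \<le> Suc 0" by simp
    then have "x = y" if "x \<in> A" "y \<in> A" for x y using card_le_Suc0_iff_eq[OF A(1)] that by blast
    then have "{(a, b, c, d). a \<in> A \<and> b \<in> A \<and> c \<in> A \<and> d \<in> A \<and>
       a \<noteq> b \<and> c \<noteq> d \<and> perp_bisector a b = perp_bisector c d} = {}" by auto
    then have "bisector_energy A = 0" unfolding bisector_energy_def by (metis card.empty)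
    \<comment> \<open>For \<open>N = 1\<close> the logarithm is 0; for \<open>N = 0\<close> the
      factor \<open>0 powr (5 / 2)\<close> is 0, whatever value \<open>ln 0\<close> has.\<close>
    moreover have "0 \<le> X + Y"
      using False A by (cases "N = 0") (auto simp: X_def Y_def not_le less_Suc_eq numeral_2_eq_2)
    ultimately show ?thesis by (simp add: X_def Y_def)
  qed
qed

end
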